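(* Let $H$ be a finitely generated free abelian group, and let $k\ge 1$. There exist exact sequences $$0\to\mathsf{D}'_{2k}(H)\to\mathsf{D}_{2k}(H)\to\mathsf{L}_{k+1}(H)\otimes\mathbb{Z}/2\to 0,$$ $$0\to H\otimes\mathsf{L}_k(H)\otimes\mathbb{Z}/2\to\mathsf{D}'_{2k-1}(H)\to\mathsf{D}_{2k-1}(H)\to 0,$$ in which the maps $\mathsf{D}'_n(H)\to\mathsf{D}_n(H)$ are the canonical ones.
   Context: $\mathsf{L}(H)=\bigoplus_n\mathsf{L}_n(H)$ is the free Lie algebra over $\mathbb{Z}$ on $H$, graded with $H$ in degree $1$ (so $[\alpha,\alpha]=0$ for all $\alpha$). A quasi-Lie algebra (over $\mathbb{Z}$) is an abelian group with a bilinear bracket satisfying $[\alpha,\beta]+[\beta,\alpha]=0$ and the Jacobi identity $[[\alpha,\beta],\gamma]+[[\beta,\gamma],\alpha]+[[\gamma,\alpha],\beta]=0$; the relation $[\alpha,\alpha]=0$ is not required. $\mathsf{L}'(H)=\bigoplus_n \mathsf{L}'_n(H)$ is the free quasi-Lie algebra on $H$, graded with $H$ in degree $1$. There is a canonical epimorphism $\gamma_n:\mathsf{L}'_n(H)\to\mathsf{L}_n(H)$ (the degree $n$ part of the bracket-preserving map which is the identity on $H$). $\mathsf{D}_n(H)$ is the kernel of the bracket map $H\otimes\mathsf{L}_{n+1}(H)\to\mathsf{L}_{n+2}(H)$, $h\otimes\lambda\mapsto[h,\lambda]$. $\mathsf{D}'_n(H)$ is the kernel of the bracket map $\beta'_n:H\otimes\mathsf{L}'_{n+1}(H)\to\mathsf{L}'_{n+2}(H)$,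 $h\otimes\lambda\mapsto[h,\lambda]$. The canonical map $\mathsf{D}'_n(H)\to\mathsf{D}_n(H)$ is the restriction of $\mathrm{id}_H\otimes\gamma_{n+1}$. *)

theory Defs
  imports "HOL-Algebra.Free_Abelian_Groups" "HOL-Algebra.Exact_Sequence"
begin

text \<open>Abelian groups are commutative groups of HOL-Algebra and are therefore written
  multiplicatively; in \<^const>\<open>free_Abelian_group\<close>, whose elements are formal integer
  combinations, the operation is the addition of combinations.\<close>

definition fg_free_abelian_group :: "('a, 'm) monoid_scheme \<Rightarrow> bool" where
  "fg_free_abelian_group H \<longleftrightarrow>
     comm_group H \<and> (\<exists>n::nat. free_Abelian_group {..<n} \<cong> H)"

text \<open>The library's \<^const>\<open>short_exact_sequence\<close> requires the three groups to have the
  same element type (and lists them from right to left).\<close>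

definition short_exact ::
  "('a, 'm) monoid_scheme \<Rightarrow> ('b, 'n) monoid_scheme \<Rightarrow> ('c, 'o) monoid_scheme
     \<Rightarrow> ('a \<Rightarrow> 'b) \<Rightarrow> ('b \<Rightarrow> 'c) \<Rightarrow> bool" where
  "short_exact A B C f g \<longleftrightarrow>
     group A \<and> group B \<and> group C \<and>
     f \<in> mon A B \<and> g \<in> epi B C \<and> f ` carrier A = kernel B C g"

lemma short_exact_eq_short_exact_sequence:
  "short_exact A B C f g \<longleftrightarrow> short_exact_sequence C B A g f"
  unfolding short_exact_def short_exact_sequence_iff
  by (auto simp: group_hom_def group_hom_axioms_def mon_def epi_def)


section \<open>Tensor products of abelian groups\<close>

text \<open>The homomorphism from the free abelian group on \<open>S\<close> which extends \<open>f\<close>.\<close>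

definition free_extend ::
  "'p set \<Rightarrow> ('k, 'm) monoid_scheme \<Rightarrow> ('p \<Rightarrow> 'k) \<Rightarrow> ('p \<Rightarrow>\<^sub>0 int) \<Rightarrow> 'k" where
  "free_extend S K f x = gfinprod K (\<lambda>p. f p [^]\<^bsub>K\<^esub> Poly_Mapping.lookup x p) S"

abbreviation pair_group ::
  "('a, 'm) monoid_scheme \<Rightarrow> ('b, 'n) monoid_scheme \<Rightarrow> ('a \<times> 'b \<Rightarrow>\<^sub>0 int) monoid" where
  "pair_group G H \<equiv> free_Abelian_group (carrier G \<times> carrier H)"

definition bilinearity_relations ::
  "('a, 'm) monoid_scheme \<Rightarrow> ('b, 'n) monoid_scheme \<Rightarrow> ('a \<times> 'b \<Rightarrow>\<^sub>0 int) set" where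
  "bilinearity_relations G H =
     {frag_of (a \<otimes>\<^bsub>G\<^esub> a', b) - frag_of (a, b) - frag_of (a', b) | a a' b.
        a \<in> carrier G \<and> a' \<in> carrier G \<and> b \<in> carrier H} \<union>
     {frag_of (a, b \<otimes>\<^bsub>H\<^esub> b') - frag_of (a, b) - frag_of (a, b') | a b b'.
        a \<in> carrier G \<and> b \<in> carrier H \<and> b' \<in> carrier H}"

abbreviation bilinearity_subgroup ::
  "('a, 'm) monoid_scheme \<Rightarrow> ('b, 'n) monoid_scheme \<Rightarrow> ('a \<times> 'b \<Rightarrow>\<^sub>0 int) set" where
  "bilinearity_subgroup G H \<equiv> generate (pair_group G H) (bilinearity_relations G H)"

definition tensor ::
  "('a, 'm) monoid_scheme \<Rightarrow> ('b, 'n) monoid_scheme \<Rightarrow> ('a \<times> 'b \<Rightarrow>\<^sub>0 int) set monoid" where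
  "tensor G H = pair_group G H Mod bilinearity_subgroup G H"

definition tensor_of ::
  "('a, 'm) monoid_scheme \<Rightarrow> ('b, 'n) monoid_scheme \<Rightarrow> 'a \<Rightarrow> 'b
     \<Rightarrow> ('a \<times> 'b \<Rightarrow>\<^sub>0 int) set" where
  "tensor_of G H a b = bilinearity_subgroup G H #>\<^bsub>pair_group G H\<^esub> frag_of (a, b)"

text \<open>The homomorphism \<open>G \<otimes> H \<rightarrow> K\<close> induced by a bilinear map \<open>f\<close>.\<close>

definition tensor_lift ::
  "('a, 'm) monoid_scheme \<Rightarrow> ('b, 'n) monoid_scheme \<Rightarrow> ('k, 'o) monoid_scheme
     \<Rightarrow> ('a \<Rightarrow> 'b \<Rightarrow> 'k) \<Rightarrow> ('a \<times> 'b \<Rightarrow>\<^sub>0 int) set \<Rightarrow> 'k" where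
  "tensor_lift G H K f X =
     the_elem (free_extend (carrier G \<times> carrier H) K (case_prod f) ` X)"

definition tensor_map ::
  "('a, 'm) monoid_scheme \<Rightarrow> ('b, 'n) monoid_scheme
     \<Rightarrow> ('c, 'o) monoid_scheme \<Rightarrow> ('d, 'p) monoid_scheme
     \<Rightarrow> ('a \<Rightarrow> 'c) \<Rightarrow> ('b \<Rightarrow> 'd) \<Rightarrow> ('a \<times> 'b \<Rightarrow>\<^sub>0 int) set \<Rightarrow> ('c \<times> 'd \<Rightarrow>\<^sub>0 int) set" where
  "tensor_map G H G' H' f g =
     tensor_lift G H (tensor G' H') (\<lambda>a b. tensor_of G' H' (f a) (g b))"

lemma (in comm_group) mult_cancel_inv:
  "\<lbrakk>x \<in> carrier G; y \<in> carrier G\<rbrakk> \<Longrightarrow> x \<otimes> y \<otimes> inv x \<otimes> inv y = \<one>"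
  by (metis inv_closed m_assoc m_closed m_comm r_inv inv_mult)

lemma keys_subset_add:
  "\<lbrakk>Poly_Mapping.keys x \<subseteq> S; Poly_Mapping.keys y \<subseteq> S\<rbrakk> \<Longrightarrow> Poly_Mapping.keys (x + y) \<subseteq> S"
  using Poly_Mapping.keys_add[of x y] by blast

lemma keys_subset_diff:
  fixes x y :: "'a \<Rightarrow>\<^sub>0 int"
  shows "\<lbrakk>Poly_Mapping.keys x \<subseteq> S; Poly_Mapping.keys y \<subseteq> S\<rbrakk> \<Longrightarrow> Poly_Mapping.keys (x - y) \<subseteq> S"
  using keys_diff[of x y] by blast

lemma (in comm_group) free_extend:
  fixes f :: "'c \<Rightarrow> 'a"
  assumes "f ` S \<subseteq> carrier G"
  shows free_extend_hom: "free_extend S G f \<in> hom (free_Abelian_group S) G"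
    and free_extend_frag_of: "\<And>p. p \<in> S \<Longrightarrow> free_extend S G f (frag_of p) = f p"
proof -
  have fin: "finite {x \<in> S. f x [^] poly_mapping.lookup u x \<noteq> \<one>}" for u :: "'c \<Rightarrow>\<^sub>0 int"
    by (rule finite_subset [OF _ finite_keys [of u]]) (auto simp: in_keys_iff)
  show "free_extend S G f \<in> hom (free_Abelian_group S) G"
  proof (rule homI)
    fix x y
    assume xy: "x \<in> carrier (free_Abelian_group S)" "y \<in> carrier (free_Abelian_group S)"
    then show "free_extend S G f (x \<otimes>\<^bsub>free_Abelian_group S\<^esub> y)
        = free_extend S G f x \<otimes> free_extend S G f y"
      using assms unfolding free_extend_def free_Abelian_group_def
      by (simp add: fin gfinprod_distrib image_subset_iff Poly_Mapping.lookup_add int_pow_mult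
          cong: gfinprod_cong)
  qed (use assms in \<open>force simp: free_Abelian_group_def free_extend_def intro: gfinprod_closed\<close>)
  show "free_extend S G f (frag_of x) = f x" if "x \<in> S" for x
  proof -
    have fin: "(\<lambda>a. f x [^] (1::int)) \<in> {x} \<rightarrow> carrier G" "f x [^] (1::int) \<in> carrier G"
      using assms that by force+
    show ?thesis
      by (cases " f x [^] (1::int) = \<one>")
        (use assms that in \<open>auto simp: free_extend_def gfinprod_def finprod_singleton\<close>)
  qed
qed

lemma hom_free_Abelian_group_diff:
  assumes "group K" "h \<in> hom (free_Abelian_group S) K"
    and "Poly_Mapping.keys x \<subseteq> S" "Poly_Mapping.keys y \<subseteq> S"
  shows "h (x - y) = h x \<otimes>\<^bsub>K\<^esub> inv\<^bsub>K\<^esub> h y"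
proof -
  interpret K: group K by fact
  have xy: "Poly_Mapping.keys (x - y) \<subseteq> S"
    using assms by (simp add: keys_subset_diff)
  have "h ((x - y) \<otimes>\<^bsub>free_Abelian_group S\<^esub> y) = h (x - y) \<otimes>\<^bsub>K\<^esub> h y"
    using assms xy by (intro hom_mult) auto
  then show ?thesis
    using assms xy hom_in_carrier[OF assms(2)] by (simp add: K.m_assoc)
qed

lemma hom_free_Abelian_group_eqI:
  assumes "group K" "g \<in> hom (free_Abelian_group S) K" "h \<in> hom (free_Abelian_group S) K"
    and "\<And>p. p \<in> S \<Longrightarrow> g (frag_of p) = h (frag_of p)"
    and "Poly_Mapping.keys x \<subseteq> S"
  shows "g x = h x"
proof (rule free_Abelian_group_induct[OF assms(5)])
  show "g 0 = h 0"
    using hom_one[OF assms(2) group_free_Abelian_group assms(1)]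
      hom_one[OF assms(3) group_free_Abelian_group assms(1)] by simp
  show "g (x - y) = h (x - y)"
    if "Poly_Mapping.keys x \<subseteq> S" "Poly_Mapping.keys y \<subseteq> S" "g x = h x" "g y = h y" for x y
    using that assms(1-3) by (simp add: hom_free_Abelian_group_diff[where K = K and S = S])
qed (rule assms(4))

text \<open>The elementwise description of homomorphisms induced on a quotient of an abelian group.\<close>

lemma (in comm_group) quotient_lift:
  assumes N: "subgroup N G" and K: "group K" and h: "h \<in> hom G K"
    and ker: "\<And>x. x \<in> N \<Longrightarrow> h x = \<one>\<^bsub>K\<^esub>"
  shows quotient_lift_coset: "\<And>x. x \<in> carrier G \<Longrightarrow> the_elem (h ` (N #> x)) = h x"
    and quotient_lift_hom: "(\<lambda>X. the_elem (h ` X)) \<in> hom (G Mod N) K"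
proof -
  interpret K: group K by fact
  interpret h: group_hom G K h using h by unfold_locales
  interpret N: normal N G using N by (simp add: normal_iff_subgroup)
  show *: "the_elem (h ` (N #> x)) = h x" if "x \<in> carrier G" for x
  proof -
    have "h ` (N #> x) = {h x}"
      using that ker N.subset N.one_closed
      by (force simp: r_coset_def h.hom_mult subset_iff)
    then show ?thesis by simp
  qed
  show "(\<lambda>X. the_elem (h ` X)) \<in> hom (G Mod N) K"
    by (rule homI) (auto simp: carrier_FactGroup * N.rcos_sum)
qed

lemma bilinearity_subgroup: "subgroup (bilinearity_subgroup G H) (pair_group G H)"
  if "comm_group G" "comm_group H"
proof -
  interpret G: comm_group G by fact
  interpret H: comm_group H by fact
  have "bilinearity_relations G H \<subseteq> carrier (pair_group G H)"
    unfolding bilinearity_relations_def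
    by (auto simp del: minus_add_distrib simp: subset_iff dest!: subsetD[OF keys_diff])
  then show ?thesis
    by (rule group.generate_is_subgroup[OF group_free_Abelian_group])
qed

lemma comm_group_tensor:
  assumes "comm_group G" "comm_group H" shows "comm_group (tensor G H)"
  unfolding tensor_def
  by (intro comm_group.abelian_FactGroup abelian_free_Abelian_group bilinearity_subgroup assms)

locale tensor_product = G: comm_group G + H: comm_group H
  for G :: "('a, 'm) monoid_scheme" and H :: "('b, 'n) monoid_scheme"
begin

abbreviation "F \<equiv> pair_group G H"
abbreviation "N \<equiv> bilinearity_subgroup G H"

sublocale F: comm_group F by (rule abelian_free_Abelian_group)
sublocale N: normal N F
  using bilinearity_subgroup[OF G.comm_group_axioms H.comm_group_axioms]
  by (simp add: F.normal_iff_subgroup)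
sublocale T: comm_group "tensor G H"
  by (intro comm_group_tensor) unfold_locales

lemma frag_closed: "\<lbrakk>a \<in> carrier G; b \<in> carrier H\<rbrakk> \<Longrightarrow> frag_of (a, b) \<in> carrier F"
  by simp

lemma tensor_of_closed:
  "\<lbrakk>a \<in> carrier G; b \<in> carrier H\<rbrakk> \<Longrightarrow> tensor_of G H a b \<in> carrier (tensor G H)"
  by (simp add: tensor_def tensor_of_def carrier_FactGroup)

lemma coset_eqI: "N #>\<^bsub>F\<^esub> x = N #>\<^bsub>F\<^esub> y"
  if "x \<in> carrier F" "y \<in> carrier F" "x - y \<in> N" for x y
proof -
  have "(x - y) \<otimes>\<^bsub>F\<^esub> y \<in> N #>\<^bsub>F\<^esub> y"
    using that by (intro F.rcosI) (use N.subset in auto)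
  then show ?thesis
    using that F.repr_independence[of x N y] N.subgroup_axioms by simp
qed

lemma coset_add:
  "\<lbrakk>x \<in> carrier F; y \<in> carrier F\<rbrakk>
     \<Longrightarrow> (N #>\<^bsub>F\<^esub> x) \<otimes>\<^bsub>tensor G H\<^esub> (N #>\<^bsub>F\<^esub> y) = N #>\<^bsub>F\<^esub> (x + y)"
  by (simp add: tensor_def N.rcos_sum)

lemma tensor_of_mult_left:
  assumes "a \<in> carrier G" "a' \<in> carrier G" "b \<in> carrier H"
  shows "tensor_of G H (a \<otimes>\<^bsub>G\<^esub> a') b
    = tensor_of G H a b \<otimes>\<^bsub>tensor G H\<^esub> tensor_of G H a' b"
proof -
  have "frag_of (a \<otimes>\<^bsub>G\<^esub> a', b) - frag_of (a, b) - frag_of (a', b) \<in> N"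
    by (rule generate.incl) (use assms in \<open>auto simp: bilinearity_relations_def\<close>)
  then show ?thesis
    unfolding tensor_of_def using assms
    by (subst coset_add) (simp_all add: coset_eqI diff_diff_eq keys_subset_add)
qed

lemma tensor_of_mult_right:
  assumes "a \<in> carrier G" "b \<in> carrier H" "b' \<in> carrier H"
  shows "tensor_of G H a (b \<otimes>\<^bsub>H\<^esub> b')
    = tensor_of G H a b \<otimes>\<^bsub>tensor G H\<^esub> tensor_of G H a b'"
proof -
  have "frag_of (a, b \<otimes>\<^bsub>H\<^esub> b') - frag_of (a, b) - frag_of (a, b') \<in> N"
    by (rule generate.incl) (use assms in \<open>auto simp: bilinearity_relations_def\<close>)
  then show ?thesis
    unfolding tensor_of_def using assms
    by (subst coset_add) (simp_all add: coset_eqI diff_diff_eq keys_subset_add)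
qed

context
  fixes K :: "('k, 'o) monoid_scheme" and f :: "'a \<Rightarrow> 'b \<Rightarrow> 'k"
  assumes K: "comm_group K"
    and f_closed: "\<And>a b. \<lbrakk>a \<in> carrier G; b \<in> carrier H\<rbrakk> \<Longrightarrow> f a b \<in> carrier K"
    and f_left: "\<And>a a' b. \<lbrakk>a \<in> carrier G; a' \<in> carrier G; b \<in> carrier H\<rbrakk>
          \<Longrightarrow> f (a \<otimes>\<^bsub>G\<^esub> a') b = f a b \<otimes>\<^bsub>K\<^esub> f a' b"
    and f_right: "\<And>a b b'. \<lbrakk>a \<in> carrier G; b \<in> carrier H; b' \<in> carrier H\<rbrakk>
          \<Longrightarrow> f a (b \<otimes>\<^bsub>H\<^esub> b') = f a b \<otimes>\<^bsub>K\<^esub> f a b'"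
begin

interpretation K: comm_group K by (rule K)

private abbreviation "e \<equiv> free_extend (carrier G \<times> carrier H) K (case_prod f)"

private lemma e_hom: "e \<in> hom F K"
  by (rule K.free_extend_hom) (auto intro: f_closed)

private lemma e_frag: "\<lbrakk>a \<in> carrier G; b \<in> carrier H\<rbrakk> \<Longrightarrow> e (frag_of (a, b)) = f a b"
  by (subst K.free_extend_frag_of) (auto intro: f_closed)

private lemma e_N: "x \<in> N \<Longrightarrow> e x = \<one>\<^bsub>K\<^esub>"
proof -
  interpret e: group_hom F K e
    using e_hom by unfold_locales
  note e_diff = hom_free_Abelian_group_diff[OF K.is_group e_hom]
  have "bilinearity_relations G H \<subseteq> kernel F K e"
  proof
    fix r assume "r \<in> bilinearity_relations G H"
    then consider
      (l) a a' b where "r = frag_of (a \<otimes>\<^bsub>G\<^esub> a', b) - frag_of (a, b) - frag_of (a', b)"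
        "a \<in> carrier G" "a' \<in> carrier G" "b \<in> carrier H"
    | (r) a b b' where "r = frag_of (a, b \<otimes>\<^bsub>H\<^esub> b') - frag_of (a, b) - frag_of (a, b')"
        "a \<in> carrier G" "b \<in> carrier H" "b' \<in> carrier H"
      unfolding bilinearity_relations_def by blast
    then show "r \<in> kernel F K e"
    proof cases
      case l
      then show ?thesis
        by (simp add: kernel_def e_diff keys_subset_diff e_frag f_left K.mult_cancel_inv f_closed)
    next
      case r
      then show ?thesis
        by (simp add: kernel_def e_diff keys_subset_diff e_frag f_right K.mult_cancel_inv f_closed)
    qed
  qed
  then have "N \<subseteq> kernel F K e"
    by (rule F.generate_subgroup_incl) (rule e.subgroup_kernel)
  then show "x \<in> N \<Longrightarrow> e x = \<one>\<^bsub>K\<^esub>"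
    by (auto simp: kernel_def)
qed

lemma tensor_lift_hom: "tensor_lift G H K f \<in> hom (tensor G H) K"
  unfolding tensor_lift_def tensor_def
  by (rule F.quotient_lift_hom[OF N.subgroup_axioms K.is_group e_hom e_N])

lemma tensor_lift_tensor_of:
  "\<lbrakk>a \<in> carrier G; b \<in> carrier H\<rbrakk> \<Longrightarrow> tensor_lift G H K f (tensor_of G H a b) = f a b"
  unfolding tensor_lift_def tensor_of_def
  by (subst F.quotient_lift_coset[OF N.subgroup_axioms K.is_group e_hom e_N]) (auto simp: e_frag)

end

lemma tensor_hom_eqI:
  assumes K: "group K" and g: "g \<in> hom (tensor G H) K" and h: "h \<in> hom (tensor G H) K"
    and eq: "\<And>a b. \<lbrakk>a \<in> carrier G; b \<in> carrier H\<rbrakk>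
               \<Longrightarrow> g (tensor_of G H a b) = h (tensor_of G H a b)"
    and X: "X \<in> carrier (tensor G H)"
  shows "g X = h X"
proof -
  obtain x where x: "x \<in> carrier F" "X = N #>\<^bsub>F\<^esub> x"
    using X by (auto simp: tensor_def carrier_FactGroup)
  have q: "(#>\<^bsub>F\<^esub>) N \<in> hom F (tensor G H)"
    unfolding tensor_def by (rule N.r_coset_hom_Mod)
  have "(g \<circ> (#>\<^bsub>F\<^esub>) N) x = (h \<circ> (#>\<^bsub>F\<^esub>) N) x"
    by (rule hom_free_Abelian_group_eqI[OF K Group.hom_compose[OF q g] Group.hom_compose[OF q h]])
       (use x eq in \<open>auto simp: tensor_of_def\<close>)
  then show ?thesis using x by simp
qed

end


section \<open>Lie and quasi-Lie algebras over the integers\<close>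

record 'a bracket_group = "'a monoid" +
  brk :: "'a \<Rightarrow> 'a \<Rightarrow> 'a"

locale bracket_ring = comm_group L for L (structure) +
  assumes brk_closed: "\<lbrakk>x \<in> carrier L; y \<in> carrier L\<rbrakk> \<Longrightarrow> brk L x y \<in> carrier L"
    and brk_mult_left: "\<lbrakk>x \<in> carrier L; y \<in> carrier L; z \<in> carrier L\<rbrakk>
          \<Longrightarrow> brk L (x \<otimes> y) z = brk L x z \<otimes> brk L y z"
    and brk_mult_right: "\<lbrakk>x \<in> carrier L; y \<in> carrier L; z \<in> carrier L\<rbrakk>
          \<Longrightarrow> brk L x (y \<otimes> z) = brk L x y \<otimes> brk L x z"
begin

lemma brk_hom_left: "y \<in> carrier L \<Longrightarrow> (\<lambda>x. brk L x y) \<in> hom L L"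
  and brk_hom_right: "x \<in> carrier L \<Longrightarrow> brk L x \<in> hom L L"
  by (auto intro!: homI simp: brk_closed brk_mult_left brk_mult_right)

lemma brk_one_left: "y \<in> carrier L \<Longrightarrow> brk L \<one> y = \<one>"
  and brk_one_right: "x \<in> carrier L \<Longrightarrow> brk L x \<one> = \<one>"
  using hom_one[OF brk_hom_left] hom_one[OF brk_hom_right] is_group by auto

end

locale quasi_lie_algebra = bracket_ring +
  assumes brk_antisym: "\<lbrakk>x \<in> carrier L; y \<in> carrier L\<rbrakk>
          \<Longrightarrow> brk L x y \<otimes> brk L y x = \<one>"
    and brk_jacobi: "\<lbrakk>x \<in> carrier L; y \<in> carrier L; z \<in> carrier L\<rbrakk>
          \<Longrightarrow> brk L (brk L x y) z \<otimes> brk L (brk L y z) x \<otimes> brk L (brk L z x) y = \<one>"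

locale lie_algebra = quasi_lie_algebra +
  assumes brk_self: "x \<in> carrier L \<Longrightarrow> brk L x x = \<one>"

definition brk_hom ::
  "('a, 'm) bracket_group_scheme \<Rightarrow> ('b, 'n) bracket_group_scheme \<Rightarrow> ('a \<Rightarrow> 'b) set" where
  "brk_hom L K = {f \<in> hom L K. \<forall>x\<in>carrier L. \<forall>y\<in>carrier L. f (brk L x y) = brk K (f x) (f y)}"


subsection \<open>Free algebras\<close>

text \<open>The free (quasi-)Lie algebra on \<open>H\<close> is the free non-associative ring on the underlying
  set of \<open>H\<close>, with the bracketed words in elements of \<open>H\<close> as basis, modulo the ideal generated
  by the axioms and by the additivity of the inclusion of \<open>H\<close>.\<close>

datatype 'a bracketing = Gen 'a | Br "'a bracketing" "'a bracketing"

primrec weight :: "'a bracketing \<Rightarrow> nat" where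
  "weight (Gen a) = 1"
| "weight (Br s t) = weight s + weight t"

definition bracketings :: "('a, 'm) monoid_scheme \<Rightarrow> 'a bracketing set" where
  "bracketings H = {t. set_bracketing t \<subseteq> carrier H}"

definition frag_brk ::
  "('a bracketing \<Rightarrow>\<^sub>0 int) \<Rightarrow> ('a bracketing \<Rightarrow>\<^sub>0 int) \<Rightarrow> ('a bracketing \<Rightarrow>\<^sub>0 int)" where
  "frag_brk x y = frag_extend (\<lambda>s. frag_extend (\<lambda>t. frag_of (Br s t)) y) x"

definition nonassoc_ring ::
  "('a, 'm) monoid_scheme \<Rightarrow> ('a bracketing \<Rightarrow>\<^sub>0 int) bracket_group" where
  "nonassoc_ring H = \<lparr>carrier = carrier (free_Abelian_group (bracketings H)),
     mult = (+), one = 0, brk = frag_brk\<rparr>"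

definition additivity_relations ::
  "('a, 'm) monoid_scheme \<Rightarrow> ('a bracketing \<Rightarrow>\<^sub>0 int) set" where
  "additivity_relations H =
     {frag_of (Gen (a \<otimes>\<^bsub>H\<^esub> b)) - frag_of (Gen a) - frag_of (Gen b) | a b.
        a \<in> carrier H \<and> b \<in> carrier H}"

definition quasi_lie_relations :: "('a, 'm) bracket_group_scheme \<Rightarrow> 'a set" where
  "quasi_lie_relations A =
     {brk A x y \<otimes>\<^bsub>A\<^esub> brk A y x | x y. x \<in> carrier A \<and> y \<in> carrier A} \<union>
     {brk A (brk A x y) z \<otimes>\<^bsub>A\<^esub> brk A (brk A y z) x \<otimes>\<^bsub>A\<^esub> brk A (brk A z x) y | x y z.
        x \<in> carrier A \<and> y \<in> carrier A \<and> z \<in> carrier A}"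

definition lie_relations :: "('a, 'm) bracket_group_scheme \<Rightarrow> 'a set" where
  "lie_relations A = quasi_lie_relations A \<union> {brk A x x | x. x \<in> carrier A}"

inductive_set brk_ideal :: "('a, 'm) bracket_group_scheme \<Rightarrow> 'a set \<Rightarrow> 'a set"
  for A R where
  incl: "r \<in> R \<Longrightarrow> r \<in> brk_ideal A R"
| one: "\<one>\<^bsub>A\<^esub> \<in> brk_ideal A R"
| mult: "\<lbrakk>r \<in> brk_ideal A R; s \<in> brk_ideal A R\<rbrakk> \<Longrightarrow> r \<otimes>\<^bsub>A\<^esub> s \<in> brk_ideal A R"
| inv: "r \<in> brk_ideal A R \<Longrightarrow> inv\<^bsub>A\<^esub> r \<in> brk_ideal A R"
| left: "\<lbrakk>x \<in> carrier A; r \<in> brk_ideal A R\<rbrakk> \<Longrightarrow> brk A x r \<in> brk_ideal A R"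
| right: "\<lbrakk>r \<in> brk_ideal A R; x \<in> carrier A\<rbrakk> \<Longrightarrow> brk A r x \<in> brk_ideal A R"

definition brk_quotient ::
  "('a, 'm) bracket_group_scheme \<Rightarrow> 'a set \<Rightarrow> 'a set bracket_group" where
  "brk_quotient A I = \<lparr>carrier = carrier (A Mod I), mult = mult (A Mod I), one = one (A Mod I),
     brk = (\<lambda>X Y. \<Union>x\<in>X. \<Union>y\<in>Y. I #>\<^bsub>A\<^esub> brk A x y)\<rparr>"

definition quasi_lie_ideal ::
  "('a, 'm) monoid_scheme \<Rightarrow> ('a bracketing \<Rightarrow>\<^sub>0 int) set" where
  "quasi_lie_ideal H = brk_ideal (nonassoc_ring H)
     (additivity_relations H \<union> quasi_lie_relations (nonassoc_ring H))"

definition lie_ideal ::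
  "('a, 'm) monoid_scheme \<Rightarrow> ('a bracketing \<Rightarrow>\<^sub>0 int) set" where
  "lie_ideal H = brk_ideal (nonassoc_ring H)
     (additivity_relations H \<union> lie_relations (nonassoc_ring H))"

text \<open>The constructions common to the two cases take the ideal \<open>I\<close> as a parameter.\<close>

definition free_alg ::
  "('a, 'm) monoid_scheme \<Rightarrow> ('a bracketing \<Rightarrow>\<^sub>0 int) set
     \<Rightarrow> ('a bracketing \<Rightarrow>\<^sub>0 int) set bracket_group" where
  "free_alg H I = brk_quotient (nonassoc_ring H) I"

definition word_class ::
  "('a, 'm) monoid_scheme \<Rightarrow> ('a bracketing \<Rightarrow>\<^sub>0 int) set \<Rightarrow> 'a bracketing
     \<Rightarrow> ('a bracketing \<Rightarrow>\<^sub>0 int) set" where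
  "word_class H I t = I #>\<^bsub>nonassoc_ring H\<^esub> frag_of t"

abbreviation free_quasi_lie where "free_quasi_lie H \<equiv> free_alg H (quasi_lie_ideal H)"
abbreviation free_lie where "free_lie H \<equiv> free_alg H (lie_ideal H)"

definition degree_part ::
  "('a, 'm) monoid_scheme \<Rightarrow> ('a bracketing \<Rightarrow>\<^sub>0 int) set \<Rightarrow> nat
     \<Rightarrow> ('a bracketing \<Rightarrow>\<^sub>0 int) set bracket_group" where
  "degree_part H I n = subgroup_generated (free_alg H I)
     {word_class H I t | t. t \<in> bracketings H \<and> weight t = n}"

abbreviation L' where "L' n H \<equiv> degree_part H (quasi_lie_ideal H) n"
abbreviation L where "L n H \<equiv> degree_part H (lie_ideal H) n"

definition bracket_map ::
  "('a, 'm) monoid_scheme \<Rightarrow> ('a bracketing \<Rightarrow>\<^sub>0 int) set \<Rightarrow> nat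
     \<Rightarrow> ('a \<times> ('a bracketing \<Rightarrow>\<^sub>0 int) set \<Rightarrow>\<^sub>0 int) set \<Rightarrow> ('a bracketing \<Rightarrow>\<^sub>0 int) set" where
  "bracket_map H I n = tensor_lift H (degree_part H I (n + 1)) (degree_part H I (n + 2))
     (\<lambda>h x. brk (free_alg H I) (word_class H I (Gen h)) x)"

definition bracket_kernel ::
  "('a, 'm) monoid_scheme \<Rightarrow> ('a bracketing \<Rightarrow>\<^sub>0 int) set \<Rightarrow> nat
     \<Rightarrow> ('a \<times> ('a bracketing \<Rightarrow>\<^sub>0 int) set \<Rightarrow>\<^sub>0 int) set monoid" where
  "bracket_kernel H I n = (tensor H (degree_part H I (n + 1)))
     \<lparr>carrier := kernel (tensor H (degree_part H I (n + 1))) (degree_part H I (n + 2))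
                   (bracket_map H I n)\<rparr>"

abbreviation D' where "D' n H \<equiv> bracket_kernel H (quasi_lie_ideal H) n"
abbreviation D where "D n H \<equiv> bracket_kernel H (lie_ideal H) n"

text \<open>The canonical epimorphism \<open>L' \<rightarrow> L\<close> sends a coset of the quasi-Lie ideal to the coset of
  the (larger) Lie ideal containing it. As functions on cosets, its degree \<open>n\<close> parts do
  not depend on \<open>n\<close>.\<close>

definition lie_projection ::
  "('a, 'm) monoid_scheme \<Rightarrow> ('a bracketing \<Rightarrow>\<^sub>0 int) set \<Rightarrow> ('a bracketing \<Rightarrow>\<^sub>0 int) set" where
  "lie_projection H X = (\<Union>x\<in>X. lie_ideal H #>\<^bsub>nonassoc_ring H\<^esub> x)"

definition D_canonical ::
  "('a, 'm) monoid_scheme \<Rightarrow> nat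
     \<Rightarrow> ('a \<times> ('a bracketing \<Rightarrow>\<^sub>0 int) set \<Rightarrow>\<^sub>0 int) set
     \<Rightarrow> ('a \<times> ('a bracketing \<Rightarrow>\<^sub>0 int) set \<Rightarrow>\<^sub>0 int) set" where
  "D_canonical H n = tensor_map H (L' (n + 1) H) H (L (n + 1) H) (\<lambda>h. h) (lie_projection H)"


subsection \<open>The free algebras are free\<close>

lemma UN_constant':
  assumes "a \<in> U" and "\<And>u. u \<in> U \<Longrightarrow> f u = C"
  shows "(\<Union>u\<in>U. f u) = C"
  using assms by auto

lemma UN_UN_constant:
  assumes "a \<in> U" "b \<in> V" and "\<And>u v. \<lbrakk>u \<in> U; v \<in> V\<rbrakk> \<Longrightarrow> f u v = C"
  shows "(\<Union>u\<in>U. \<Union>v\<in>V. f u v) = C"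
  using assms by auto

locale bracket_ideal_quotient = bracket_ring A for A (structure) and R +
  assumes R: "R \<subseteq> carrier A"
begin

abbreviation "I \<equiv> brk_ideal A R"
abbreviation "Q \<equiv> brk_quotient A I"

lemma ideal_closed: "r \<in> I \<Longrightarrow> r \<in> carrier A"
  by (induction rule: brk_ideal.induct) (use R brk_closed in auto)

lemma ideal_subgroup: "subgroup I A"
  by (rule subgroupI) (use brk_ideal.one[of A R] in \<open>auto intro: ideal_closed brk_ideal.mult brk_ideal.inv\<close>)

sublocale I: normal I A
  using ideal_subgroup by (simp add: normal_iff_subgroup)

lemma ideal_coset: "r \<in> I \<Longrightarrow> I #> r = I"
  by (intro coset_join2 ideal_closed ideal_subgroup)

lemma coset_eqI: "I #> x = I #> y"
  if "x \<in> carrier A" "y \<in> carrier A" "r \<in> I" "x = r \<otimes> y" for x y r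
  using that repr_independence[of x I y] ideal_subgroup rcosI[of r I y] I.subset by simp

lemma coset_elem: "\<exists>r\<in>I. u = r \<otimes> x" if "u \<in> I #> x" for u x
  using that by (auto simp: r_coset_def)

lemma carrier_quotient: "carrier Q = (\<lambda>x. I #> x) ` carrier A"
  by (simp add: brk_quotient_def carrier_FactGroup)

lemma one_quotient: "\<one>\<^bsub>Q\<^esub> = I"
  by (simp add: brk_quotient_def)

lemma mult_quotient: "\<lbrakk>x \<in> carrier A; y \<in> carrier A\<rbrakk> \<Longrightarrow> (I #> x) \<otimes>\<^bsub>Q\<^esub> (I #> y) = I #> (x \<otimes> y)"
  by (simp add: brk_quotient_def I.rcos_sum)

lemma brk_quotient:
  assumes x: "x \<in> carrier A" and y: "y \<in> carrier A"
  shows "brk Q (I #> x) (I #> y) = I #> brk A x y"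
proof -
  have *: "I #> brk A u v = I #> brk A x y" if uv: "u \<in> I #> x" "v \<in> I #> y" for u v
  proof -
    from coset_elem[OF uv(1)] obtain r where r: "r \<in> I" "u = r \<otimes> x" ..
    from coset_elem[OF uv(2)] obtain s where s: "s \<in> I" "v = s \<otimes> y" ..
    note rs = r s
    have c: "r \<in> carrier A" "s \<in> carrier A"
      using rs ideal_closed by auto
    have eq: "brk A u v = (brk A r (s \<otimes> y) \<otimes> brk A x s) \<otimes> brk A x y"
      unfolding rs(2,4)
      using c x y brk_mult_left[of r x "s \<otimes> y"] brk_mult_right[of x s y]
      by (simp add: brk_closed m_assoc)
    have mem: "brk A r (s \<otimes> y) \<otimes> brk A x s \<in> I"
      using rs c x y by (intro brk_ideal.mult brk_ideal.left brk_ideal.right) auto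
    show ?thesis
      by (rule coset_eqI[OF _ _ mem eq]) (simp_all add: rs c x y brk_closed)
  qed
  have "(\<Union>u\<in>I #> x. \<Union>v\<in>I #> y. I #> brk A u v) = I #> brk A x y"
    by (rule UN_UN_constant[OF rcos_self[OF x ideal_subgroup] rcos_self[OF y ideal_subgroup] *])
  then show ?thesis
    by (simp add: brk_quotient_def)
qed

lemma coset_brk_hom: "(\<lambda>x. I #> x) \<in> brk_hom A Q"
  unfolding brk_hom_def by (auto intro!: homI simp: carrier_quotient mult_quotient brk_quotient)

sublocale Q: bracket_ring Q
proof -
  interpret M: comm_group "A Mod I"
    by (rule abelian_FactGroup[OF ideal_subgroup])
  have Q: "carrier Q = carrier (A Mod I)" "\<one>\<^bsub>Q\<^esub> = \<one>\<^bsub>A Mod I\<^esub>"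
    "mult Q = mult (A Mod I)"
    by (simp_all only: brk_quotient_def partial_object.select_convs monoid.select_convs)
  have "comm_group Q"
    by (rule comm_groupI, unfold Q) (fact M.m_closed M.one_closed M.m_assoc M.m_comm M.l_one M.l_inv_ex)+
  then show "bracket_ring Q"
    by (rule bracket_ring.intro, unfold_locales)
       (auto simp: carrier_quotient brk_quotient mult_quotient brk_closed brk_mult_left
          brk_mult_right)
qed

lemma quotient_quasi_lie_algebra:
  assumes "quasi_lie_relations A \<subseteq> I"
  shows "quasi_lie_algebra Q"
proof
  fix X Y Z assume "X \<in> carrier Q" "Y \<in> carrier Q" "Z \<in> carrier Q"
  then obtain x y z where [simp]: "X = I #> x" "Y = I #> y" "Z = I #> z"
    "x \<in> carrier A" "y \<in> carrier A" "z \<in> carrier A"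
    by (auto simp: carrier_quotient)
  have "brk A x y \<otimes> brk A y x \<in> I"
    by (rule subsetD[OF assms]) 
      (unfold quasi_lie_relations_def, rule UnI1, rule CollectI, rule exI[of _ x], rule exI[of _ y], simp)
  then show "brk Q X Y \<otimes>\<^bsub>Q\<^esub> brk Q Y X = \<one>\<^bsub>Q\<^esub>"
    by (simp add: brk_quotient mult_quotient brk_closed one_quotient ideal_coset)
  have "brk A (brk A x y) z \<otimes> brk A (brk A y z) x \<otimes> brk A (brk A z x) y \<in> I"
    by (rule subsetD[OF assms]) 
      (unfold quasi_lie_relations_def, rule UnI2, rule CollectI, rule exI[of _ x], rule exI[of _ y],
        rule exI[of _ z], simp)
  then show "brk Q (brk Q X Y) Z \<otimes>\<^bsub>Q\<^esub> brk Q (brk Q Y Z) X \<otimes>\<^bsub>Q\<^esub> brk Q (brk Q Z X) Y = \<one>\<^bsub>Q\<^esub>"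
    by (simp add: brk_quotient mult_quotient brk_closed one_quotient ideal_coset)
qed

lemma quotient_lie_algebra:
  assumes "lie_relations A \<subseteq> I"
  shows "lie_algebra Q"
proof -
  interpret q: quasi_lie_algebra Q
    by (rule quotient_quasi_lie_algebra) (use assms in \<open>auto simp: lie_relations_def\<close>)
  show ?thesis
  proof
    fix X assume "X \<in> carrier Q"
    then obtain x where [simp]: "X = I #> x" "x \<in> carrier A"
      by (auto simp: carrier_quotient)
    have "brk A x x \<in> I"
      by (rule subsetD[OF assms]) 
        (unfold lie_relations_def, rule UnI2, rule CollectI, rule exI[of _ x], simp)
    then show "brk Q X X = \<one>\<^bsub>Q\<^esub>"
      by (simp add: brk_quotient one_quotient ideal_coset)
  qed
qed

lemma quotient_universal:
  assumes K: "bracket_ring K" and e: "e \<in> brk_hom A K"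
    and kill: "\<And>r. r \<in> R \<Longrightarrow> e r = \<one>\<^bsub>K\<^esub>"
  shows "\<exists>g \<in> brk_hom Q K. \<forall>x\<in>carrier A. g (I #> x) = e x"
proof -
  interpret K: bracket_ring K by (rule K)
  interpret e: group_hom A K e
    using e by unfold_locales (auto simp: brk_hom_def)
  have e_brk: "\<lbrakk>x \<in> carrier A; y \<in> carrier A\<rbrakk> \<Longrightarrow> e (brk A x y) = brk K (e x) (e y)" for x y
    using e by (auto simp: brk_hom_def)
  have ker: "e r = \<one>\<^bsub>K\<^esub>" if "r \<in> I" for r
    using that
  proof (induction rule: brk_ideal.induct)
    case (incl r)
    then show ?case by (rule kill)
  qed (simp_all add: ideal_closed e_brk K.brk_one_left K.brk_one_right)
  define g where "g X = the_elem (e ` X)" for X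
  have g: "g (I #> x) = e x" if "x \<in> carrier A" for x
    unfolding g_def
    by (rule quotient_lift_coset[OF ideal_subgroup K.is_group e.homh ker that])
  have "g \<in> hom Q K"
    by (rule homI) (auto simp: carrier_quotient mult_quotient g)
  moreover have "g (brk Q X Y) = brk K (g X) (g Y)" if XY: "X \<in> carrier Q" "Y \<in> carrier Q" for X Y
  proof -
    obtain x y where "X = I #> x" "Y = I #> y" "x \<in> carrier A" "y \<in> carrier A"
      using XY by (auto simp: carrier_quotient)
    then show ?thesis
      by (simp add: brk_quotient g brk_closed e_brk)
  qed
  ultimately have "g \<in> brk_hom Q K"
    by (simp add: brk_hom_def)
  with g show ?thesis by (intro bexI[of _ g]) auto
qed

end

lemma frag_brk_frag_of [simp]: "frag_brk (frag_of s) (frag_of t) = frag_of (Br s t)"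
  by (simp add: frag_brk_def)

lemma frag_brk_add_left: "frag_brk (x + y) z = frag_brk x z + frag_brk y z"
  by (simp add: frag_brk_def frag_extend_add)

lemma frag_extend_plus: "frag_extend (\<lambda>i. f i + g i) x = frag_extend f x + frag_extend g x"
  by (simp add: frag_extend_def frag_cmul_distrib2 sum.distrib)

lemma frag_brk_add_right: "frag_brk x (y + z) = frag_brk x y + frag_brk x z"
  by (simp add: frag_brk_def frag_extend_add frag_extend_plus)

lemma bracketings_simps [simp]:
  "Gen a \<in> bracketings H \<longleftrightarrow> a \<in> carrier H"
  "Br s t \<in> bracketings H \<longleftrightarrow> s \<in> bracketings H \<and> t \<in> bracketings H"
  by (auto simp: bracketings_def)

lemma nonassoc_ring_simps:
  "x \<in> carrier (nonassoc_ring H) \<longleftrightarrow> Poly_Mapping.keys x \<subseteq> bracketings H"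
  "x \<otimes>\<^bsub>nonassoc_ring H\<^esub> y = x + y" "\<one>\<^bsub>nonassoc_ring H\<^esub> = 0" "brk (nonassoc_ring H) = frag_brk"
  by (simp_all add: nonassoc_ring_def)

lemma bracket_ring_nonassoc_ring: "bracket_ring (nonassoc_ring H)"
proof -
  have keys_minus: "Poly_Mapping.keys (- x) \<subseteq> bracketings H"
    if "Poly_Mapping.keys x \<subseteq> bracketings H" for x :: "'a bracketing \<Rightarrow>\<^sub>0 int"
    using that by simp
  interpret comm_group "nonassoc_ring H"
  proof (rule comm_groupI)
    fix x assume "x \<in> carrier (nonassoc_ring H)"
    then show "\<exists>y\<in>carrier (nonassoc_ring H). y \<otimes>\<^bsub>nonassoc_ring H\<^esub> x = \<one>\<^bsub>nonassoc_ring H\<^esub>"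
      by (intro bexI[of _ "- x"]) (simp_all add: nonassoc_ring_simps keys_minus)
  qed (simp_all add: nonassoc_ring_simps keys_subset_add algebra_simps)
  show ?thesis
  proof
    fix x y z
    assume "x \<in> carrier (nonassoc_ring H)" "y \<in> carrier (nonassoc_ring H)"
    then show "brk (nonassoc_ring H) x y \<in> carrier (nonassoc_ring H)"
      unfolding nonassoc_ring_simps frag_brk_def
      by (auto dest!: subsetD[OF keys_frag_extend] simp: subset_iff)
  qed (simp_all add: nonassoc_ring_simps frag_brk_add_left frag_brk_add_right)
qed

lemma hom_nonassoc_ring: "hom (nonassoc_ring H) K = hom (free_Abelian_group (bracketings H)) K"
  by (auto simp: hom_def nonassoc_ring_simps)

locale free_bracket_algebra =
  fixes H :: "('a, 'm) monoid_scheme" and S :: "('a bracketing \<Rightarrow>\<^sub>0 int) set"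
  assumes H: "comm_group H" and S: "S \<subseteq> carrier (nonassoc_ring H)"
begin

sublocale H: comm_group H by (rule H)

lemma additivity_closed: "additivity_relations H \<subseteq> carrier (nonassoc_ring H)"
  unfolding additivity_relations_def nonassoc_ring_simps
  by (auto simp: nonassoc_ring_simps simp del: minus_add_distrib
      dest!: subsetD[OF keys_diff] split: if_splits)

sublocale bracket_ideal_quotient "nonassoc_ring H" "additivity_relations H \<union> S"
  using bracket_ring_nonassoc_ring additivity_closed S
  by (simp add: bracket_ideal_quotient_def bracket_ideal_quotient_axioms_def)

abbreviation "\<iota> h \<equiv> word_class H I (Gen h)"

lemma word_class_closed: "t \<in> bracketings H \<Longrightarrow> word_class H I t \<in> carrier (free_alg H I)"
  by (auto simp: free_alg_def word_class_def carrier_quotient nonassoc_ring_simps)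

lemma word_class_Br:
  "\<lbrakk>s \<in> bracketings H; t \<in> bracketings H\<rbrakk>
     \<Longrightarrow> word_class H I (Br s t) = brk (free_alg H I) (word_class H I s) (word_class H I t)"
  by (simp add: free_alg_def word_class_def brk_quotient nonassoc_ring_simps)

lemma inclusion_hom: "\<iota> \<in> hom H (free_alg H I)"
proof (rule homI)
  fix a b assume ab: "a \<in> carrier H" "b \<in> carrier H"
  have "frag_of (Gen (a \<otimes>\<^bsub>H\<^esub> b)) - frag_of (Gen a) - frag_of (Gen b) \<in> I"
    by (rule brk_ideal.incl) (use ab in \<open>auto simp: additivity_relations_def\<close>)
  then have "\<iota> (a \<otimes>\<^bsub>H\<^esub> b) = I #>\<^bsub>nonassoc_ring H\<^esub> (frag_of (Gen a) + frag_of (Gen b))"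
    unfolding word_class_def using ab
    by (intro coset_eqI[where r = "frag_of (Gen (a \<otimes>\<^bsub>H\<^esub> b)) - frag_of (Gen a) - frag_of (Gen b)"])
       (simp_all add: nonassoc_ring_simps keys_subset_add)
  then show "\<iota> (a \<otimes>\<^bsub>H\<^esub> b) = \<iota> a \<otimes>\<^bsub>free_alg H I\<^esub> \<iota> b"
    using ab mult_quotient[of "frag_of (Gen a)" "frag_of (Gen b)"]
    by (simp add: free_alg_def word_class_def nonassoc_ring_simps)
qed (simp add: word_class_closed)

lemma free_alg_hom_eqI:
  assumes K: "group K" and g: "g \<in> brk_hom (free_alg H I) K" and h: "h \<in> brk_hom (free_alg H I) K"
    and eq: "\<And>a. a \<in> carrier H \<Longrightarrow> g (\<iota> a) = h (\<iota> a)"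
    and X: "X \<in> carrier (free_alg H I)"
  shows "g X = h X"
proof -
  let ?q = "\<lambda>x. I #>\<^bsub>nonassoc_ring H\<^esub> x"
  obtain x where x: "x \<in> carrier (nonassoc_ring H)" "X = ?q x"
    using X by (auto simp: free_alg_def carrier_quotient)
  have q: "?q \<in> hom (free_Abelian_group (bracketings H)) (free_alg H I)"
    using coset_brk_hom unfolding brk_hom_def hom_nonassoc_ring free_alg_def by blast
  have gh: "g \<in> hom (free_alg H I) K" "h \<in> hom (free_alg H I) K"
    using g h by (auto simp: brk_hom_def)
  have words: "g (word_class H I t) = h (word_class H I t)" if "t \<in> bracketings H" for t
    using that
  proof (induction t)
    case (Gen a)
    then show ?case by (simp add: eq)
  next
    case (Br s t)
    then show ?case
      using g h by (simp add: word_class_Br brk_hom_def word_class_closed)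
  qed
  have "(g \<circ> ?q) x = (h \<circ> ?q) x"
    by (rule hom_free_Abelian_group_eqI[OF K Group.hom_compose[OF q gh(1)] Group.hom_compose[OF q gh(2)]])
       (use words x in \<open>auto simp: word_class_def nonassoc_ring_simps\<close>)
  then show ?thesis using x by simp
qed

end

context free_bracket_algebra
begin

lemma bracket_ring_free_alg: "bracket_ring (free_alg H I)"
  unfolding free_alg_def by (rule Q.bracket_ring_axioms)

lemma comm_group_degree_part: "comm_group (degree_part H I n)"
proof -
  interpret alg: bracket_ring "free_alg H I" by (rule bracket_ring_free_alg)
  show ?thesis
    unfolding degree_part_def by (rule alg.abelian_subgroup_generated[OF alg.comm_group_axioms])
qed

lemma degree_part_closed: "x \<in> carrier (degree_part H I n) \<Longrightarrow> x \<in> carrier (free_alg H I)"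
proof -
  interpret alg: bracket_ring "free_alg H I" by (rule bracket_ring_free_alg)
  show "x \<in> carrier (degree_part H I n) \<Longrightarrow> x \<in> carrier (free_alg H I)"
    unfolding degree_part_def using alg.carrier_subgroup_generated_subset by (rule subsetD)
qed

lemma mult_degree_part: "mult (degree_part H I n) = mult (free_alg H I)"
  by (simp add: degree_part_def)

lemma brk_generator_hom:
  assumes "h \<in> carrier H"
  shows "brk (free_alg H I) (\<iota> h) \<in> hom (degree_part H I (n + 1)) (degree_part H I (n + 2))"
proof -
  interpret alg: bracket_ring "free_alg H I" by (rule bracket_ring_free_alg)
  have h: "\<iota> h \<in> carrier (free_alg H I)"
    using assms by (simp add: word_class_closed)
  interpret b: group_hom "free_alg H I" "free_alg H I" "brk (free_alg H I) (\<iota> h)"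
    using alg.brk_hom_right[OF h] by unfold_locales
  show ?thesis
    unfolding degree_part_def
  proof (rule b.hom_between_subgroups, rule image_subsetI, elim CollectE exE conjE)
    fix X t
    assume t: "X = word_class H I t" "t \<in> bracketings H" "weight t = n + 1"
    have "brk (free_alg H I) (\<iota> h) X = word_class H I (Br (Gen h) t)"
      using t assms by (simp add: word_class_Br)
    then show "brk (free_alg H I) (\<iota> h) X
        \<in> {word_class H I t |t. t \<in> bracketings H \<and> weight t = n + 2}"
      using t assms by (intro CollectI exI[of _ "Br (Gen h) t"]) simp
  qed
qed

lemma
  shows bracket_map_hom:
    "bracket_map H I n \<in> hom (tensor H (degree_part H I (n + 1))) (degree_part H I (n + 2))"
  and bracket_map_tensor_of: "\<And>h x. \<lbrakk>h \<in> carrier H; x \<in> carrier (degree_part H I (n + 1))\<rbrakk>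
    \<Longrightarrow> bracket_map H I n (tensor_of H (degree_part H I (n + 1)) h x)
          = brk (free_alg H I) (\<iota> h) x"
proof -
  interpret alg: bracket_ring "free_alg H I" by (rule bracket_ring_free_alg)
  interpret T: tensor_product H "degree_part H I (n + 1)"
    by (rule tensor_product.intro[OF H comm_group_degree_part])
  have closed: "brk (free_alg H I) (\<iota> a) b \<in> carrier (degree_part H I (n + 2))"
    if "a \<in> carrier H" "b \<in> carrier (degree_part H I (n + 1))" for a b
    using hom_in_carrier[OF brk_generator_hom[OF that(1)] that(2)] .
  have left: "brk (free_alg H I) (\<iota> (a \<otimes>\<^bsub>H\<^esub> a')) b
      = brk (free_alg H I) (\<iota> a) b \<otimes>\<^bsub>degree_part H I (n + 2)\<^esub> brk (free_alg H I) (\<iota> a') b"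
    if "a \<in> carrier H" "a' \<in> carrier H" "b \<in> carrier (degree_part H I (n + 1))" for a a' b
    unfolding mult_degree_part hom_mult[OF inclusion_hom that(1,2)]
    using that degree_part_closed
    by (intro alg.brk_mult_left) (simp_all add: word_class_closed)
  have right: "brk (free_alg H I) (\<iota> a) (b \<otimes>\<^bsub>degree_part H I (n + 1)\<^esub> b')
      = brk (free_alg H I) (\<iota> a) b \<otimes>\<^bsub>degree_part H I (n + 2)\<^esub> brk (free_alg H I) (\<iota> a) b'"
    if "a \<in> carrier H" "b \<in> carrier (degree_part H I (n + 1))"
      "b' \<in> carrier (degree_part H I (n + 1))" for a b b'
    by (rule hom_mult[OF brk_generator_hom[OF that(1)] that(2,3)])
  show "bracket_map H I n \<in> hom (tensor H (degree_part H I (n + 1))) (degree_part H I (n + 2))"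
    unfolding bracket_map_def
    by (rule T.tensor_lift_hom[OF comm_group_degree_part closed left right])
  show "bracket_map H I n (tensor_of H (degree_part H I (n + 1)) h x)
          = brk (free_alg H I) (\<iota> h) x"
    if "h \<in> carrier H" "x \<in> carrier (degree_part H I (n + 1))" for h x
    unfolding bracket_map_def
    by (rule T.tensor_lift_tensor_of[OF comm_group_degree_part closed left right that])
qed

end

primrec eval_bracketing ::
  "('k, 'm) bracket_group_scheme \<Rightarrow> ('a \<Rightarrow> 'k) \<Rightarrow> 'a bracketing \<Rightarrow> 'k" where
  "eval_bracketing K f (Gen a) = f a"
| "eval_bracketing K f (Br s t) = brk K (eval_bracketing K f s) (eval_bracketing K f t)"

lemma (in bracket_ring) nonassoc_ring_universal:
  assumes f: "\<And>a. a \<in> carrier H \<Longrightarrow> f a \<in> carrier L"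
  shows "\<exists>e \<in> brk_hom (nonassoc_ring H) L. \<forall>a\<in>carrier H. e (frag_of (Gen a)) = f a"
proof -
  let ?F = "free_Abelian_group (bracketings H)"
  define e where "e = free_extend (bracketings H) L (eval_bracketing L f)"
  have ev: "eval_bracketing L f t \<in> carrier L" if "t \<in> bracketings H" for t
    using that by (induction t) (auto simp: f brk_closed)
  have e: "e \<in> hom ?F L"
    unfolding e_def by (rule free_extend_hom) (use ev in auto)
  have e_frag: "e (frag_of t) = eval_bracketing L f t" if "t \<in> bracketings H" for t
    unfolding e_def by (rule free_extend_frag_of) (use ev that in auto)
  have ec: "e x \<in> carrier L" if "Poly_Mapping.keys x \<subseteq> bracketings H" for x
    using hom_in_carrier[OF e] that by simp
  interpret A: bracket_ring "nonassoc_ring H"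
    by (rule bracket_ring_nonassoc_ring)
  have left: "(\<lambda>x. frag_brk x y) \<in> hom ?F ?F" "frag_brk y \<in> hom ?F ?F"
    if "Poly_Mapping.keys y \<subseteq> bracketings H" for y
    using A.brk_hom_left[of y] A.brk_hom_right[of y] that
    by (auto simp: hom_def nonassoc_ring_simps)
  have 1: "e (frag_brk (frag_of s) y) = brk L (e (frag_of s)) (e y)"
    if "s \<in> bracketings H" "Poly_Mapping.keys y \<subseteq> bracketings H" for s y
  proof -
    have "(e \<circ> frag_brk (frag_of s)) y = (brk L (e (frag_of s)) \<circ> e) y"
      by (rule hom_free_Abelian_group_eqI[OF is_group Group.hom_compose[OF left(2) e]
            Group.hom_compose[OF e brk_hom_right]])
         (use that in \<open>auto simp: e_frag ev\<close>)
    then show ?thesis by simp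
  qed
  have "e (frag_brk x y) = brk L (e x) (e y)"
    if "Poly_Mapping.keys x \<subseteq> bracketings H" "Poly_Mapping.keys y \<subseteq> bracketings H" for x y
  proof -
    have "(e \<circ> (\<lambda>x. frag_brk x y)) x = ((\<lambda>u. brk L u (e y)) \<circ> e) x"
      by (rule hom_free_Abelian_group_eqI[OF is_group Group.hom_compose[OF left(1) e]
            Group.hom_compose[OF e brk_hom_left]])
         (use that in \<open>auto simp: 1 ec\<close>)
    then show ?thesis by simp
  qed
  then have "e \<in> brk_hom (nonassoc_ring H) L"
    using e by (simp add: brk_hom_def hom_nonassoc_ring nonassoc_ring_simps)
  moreover have "\<forall>a\<in>carrier H. e (frag_of (Gen a)) = f a"
    by (simp add: e_frag)
  ultimately show ?thesis by blast
qed

lemma (in free_bracket_algebra) free_alg_universal: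
  assumes K: "bracket_ring K" and f: "f \<in> hom H K"
    and kill: "\<And>e r. \<lbrakk>e \<in> brk_hom (nonassoc_ring H) K; r \<in> S\<rbrakk> \<Longrightarrow> e r = \<one>\<^bsub>K\<^esub>"
  shows "\<exists>g \<in> brk_hom (free_alg H I) K. \<forall>h\<in>carrier H. g (\<iota> h) = f h"
proof -
  interpret K: bracket_ring K by (rule K)
  have fc: "\<And>a. a \<in> carrier H \<Longrightarrow> f a \<in> carrier K"
    using hom_in_carrier[OF f] .
  from K.nonassoc_ring_universal[of H f, OF fc]
  obtain e where e: "e \<in> brk_hom (nonassoc_ring H) K"
    and e_gen: "\<forall>a\<in>carrier H. e (frag_of (Gen a)) = f a" ..
  have e_hom: "e \<in> hom (free_Abelian_group (bracketings H)) K"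
    using e by (simp add: brk_hom_def hom_nonassoc_ring)
  have "e r = \<one>\<^bsub>K\<^esub>" if rel: "r \<in> additivity_relations H" for r
  proof -
    obtain a b where r: "r = frag_of (Gen (a \<otimes>\<^bsub>H\<^esub> b)) - frag_of (Gen a) - frag_of (Gen b)"
      "a \<in> carrier H" "b \<in> carrier H"
      using rel by (auto simp: additivity_relations_def)
    have "e r = f a \<otimes>\<^bsub>K\<^esub> f b \<otimes>\<^bsub>K\<^esub> inv\<^bsub>K\<^esub> f a \<otimes>\<^bsub>K\<^esub> inv\<^bsub>K\<^esub> f b"
      using r f by (simp add: hom_free_Abelian_group_diff[OF K.is_group e_hom]
          keys_subset_diff e_gen hom_mult)
    also have "\<dots> = \<one>\<^bsub>K\<^esub>"
      using fc r by (simp add: K.mult_cancel_inv)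
    finally show ?thesis .
  qed
  with kill[OF e]
  have "\<exists>g \<in> brk_hom Q K. \<forall>x\<in>carrier (nonassoc_ring H). g (I #>\<^bsub>nonassoc_ring H\<^esub> x) = e x"
    by (intro quotient_universal[OF K e]) (elim UnE)
  then obtain g where g: "g \<in> brk_hom Q K"
    "\<forall>x\<in>carrier (nonassoc_ring H). g (I #>\<^bsub>nonassoc_ring H\<^esub> x) = e x" ..
  show ?thesis
  proof (rule bexI[of _ g], rule ballI)
    show "g (\<iota> h) = f h" if "h \<in> carrier H" for h
      using that g(2) e_gen by (simp add: word_class_def nonassoc_ring_simps)
    show "g \<in> brk_hom (free_alg H I) K"
      using g(1) by (simp only: free_alg_def)
  qed
qed

lemma quasi_lie_relations_closed:
  "bracket_ring A \<Longrightarrow> quasi_lie_relations A \<subseteq> carrier A"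
  and lie_relations_closed: "bracket_ring A \<Longrightarrow> lie_relations A \<subseteq> carrier A"
proof -
  assume "bracket_ring A"
  then interpret bracket_ring A .
  show "quasi_lie_relations A \<subseteq> carrier A" "lie_relations A \<subseteq> carrier A"
    by (auto simp: quasi_lie_relations_def lie_relations_def brk_closed)
qed

lemma (in quasi_lie_algebra) quasi_lie_relations_vanish:
  assumes A: "bracket_ring A" and e: "e \<in> brk_hom A L" and r: "r \<in> quasi_lie_relations A"
  shows "e r = \<one>"
proof -
  interpret A: bracket_ring A by (rule A)
  interpret e: group_hom A L e
    using e by unfold_locales (auto simp: brk_hom_def)
  have e_brk: "\<lbrakk>x \<in> carrier A; y \<in> carrier A\<rbrakk> \<Longrightarrow> e (brk A x y) = brk L (e x) (e y)" for x y
    using e by (auto simp: brk_hom_def)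
  show ?thesis
    using r unfolding quasi_lie_relations_def
  proof (elim UnE CollectE exE conjE)
    fix x y assume "r = brk A x y \<otimes>\<^bsub>A\<^esub> brk A y x" "x \<in> carrier A" "y \<in> carrier A"
    then show ?thesis
      using brk_antisym[of "e x" "e y"] by (simp add: e_brk A.brk_closed)
  next
    fix x y z
    assume "r = brk A (brk A x y) z \<otimes>\<^bsub>A\<^esub> brk A (brk A y z) x \<otimes>\<^bsub>A\<^esub> brk A (brk A z x) y"
      "x \<in> carrier A" "y \<in> carrier A" "z \<in> carrier A"
    then show ?thesis
      using brk_jacobi[of "e x" "e y" "e z"] by (simp add: e_brk A.brk_closed)
  qed
qed

lemma (in lie_algebra) lie_relations_vanish:
  assumes A: "bracket_ring A" and e: "e \<in> brk_hom A L" and r: "r \<in> lie_relations A"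
  shows "e r = \<one>"
proof (cases "r \<in> quasi_lie_relations A")
  case True
  then show ?thesis
    by (rule quasi_lie_relations_vanish[OF A e])
next
  case False
  then obtain x where x: "r = brk A x x" "x \<in> carrier A"
    using r by (auto simp: lie_relations_def)
  moreover have "e x \<in> carrier L" "e (brk A x x) = brk L (e x) (e x)"
    using e x by (auto simp: brk_hom_def hom_in_carrier)
  ultimately show ?thesis
    by (simp add: brk_self)
qed

lemma free_bracket_algebra_quasi_lie:
  "comm_group H \<Longrightarrow> free_bracket_algebra H (quasi_lie_relations (nonassoc_ring H))"
  and free_bracket_algebra_lie:
  "comm_group H \<Longrightarrow> free_bracket_algebra H (lie_relations (nonassoc_ring H))"
  by (simp_all add: free_bracket_algebra_def quasi_lie_relations_closed lie_relations_closed
      bracket_ring_nonassoc_ring)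

context
  fixes H :: "('a, 'm) monoid_scheme"
  assumes H: "comm_group H"
begin

interpretation q: free_bracket_algebra H "quasi_lie_relations (nonassoc_ring H)"
  rewrites "brk_ideal (nonassoc_ring H) (additivity_relations H \<union> quasi_lie_relations (nonassoc_ring H))
      = quasi_lie_ideal H"
  by (rule free_bracket_algebra_quasi_lie[OF H]) (simp add: quasi_lie_ideal_def)

interpretation l: free_bracket_algebra H "lie_relations (nonassoc_ring H)"
  rewrites "brk_ideal (nonassoc_ring H) (additivity_relations H \<union> lie_relations (nonassoc_ring H))
      = lie_ideal H"
  by (rule free_bracket_algebra_lie[OF H]) (simp add: lie_ideal_def)

lemma quasi_lie_algebra_free_quasi_lie: "quasi_lie_algebra (free_quasi_lie H)"
  unfolding free_alg_def
  by (rule q.quotient_quasi_lie_algebra) (auto simp: quasi_lie_ideal_def intro: brk_ideal.incl)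

lemma lie_algebra_free_lie: "lie_algebra (free_lie H)"
  unfolding free_alg_def
  by (rule l.quotient_lie_algebra) (auto simp: lie_ideal_def intro: brk_ideal.incl)

theorem free_quasi_lie_universal:
  assumes "quasi_lie_algebra K" and "f \<in> hom H K"
  shows "\<exists>g \<in> brk_hom (free_quasi_lie H) K.
           \<forall>h\<in>carrier H. g (word_class H (quasi_lie_ideal H) (Gen h)) = f h"
proof (rule q.free_alg_universal)
  interpret K: quasi_lie_algebra K by fact
  show "bracket_ring K" by unfold_locales
  show "e r = \<one>\<^bsub>K\<^esub>" if "e \<in> brk_hom (nonassoc_ring H) K" "r \<in> quasi_lie_relations (nonassoc_ring H)" for e r
    by (rule K.quasi_lie_relations_vanish[OF bracket_ring_nonassoc_ring that])
qed fact

theorem free_lie_universal: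
  assumes "lie_algebra K" and "f \<in> hom H K"
  shows "\<exists>g \<in> brk_hom (free_lie H) K.
           \<forall>h\<in>carrier H. g (word_class H (lie_ideal H) (Gen h)) = f h"
proof (rule l.free_alg_universal)
  interpret K: lie_algebra K by fact
  show "bracket_ring K" by unfold_locales
  show "e r = \<one>\<^bsub>K\<^esub>" if "e \<in> brk_hom (nonassoc_ring H) K" "r \<in> lie_relations (nonassoc_ring H)" for e r
    by (rule K.lie_relations_vanish[OF bracket_ring_nonassoc_ring that])
qed fact

theorem free_quasi_lie_unique:
  assumes "group K" "g \<in> brk_hom (free_quasi_lie H) K" "g' \<in> brk_hom (free_quasi_lie H) K"
    and "\<And>h. h \<in> carrier H \<Longrightarrow> g (word_class H (quasi_lie_ideal H) (Gen h))
                                = g' (word_class H (quasi_lie_ideal H) (Gen h))"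
    and "X \<in> carrier (free_quasi_lie H)"
  shows "g X = g' X"
  by (rule q.free_alg_hom_eqI[OF assms])

theorem free_lie_unique:
  assumes "group K" "g \<in> brk_hom (free_lie H) K" "g' \<in> brk_hom (free_lie H) K"
    and "\<And>h. h \<in> carrier H \<Longrightarrow> g (word_class H (lie_ideal H) (Gen h))
                                = g' (word_class H (lie_ideal H) (Gen h))"
    and "X \<in> carrier (free_lie H)"
  shows "g X = g' X"
  by (rule l.free_alg_hom_eqI[OF assms])

lemma quasi_lie_ideal_le: "quasi_lie_ideal H \<subseteq> lie_ideal H"
proof
  fix r assume "r \<in> quasi_lie_ideal H"
  then show "r \<in> lie_ideal H"
    unfolding quasi_lie_ideal_def lie_ideal_def
    by (induction rule: brk_ideal.induct) (auto simp: lie_relations_def intro: brk_ideal.intros)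
qed

lemma lie_projection_coset:
  assumes x: "x \<in> carrier (nonassoc_ring H)"
  shows "lie_projection H (quasi_lie_ideal H #>\<^bsub>nonassoc_ring H\<^esub> x)
           = lie_ideal H #>\<^bsub>nonassoc_ring H\<^esub> x"
proof -
  have "lie_ideal H #>\<^bsub>nonassoc_ring H\<^esub> u = lie_ideal H #>\<^bsub>nonassoc_ring H\<^esub> x"
    if u: "u \<in> quasi_lie_ideal H #>\<^bsub>nonassoc_ring H\<^esub> x" for u
  proof -
    from q.coset_elem[OF u]
    obtain r where "r \<in> quasi_lie_ideal H" "u = r \<otimes>\<^bsub>nonassoc_ring H\<^esub> x" ..
    note r = this
    have "r \<in> lie_ideal H"
      by (rule subsetD[OF quasi_lie_ideal_le r(1)])
    moreover have "u \<in> carrier (nonassoc_ring H)"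
      unfolding r(2) by (rule q.m_closed[OF q.ideal_closed[OF r(1)] x])
    ultimately show ?thesis
      using x r(2) by (intro l.coset_eqI)
  qed
  then show ?thesis
    unfolding lie_projection_def
    by (rule UN_constant'[OF q.rcos_self[OF x q.ideal_subgroup]])
qed

theorem lie_projection_brk_hom: "lie_projection H \<in> brk_hom (free_quasi_lie H) (free_lie H)"
  unfolding brk_hom_def free_alg_def
  by (auto intro!: homI simp: q.carrier_quotient l.carrier_quotient q.mult_quotient l.mult_quotient
      q.brk_quotient l.brk_quotient lie_projection_coset q.brk_closed)

theorem lie_projection_word:
  "t \<in> bracketings H \<Longrightarrow>
     lie_projection H (word_class H (quasi_lie_ideal H) t) = word_class H (lie_ideal H) t"
  by (simp add: word_class_def lie_projection_coset nonassoc_ring_simps)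

lemma lie_projection_hom_degree: "lie_projection H \<in> hom (L' n H) (L n H)"
proof -
  interpret a: bracket_ring "free_quasi_lie H" by (rule q.bracket_ring_free_alg)
  interpret b: bracket_ring "free_lie H" by (rule l.bracket_ring_free_alg)
  interpret p: group_hom "free_quasi_lie H" "free_lie H" "lie_projection H"
    using lie_projection_brk_hom by unfold_locales (simp add: brk_hom_def)
  show ?thesis
    unfolding degree_part_def
  proof (rule p.hom_between_subgroups, rule image_subsetI, elim CollectE exE conjE)
    fix X t
    assume "X = word_class H (quasi_lie_ideal H) t" "t \<in> bracketings H" "weight t = n"
    then show "lie_projection H X
        \<in> {word_class H (lie_ideal H) t |t. t \<in> bracketings H \<and> weight t = n}"
      by (intro CollectI exI[of _ t]) (simp add: lie_projection_word)
  qed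
qed

lemma
  shows D_canonical_tensor_hom:
    "D_canonical H n \<in> hom (tensor H (L' (n + 1) H)) (tensor H (L (n + 1) H))"
  and D_canonical_tensor_of: "\<And>h x. \<lbrakk>h \<in> carrier H; x \<in> carrier (L' (n + 1) H)\<rbrakk>
    \<Longrightarrow> D_canonical H n (tensor_of H (L' (n + 1) H) h x)
          = tensor_of H (L (n + 1) H) h (lie_projection H x)"
proof -
  interpret T: tensor_product H "L (n + 1) H"
    by (rule tensor_product.intro[OF H l.comm_group_degree_part])
  interpret T': tensor_product H "L' (n + 1) H"
    by (rule tensor_product.intro[OF H q.comm_group_degree_part])
  note p = lie_projection_hom_degree[of "n + 1"]
  note pc = hom_in_carrier[OF p]
  have right: "tensor_of H (L (n + 1) H) a (lie_projection H (b \<otimes>\<^bsub>L' (n + 1) H\<^esub> b'))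
      = tensor_of H (L (n + 1) H) a (lie_projection H b) \<otimes>\<^bsub>tensor H (L (n + 1) H)\<^esub>
        tensor_of H (L (n + 1) H) a (lie_projection H b')"
    if "a \<in> carrier H" "b \<in> carrier (L' (n + 1) H)" "b' \<in> carrier (L' (n + 1) H)" for a b b'
    unfolding hom_mult[OF p that(2,3)]
    by (rule T.tensor_of_mult_right[OF that(1) pc[OF that(2)] pc[OF that(3)]])
  show "D_canonical H n \<in> hom (tensor H (L' (n + 1) H)) (tensor H (L (n + 1) H))"
    unfolding D_canonical_def tensor_map_def
    by (rule T'.tensor_lift_hom[OF T.T.comm_group_axioms T.tensor_of_closed[OF _ pc]
          T.tensor_of_mult_left[OF _ _ pc] right])
  show "D_canonical H n (tensor_of H (L' (n + 1) H) h x)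
          = tensor_of H (L (n + 1) H) h (lie_projection H x)"
    if "h \<in> carrier H" "x \<in> carrier (L' (n + 1) H)" for h x
    unfolding D_canonical_def tensor_map_def
    by (rule T'.tensor_lift_tensor_of[OF T.T.comm_group_axioms T.tensor_of_closed[OF _ pc]
          T.tensor_of_mult_left[OF _ _ pc] right that])
qed

lemma bracket_map_D_canonical:
  assumes X: "X \<in> carrier (tensor H (L' (n + 1) H))"
  shows "bracket_map H (lie_ideal H) n (D_canonical H n X)
           = lie_projection H (bracket_map H (quasi_lie_ideal H) n X)"
proof -
  interpret T': tensor_product H "L' (n + 1) H"
    by (rule tensor_product.intro[OF H q.comm_group_degree_part])
  interpret Ln: comm_group "L (n + 2) H" by (rule l.comm_group_degree_part)
  have "(bracket_map H (lie_ideal H) n \<circ> D_canonical H n) X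
      = (lie_projection H \<circ> bracket_map H (quasi_lie_ideal H) n) X"
  proof (rule T'.tensor_hom_eqI[OF Ln.is_group
        Group.hom_compose[OF D_canonical_tensor_hom l.bracket_map_hom]
        Group.hom_compose[OF q.bracket_map_hom lie_projection_hom_degree] _ X])
    fix h x assume h: "h \<in> carrier H" and x: "x \<in> carrier (L' (n + 1) H)"
    have "lie_projection H (brk (free_quasi_lie H) (word_class H (quasi_lie_ideal H) (Gen h)) x)
        = brk (free_lie H) (lie_projection H (word_class H (quasi_lie_ideal H) (Gen h)))
            (lie_projection H x)"
      using lie_projection_brk_hom q.degree_part_closed[OF x] q.word_class_closed[of "Gen h"] h
      by (simp add: brk_hom_def)
    then show "(bracket_map H (lie_ideal H) n \<circ> D_canonical H n) (tensor_of H (L' (n + 1) H) h x)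
        = (lie_projection H \<circ> bracket_map H (quasi_lie_ideal H) n) (tensor_of H (L' (n + 1) H) h x)"
      unfolding o_apply D_canonical_tensor_of[OF h x] q.bracket_map_tensor_of[OF h x]
        l.bracket_map_tensor_of[OF h hom_in_carrier[OF lie_projection_hom_degree x]]
      using h by (simp add: lie_projection_word)
  qed
  then show ?thesis by simp
qed

lemma D_canonical_hom: "D_canonical H n \<in> hom (D' n H) (D n H)"
proof -
  interpret a: comm_group "L' (n + 2) H" by (rule q.comm_group_degree_part)
  interpret b: comm_group "L (n + 2) H" by (rule l.comm_group_degree_part)
  have one: "lie_projection H \<one>\<^bsub>L' (n + 2) H\<^esub> = \<one>\<^bsub>L (n + 2) H\<^esub>"
    by (rule hom_one[OF lie_projection_hom_degree a.is_group b.is_group])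
  show ?thesis
  proof (rule homI)
    fix X assume "X \<in> carrier (D' n H)"
    then have X: "X \<in> carrier (tensor H (L' (n + 1) H))"
      "bracket_map H (quasi_lie_ideal H) n X = \<one>\<^bsub>L' (n + 2) H\<^esub>"
      unfolding bracket_kernel_def kernel_def by simp_all
    show "D_canonical H n X \<in> carrier (D n H)"
      using hom_in_carrier[OF D_canonical_tensor_hom X(1)] bracket_map_D_canonical[OF X(1)] X(2) one
      unfolding bracket_kernel_def kernel_def by simp
  next
    fix X Y assume "X \<in> carrier (D' n H)" "Y \<in> carrier (D' n H)"
    then show "D_canonical H n (X \<otimes>\<^bsub>D' n H\<^esub> Y) = D_canonical H n X \<otimes>\<^bsub>D n H\<^esub> D_canonical H n Y"
      using hom_mult[OF D_canonical_tensor_hom[of n], of X Y]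
      unfolding bracket_kernel_def kernel_def by simp
  qed
qed

end

end

theory Submission
  imports Defs
begin

text \<open>
  In a quasi-Lie algebra a self-bracket \<open>[x,x]\<close> is killed by \<open>2\<close> (antisymmetry), central (the
  Jacobi identity for \<open>x\<close>, \<open>x\<close>, \<open>z\<close>) and additive in \<open>x\<close>. So the ideal generated by all self-brackets
  is just the set of self-brackets, and this is the kernel of \<open>L' \<rightarrow> L\<close>. It vanishes in odd
  degrees, and in degree \<open>2k\<close> it is the image of a homomorphism \<open>L\<^sub>k \<otimes> \<int>/2 \<rightarrow> L'\<^sub>2\<^sub>k\<close>, which sends
  the class of \<open>x\<close> to \<open>[x,x]\<close>.

  The heart of the matter is that this homomorphism is injective: if \<open>[x,x] = 0\<close> in the free
  quasi-Lie algebra, then \<open>x\<close> is divisible by \<open>2\<close> in the free Lie algebra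
  (\<open>square_null_even\<close>). The proof is Lazard elimination. Fix a generator \<open>a\<close>. Setting \<open>a = 0\<close>
  splits off the words without \<open>a\<close>, so let \<open>a\<close> occur in every word of \<open>x\<close>. The algebra maps to the
  semidirect product of \<open>\<int>a\<close> with the free quasi-Lie algebra on the symbols
  \<open>y\<^sub>g\<^sub>,\<^sub>i = ad(a)\<^sup>i(g)\<close>, on which \<open>a\<close> acts by the derivation \<open>y\<^sub>g\<^sub>,\<^sub>i \<mapsto> y\<^sub>g\<^sub>,\<^sub>i\<^sub>+\<^sub>1\<close>. The image of \<open>x\<close> is
  \<open>ca + u\<close>, where \<open>u\<close> has smaller length in the new generators and \<open>[u,u] = 0\<close>; by induction \<open>u\<close>
  is divisible by \<open>2\<close> in the Lie algebra, and \<open>c\<close> is even because the coefficient of the word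
  \<open>[a,a]\<close> is defined modulo \<open>2\<close> in the quasi-Lie algebra. Reading the symbols \<open>y\<^sub>g\<^sub>,\<^sub>i\<close> as iterated
  brackets again recovers the image of \<open>x\<close> in the Lie algebra (\<open>unelim_elim\<close>), and divisibility
  survives.

  The sequences then come from the commutative square with rows
  \<open>H \<otimes> L'\<^sub>n\<^sub>+\<^sub>1 \<rightarrow> L'\<^sub>n\<^sub>+\<^sub>2\<close> and \<open>H \<otimes> L\<^sub>n\<^sub>+\<^sub>1 \<rightarrow> L\<^sub>n\<^sub>+\<^sub>2\<close>, whose kernels are \<open>D'\<^sub>n\<close> and \<open>D\<^sub>n\<close>. For \<open>n = 2k\<close>
  the left column is an isomorphism, so \<open>D'\<^sub>n \<rightarrow> D\<^sub>n\<close> is injective and, the upper row being onto, its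
  cokernel is the kernel \<open>L\<^sub>k\<^sub>+\<^sub>1 \<otimes> \<int>/2\<close> of the right column. For \<open>n = 2k - 1\<close> the right column is an
  isomorphism, so \<open>D'\<^sub>n\<close> is the full preimage of \<open>D\<^sub>n\<close>, and the kernel is that of the left column,
  which is \<open>H \<otimes> L\<^sub>k \<otimes> \<int>/2\<close> because \<open>H\<close> is free.
\<close>

section \<open>The relations of the free algebras\<close>

notation frag_brk (infixl "\<star>" 70)

lemma frag_brk_zero [simp]: "0 \<star> y = 0" "x \<star> 0 = 0"
  using frag_brk_add_left[of 0 0 y] frag_brk_add_right[of x 0 0] by simp_all

lemma frag_brk_minus: "(- x) \<star> y = - (x \<star> y)" "x \<star> (- y) = - (x \<star> y)"
  using frag_brk_add_left[of x "- x" y] frag_brk_add_right[of x y "- y"]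
  by (simp_all add: eq_neg_iff_add_eq_0 add.commute)

lemma frag_brk_diff: "(x - z) \<star> y = x \<star> y - z \<star> y" "x \<star> (y - z) = x \<star> y - x \<star> z"
  using frag_brk_add_left[of x "- z" y] frag_brk_add_right[of x y "- z"]
  by (simp_all add: frag_brk_minus)

lemmas frag_brk_distribs = frag_brk_add_left frag_brk_add_right frag_brk_diff frag_brk_minus

lemma frag_induct [case_names zero one diff]:
  assumes "P 0" "\<And>s. P (frag_of s)" "\<And>x y. P x \<Longrightarrow> P y \<Longrightarrow> P (x - y)"
  shows "P x"
  by (rule frag_induction[of x UNIV]) (simp_all add: assms)

definition jacobiator where
  "jacobiator x y z = x \<star> y \<star> z + y \<star> z \<star> x + z \<star> x \<star> y"

text \<open>The consequences of the quasi-Lie axioms, and for \<open>strict\<close> also of \<open>[x,x] = 0\<close>, in the free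
non-associative ring on a whole type of generators. Congruence modulo this set
replaces equality in the quotient, so that substitutions can be computed on representatives.\<close>

inductive_set lie_null :: "bool \<Rightarrow> ('g bracketing \<Rightarrow>\<^sub>0 int) set" for strict where
  zero: "0 \<in> lie_null strict"
| diff: "\<lbrakk>x \<in> lie_null strict; y \<in> lie_null strict\<rbrakk> \<Longrightarrow> x - y \<in> lie_null strict"
| left: "x \<in> lie_null strict \<Longrightarrow> z \<star> x \<in> lie_null strict"
| right: "x \<in> lie_null strict \<Longrightarrow> x \<star> z \<in> lie_null strict"
| antisym: "x \<star> y + y \<star> x \<in> lie_null strict"
| jacobi: "jacobiator x y z \<in> lie_null strict"
| self: "strict \<Longrightarrow> x \<star> x \<in> lie_null strict"

lemma lie_null_uminus: "x \<in> lie_null s \<Longrightarrow> - x \<in> lie_null s"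
  using lie_null.diff[OF lie_null.zero] by fastforce

lemma lie_null_add: "\<lbrakk>x \<in> lie_null s; y \<in> lie_null s\<rbrakk> \<Longrightarrow> x + y \<in> lie_null s"
  using lie_null.diff[OF _ lie_null_uminus] by fastforce

lemma lie_null_diff_trans: "\<lbrakk>x - y \<in> lie_null s; y - z \<in> lie_null s\<rbrakk> \<Longrightarrow> x - z \<in> lie_null s"
  using lie_null_add by fastforce

lemma lie_null_cong: "x - y \<in> lie_null s \<Longrightarrow> x \<in> lie_null s \<longleftrightarrow> y \<in> lie_null s"
  by (metis add_diff_cancel_left' diff_add_cancel lie_null_add lie_null.diff)

lemma lie_null_brk_cong:
  assumes "x - x' \<in> lie_null s" "y - y' \<in> lie_null s"
  shows "x \<star> y - x' \<star> y' \<in> lie_null s"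
proof -
  have "x \<star> y - x' \<star> y' = (x - x') \<star> y + x' \<star> (y - y')"
    by (simp add: frag_brk_distribs)
  then show ?thesis using assms by (auto intro: lie_null_add lie_null.intros)
qed

text \<open>Since \<open>[y,y]\<close> and \<open>- [y,y]\<close> are congruent, additivity of self-brackets takes this form for
differences, which are what induction over fragments produces.\<close>

lemma square_diff: "(x - y) \<star> (x - y) - (x \<star> x - y \<star> y) \<in> lie_null s"
proof -
  have "(x - y) \<star> (x - y) - (x \<star> x - y \<star> y) = (y \<star> y + y \<star> y) - (x \<star> y + y \<star> x)"
    by (simp add: frag_brk_distribs)
  then show ?thesis by (simp only:) (intro lie_null.intros)
qed

text \<open>The Jacobi identity for \<open>x\<close>, \<open>x\<close>, \<open>z\<close> has two terms that cancel by antisymmetry.\<close>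

lemma square_central: "x \<star> x \<star> z \<in> lie_null s" "z \<star> (x \<star> x) \<in> lie_null s"
proof -
  have "x \<star> x \<star> z = jacobiator x x z - (x \<star> z + z \<star> x) \<star> x"
    by (simp add: jacobiator_def frag_brk_distribs)
  then show *: "x \<star> x \<star> z \<in> lie_null s"
    by (simp only:) (intro lie_null.intros)
  have "z \<star> (x \<star> x) = (z \<star> (x \<star> x) + x \<star> x \<star> z) - x \<star> x \<star> z" by simp
  then show "z \<star> (x \<star> x) \<in> lie_null s"
    using lie_null.diff[OF lie_null.antisym[of z "x \<star> x"] *] by simp
qed

text \<open>Self-brackets are additive and central, so they already form the ideal that they generate.\<close>

lemma lie_null_imp_square: "x \<in> lie_null True \<Longrightarrow> \<exists>y. x - y \<star> y \<in> lie_null False"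
proof (induction rule: lie_null.induct)
  case (diff x y)
  then obtain u v where uv: "x - u \<star> u \<in> lie_null False" "y - v \<star> v \<in> lie_null False" by blast
  have "(x - y) - (u - v) \<star> (u - v)
     = (x - u \<star> u) - (y - v \<star> v) - ((u - v) \<star> (u - v) - (u \<star> u - v \<star> v))" by simp
  then have "(x - y) - (u - v) \<star> (u - v) \<in> lie_null False"
    using lie_null.diff[OF lie_null.diff[OF uv] square_diff] by (simp only:)
  then show ?case by blast
next
  case (left x z)
  then obtain u where u: "x - u \<star> u \<in> lie_null False" by blast
  have "z \<star> x = z \<star> (x - u \<star> u) + z \<star> (u \<star> u)" by (simp add: frag_brk_distribs)
  then have "z \<star> x - 0 \<star> 0 \<in> lie_null False"
    using u by (auto intro: lie_null_add lie_null.left square_central)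
  then show ?case by blast
next
  case (right x z)
  then obtain u where u: "x - u \<star> u \<in> lie_null False" by blast
  have "x \<star> z = (x - u \<star> u) \<star> z + u \<star> u \<star> z" by (simp add: frag_brk_distribs)
  then have "x \<star> z - 0 \<star> 0 \<in> lie_null False"
    using u by (auto intro: lie_null_add lie_null.right square_central)
  then show ?case by blast
next
  case (self x)
  then show ?case by (metis diff_self lie_null.zero)
qed (metis diff_zero frag_brk_zero(1) lie_null.zero lie_null.antisym lie_null.jacobi)+

section \<open>Homogeneous components\<close>

definition component :: "nat \<Rightarrow> ('g bracketing \<Rightarrow>\<^sub>0 int) \<Rightarrow> ('g bracketing \<Rightarrow>\<^sub>0 int)" where
  "component n = frag_extend (\<lambda>t. if weight t = n then frag_of t else 0)"

lemma component_simps [simp]: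
  "component n 0 = 0" "component n (x + y) = component n x + component n y"
  "component n (x - y) = component n x - component n y"
  "component n (frag_of t) = (if weight t = n then frag_of t else 0)"
  by (simp_all add: component_def frag_extend_add frag_extend_diff)

lemma weight_pos: "weight t > 0"
  by (induction t) auto

lemma component_word_brk:
  "component n (frag_of s \<star> x)
     = (if weight s \<le> n then frag_of s \<star> component (n - weight s) x else 0)"
  "component n (x \<star> frag_of s)
     = (if weight s \<le> n then component (n - weight s) x \<star> frag_of s else 0)"
  by (induction x rule: frag_induct) (auto simp: frag_brk_diff)

lemma component_antisym: "component n (x \<star> y + y \<star> x) \<in> lie_null strict"
proof (induction x rule: frag_induct)
  case (one u)
  show ?case
  proof (induction y rule: frag_induct)
    case (one v)
    show ?case
      using lie_null.antisym[of "frag_of u" "frag_of v"] by (auto simp: add.commute lie_null.zero)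
  next
    case (diff a b)
    then show ?case using lie_null.diff[OF diff] by (simp add: frag_brk_diff algebra_simps)
  qed (simp add: lie_null.zero)
next
  case (diff a b)
  then show ?case using lie_null.diff[OF diff] by (simp add: frag_brk_diff algebra_simps)
qed (simp add: lie_null.zero)

lemma component_jacobi: "component n (jacobiator x y z) \<in> lie_null strict"
proof (induction x rule: frag_induct)
  case (one u)
  show ?case 
  proof (induction y rule: frag_induct)
    case (one v)
    show ?case
    proof (induction z rule: frag_induct)
      case (one w)
      show ?case using lie_null.jacobi[of "frag_of u" "frag_of v" "frag_of w" strict]
        by (auto simp: jacobiator_def add_ac lie_null.zero)
    next
      case (diff a b)
      then show ?case using lie_null.diff[OF diff] by (simp add: jacobiator_def frag_brk_diff algebra_simps)
    qed (simp add: jacobiator_def lie_null.zero)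
  next
    case (diff a b)
    then show ?case using lie_null.diff[OF diff] by (simp add: jacobiator_def frag_brk_diff algebra_simps)
  qed (simp add: jacobiator_def lie_null.zero)
next
  case (diff a b)
  then show ?case using lie_null.diff[OF diff] by (simp add: jacobiator_def frag_brk_diff algebra_simps)
qed (simp add: jacobiator_def lie_null.zero)

text \<open>The homogeneous component of \<open>[x,x]\<close> up to congruence: the mixed terms \<open>[x\<^sub>i,x\<^sub>j] + [x\<^sub>j,x\<^sub>i]\<close> cancel.\<close>

abbreviation halved_square :: "nat \<Rightarrow> ('g bracketing \<Rightarrow>\<^sub>0 int) \<Rightarrow> ('g bracketing \<Rightarrow>\<^sub>0 int)" where
  "halved_square n x \<equiv> if even n then component (n div 2) x \<star> component (n div 2) x else 0"

lemma component_square: "component n (x \<star> x) - halved_square n x \<in> lie_null strict"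
proof (induction x rule: frag_induct)
  case zero
  then show ?case by (simp add: lie_null.zero)
next
  case (one w)
  have "weight w + weight w \<noteq> n" if "odd n"
    using that by (metis even_add)
  then show ?case by (auto simp: lie_null.zero)
next
  case (diff a b)
  let ?a = "component (n div 2) a" and ?b = "component (n div 2) b"
  have 1: "component n ((a - b) \<star> (a - b)) - (component n (a \<star> a) - component n (b \<star> b)) \<in> lie_null strict"
  proof -
    have "component n ((a - b) \<star> (a - b)) - (component n (a \<star> a) - component n (b \<star> b))
      = component n (b \<star> b + b \<star> b) - component n (a \<star> b + b \<star> a)"
      by (simp add: frag_brk_distribs)
    then show ?thesis by (simp only:) (intro lie_null.diff component_antisym)
  qed
  have 2: "halved_square n a - halved_square n b - halved_square n (a - b) \<in> lie_null strict"
    using lie_null_uminus[OF square_diff[of ?a ?b strict]] by (auto simp: lie_null.zero)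
  have 3: "(component n (a \<star> a) - component n (b \<star> b)) - (halved_square n a - halved_square n b) \<in> lie_null strict"
    using lie_null.diff[OF diff] by (simp add: algebra_simps)
  show ?case
    by (rule lie_null_diff_trans[OF 1 lie_null_diff_trans[OF 3 2]])
qed

text \<open>The relations are not homogeneous, but they are multilinear up to additivity of
self-brackets, so it suffices to test them on words.\<close>

lemma component_lie_null: "x \<in> lie_null strict \<Longrightarrow> component n x \<in> lie_null strict"
proof (induction arbitrary: n rule: lie_null.induct)
  case (left x z)
  show ?case
    by (induction z rule: frag_induct)
       (auto simp: component_word_brk frag_brk_diff left intro: lie_null.intros)
next
  case (right x z)
  show ?case
    by (induction z rule: frag_induct)
       (auto simp: component_word_brk frag_brk_diff right intro: lie_null.intros)
next
  case (antisym x y)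
  show ?case by (rule component_antisym)
next
  case (jacobi x y z)
  show ?case by (rule component_jacobi)
next
  case (self x)
  then have "halved_square n x \<in> lie_null strict" by (auto intro: lie_null.intros)
  then show ?case using lie_null_cong[OF component_square] by blast
qed (simp_all add: lie_null.zero lie_null.diff)

section \<open>Substitutions and derivations\<close>

primrec subst_word :: "('g \<Rightarrow> ('h bracketing \<Rightarrow>\<^sub>0 int)) \<Rightarrow> 'g bracketing \<Rightarrow> ('h bracketing \<Rightarrow>\<^sub>0 int)" where
  "subst_word f (Gen a) = f a"
| "subst_word f (Br s t) = subst_word f s \<star> subst_word f t"

definition subst :: "('g \<Rightarrow> ('h bracketing \<Rightarrow>\<^sub>0 int)) \<Rightarrow> ('g bracketing \<Rightarrow>\<^sub>0 int) \<Rightarrow> ('h bracketing \<Rightarrow>\<^sub>0 int)" where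
  "subst f = frag_extend (subst_word f)"

lemma subst_simps [simp]:
  "subst f 0 = 0" "subst f (frag_of t) = subst_word f t" "subst f (- x) = - subst f x"
  "subst f (x + y) = subst f x + subst f y" "subst f (x - y) = subst f x - subst f y"
  by (simp_all add: subst_def frag_extend_add frag_extend_diff frag_extend_minus)

lemma subst_brk: "subst f (x \<star> y) = subst f x \<star> subst f y"
proof (induction x rule: frag_induct)
  case (one s)
  show ?case by (induction y rule: frag_induct) (simp_all add: frag_brk_diff)
qed (simp_all add: frag_brk_diff)

lemma subst_lie_null: "x \<in> lie_null strict \<Longrightarrow> subst f x \<in> lie_null strict"
proof (induction rule: lie_null.induct)
  case (jacobi x y z)
  then show ?case using lie_null.jacobi[of "subst f x" "subst f y" "subst f z"]
    by (simp add: jacobiator_def subst_brk)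
qed (simp_all add: subst_brk lie_null.intros)

primrec derivation_word :: "('g \<Rightarrow> ('g bracketing \<Rightarrow>\<^sub>0 int)) \<Rightarrow> 'g bracketing \<Rightarrow> ('g bracketing \<Rightarrow>\<^sub>0 int)" where
  "derivation_word d (Gen a) = d a"
| "derivation_word d (Br s t) = derivation_word d s \<star> frag_of t + frag_of s \<star> derivation_word d t"

definition derivation :: "('g \<Rightarrow> ('g bracketing \<Rightarrow>\<^sub>0 int)) \<Rightarrow> ('g bracketing \<Rightarrow>\<^sub>0 int) \<Rightarrow> ('g bracketing \<Rightarrow>\<^sub>0 int)" where
  "derivation d = frag_extend (derivation_word d)"

lemma derivation_simps [simp]:
  "derivation d 0 = 0" "derivation d (frag_of t) = derivation_word d t" "derivation d (- x) = - derivation d x"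
  "derivation d (x + y) = derivation d x + derivation d y" "derivation d (x - y) = derivation d x - derivation d y"
  by (simp_all add: derivation_def frag_extend_add frag_extend_diff frag_extend_minus)

lemma derivation_brk: "derivation d (x \<star> y) = derivation d x \<star> y + x \<star> derivation d y"
proof (induction x rule: frag_induct)
  case (one s)
  show ?case by (induction y rule: frag_induct) (simp_all add: frag_brk_diff)
qed (simp_all add: frag_brk_diff)

lemma derivation_lie_null: "x \<in> lie_null strict \<Longrightarrow> derivation d x \<in> lie_null strict"
proof (induction rule: lie_null.induct)
  case (antisym x y)
  have "derivation d (x \<star> y + y \<star> x)
    = (derivation d x \<star> y + y \<star> derivation d x) + (x \<star> derivation d y + derivation d y \<star> x)"
    by (simp add: derivation_brk)
  then show ?case by (simp only:) (intro lie_null_add lie_null.antisym)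
next
  case (jacobi x y z)
  have "derivation d (jacobiator x y z)
    = jacobiator (derivation d x) y z + jacobiator x (derivation d y) z + jacobiator x y (derivation d z)"
    by (simp add: derivation_brk jacobiator_def frag_brk_distribs)
  then show ?case by (simp only:) (intro lie_null_add lie_null.jacobi)
qed (simp_all add: derivation_brk lie_null.intros lie_null_add)

lemma lie_null_cmul: "x \<in> lie_null strict \<Longrightarrow> frag_cmul c x \<in> lie_null strict"
  by (rule frag_closure_minus_cmul[where P = "\<lambda>y. y \<in> lie_null strict"]) (simp_all add: lie_null.intros)

lemma frag_cmul_diff2: "frag_cmul c (a - b) = frag_cmul c a - frag_cmul c b"
  using frag_cmul_distrib2[of c "a - b" b] by (simp add: algebra_simps)

lemma frag_brk_cmul: "frag_cmul c x \<star> y = frag_cmul c (x \<star> y)" "x \<star> frag_cmul c y = frag_cmul c (x \<star> y)"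
proof -
  show "frag_cmul c x \<star> y = frag_cmul c (x \<star> y)"
    by (simp add: frag_brk_def frag_extend_cmul)
  show "x \<star> frag_cmul c y = frag_cmul c (x \<star> y)"
    by (induction x rule: frag_induct)
       (simp_all add: frag_brk_diff frag_cmul_diff2, simp add: frag_brk_def frag_extend_cmul)
qed

lemma lookup_frag_brk_Br:
  "Poly_Mapping.lookup (x \<star> y) (Br s t) = Poly_Mapping.lookup x s * Poly_Mapping.lookup y t"
proof (induction x rule: frag_induct)
  case (one u)
  show ?case by (induction y rule: frag_induct) (simp_all add: frag_brk_diff lookup_minus algebra_simps)
qed (simp_all add: frag_brk_diff lookup_minus algebra_simps)

lemma lookup_frag_brk_Gen: "Poly_Mapping.lookup (x \<star> y) (Gen g) = 0"
proof (induction x rule: frag_induct)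
  case (one u)
  show ?case by (induction y rule: frag_induct) (simp_all add: frag_brk_diff lookup_minus)
qed (simp_all add: frag_brk_diff lookup_minus)

lemma lie_null_lookup_Gen: "x \<in> lie_null strict \<Longrightarrow> Poly_Mapping.lookup x (Gen g) = 0"
  by (induction rule: lie_null.induct)
     (simp_all add: lookup_frag_brk_Gen jacobiator_def lookup_add lookup_minus)

text \<open>An antisymmetry relation has twice a product as its coefficient at \<open>[g,g]\<close>, while Jacobi
relations and brackets with relations do not contain this word.\<close>

lemma lie_null_lookup_square:
  "x \<in> lie_null False \<Longrightarrow> even (Poly_Mapping.lookup x (Br (Gen g) (Gen g)))"
  by (induction rule: lie_null.induct)
     (simp_all add: lookup_frag_brk_Gen lookup_frag_brk_Br jacobiator_def lookup_add lookup_minus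
       lie_null_lookup_Gen)

section \<open>Lazard elimination\<close>

text \<open>The symbol \<open>y\<^sub>g\<^sub>,\<^sub>i\<close> that stands for \<open>ad(a)\<^sup>i(g)\<close> is encoded as a number, so that elimination does
not leave the type of words and can be iterated.\<close>

definition shift_gen :: "nat \<Rightarrow> (nat bracketing \<Rightarrow>\<^sub>0 int)" where
  "shift_gen g = frag_of (Gen (prod_encode (fst (prod_decode g), Suc (snd (prod_decode g)))))"

abbreviation "shift \<equiv> derivation shift_gen"

text \<open>The component in the free algebra on the symbols \<open>y\<^sub>g\<^sub>,\<^sub>i\<close> of the map to the semidirect product; its
other component is the coefficient of \<open>a\<close>. The bracket there is
\<open>[ca + u, da + v] = c Dv - d Du + [u,v]\<close> with \<open>D\<close> the shift.\<close>

primrec elim_word :: "nat \<Rightarrow> nat bracketing \<Rightarrow> (nat bracketing \<Rightarrow>\<^sub>0 int)" where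
  "elim_word a (Gen g) = (if g = a then 0 else frag_of (Gen (prod_encode (g, 0))))"
| "elim_word a (Br s t) = (if s = Gen a then shift (elim_word a t) else 0)
     - (if t = Gen a then shift (elim_word a s) else 0) + elim_word a s \<star> elim_word a t"

definition elim :: "nat \<Rightarrow> (nat bracketing \<Rightarrow>\<^sub>0 int) \<Rightarrow> (nat bracketing \<Rightarrow>\<^sub>0 int)" where
  "elim a = frag_extend (elim_word a)"

abbreviation gen_coeff :: "'g \<Rightarrow> ('g bracketing \<Rightarrow>\<^sub>0 int) \<Rightarrow> int" where
  "gen_coeff a x \<equiv> Poly_Mapping.lookup x (Gen a)"

lemma elim_simps [simp]:
  "elim a 0 = 0" "elim a (frag_of t) = elim_word a t" 
  "elim a (x + y) = elim a x + elim a y" "elim a (x - y) = elim a x - elim a y"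
  by (simp_all add: elim_def frag_extend_add frag_extend_diff frag_extend_minus)

lemma derivation_cmul: "derivation d (frag_cmul c x) = frag_cmul c (derivation d x)"
  by (simp add: derivation_def frag_extend_cmul)

lemma elim_brk:
  "elim a (x \<star> y) = frag_cmul (gen_coeff a x) (shift (elim a y))
     - frag_cmul (gen_coeff a y) (shift (elim a x)) + elim a x \<star> elim a y"
proof (induction x rule: frag_induct)
  case (one s)
  show ?case
    by (induction y rule: frag_induct)
       (auto simp: frag_brk_diff frag_cmul_diff2 frag_cmul_diff_distrib lookup_minus)
qed (simp_all add: frag_brk_diff frag_cmul_diff2 frag_cmul_diff_distrib lookup_minus)

text \<open>The semidirect product is again a quasi-Lie algebra: in the Jacobi identity the terms with two
shifts cancel, and those with one shift are antisymmetry relations.\<close>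

lemma elim_lie_null: "x \<in> lie_null strict \<Longrightarrow> elim a x \<in> lie_null strict"
proof (induction rule: lie_null.induct)
  case (jacobi x y z)
  let ?x = "elim a x" and ?y = "elim a y" and ?z = "elim a z"
  have "elim a (jacobiator x y z) = jacobiator ?x ?y ?z
     - frag_cmul (gen_coeff a x) (?y \<star> shift ?z + shift ?z \<star> ?y)
     - frag_cmul (gen_coeff a y) (?z \<star> shift ?x + shift ?x \<star> ?z)
     - frag_cmul (gen_coeff a z) (?x \<star> shift ?y + shift ?y \<star> ?x)"
    by (simp add: jacobiator_def elim_brk lookup_frag_brk_Gen derivation_brk derivation_cmul frag_brk_cmul
        frag_brk_distribs frag_cmul_diff2 frag_cmul_distrib2 mult.commute del: minus_frag_cmul)
  then show ?case
    by (simp only:) (intro lie_null.diff lie_null_cmul lie_null.jacobi lie_null.antisym)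
qed (simp_all add: elim_brk lie_null_lookup_Gen lie_null.intros lie_null_add lie_null_cmul derivation_lie_null)

primrec ad_power :: "nat \<Rightarrow> nat \<Rightarrow> nat \<Rightarrow> (nat bracketing \<Rightarrow>\<^sub>0 int)" where
  "ad_power a g 0 = frag_of (Gen g)"
| "ad_power a g (Suc i) = frag_of (Gen a) \<star> ad_power a g i"

text \<open>The way back reads each symbol \<open>y\<^sub>g\<^sub>,\<^sub>i\<close> as the iterated bracket \<open>ad(a)\<^sup>i(g)\<close>.\<close>

definition unelim :: "nat \<Rightarrow> (nat bracketing \<Rightarrow>\<^sub>0 int) \<Rightarrow> (nat bracketing \<Rightarrow>\<^sub>0 int)" where
  "unelim a = subst (\<lambda>g. ad_power a (fst (prod_decode g)) (snd (prod_decode g)))"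

lemma unelim_lie_null: "x \<in> lie_null strict \<Longrightarrow> unelim a x \<in> lie_null strict"
  unfolding unelim_def by (rule subst_lie_null)

lemma ad_derivation: "x \<star> y \<star> z + y \<star> (x \<star> z) - x \<star> (y \<star> z) \<in> lie_null strict"
proof -
  have "x \<star> y \<star> z + y \<star> (x \<star> z) - x \<star> (y \<star> z) = jacobiator x y z 
    - (y \<star> z \<star> x + x \<star> (y \<star> z)) - (z \<star> x \<star> y + y \<star> (z \<star> x)) + y \<star> (z \<star> x + x \<star> z)"
    by (simp add: jacobiator_def frag_brk_distribs)
  then show ?thesis
    by (simp only:) (intro lie_null.diff lie_null_add lie_null.left lie_null.jacobi lie_null.antisym)
qed

text \<open>Both \<open>D\<close> and \<open>ad(a)\<close> are derivations, and they agree on the symbols by construction.\<close>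

lemma unelim_shift: "unelim a (shift u) - frag_of (Gen a) \<star> unelim a u \<in> lie_null strict"
proof (induction u rule: frag_induct)
  case (one w)
  show ?case
  proof (induction w)
    case (Gen g)
    then show ?case by (simp add: unelim_def shift_gen_def lie_null.zero)
  next
    case (Br s t)
    let ?a = "frag_of (Gen a)" and ?s = "unelim a (frag_of s)" and ?t = "unelim a (frag_of t)"
    have eq: "unelim a (shift (frag_of (Br s t))) - ?a \<star> unelim a (frag_of (Br s t))
       = (unelim a (shift (frag_of s)) - ?a \<star> ?s) \<star> ?t + ?s \<star> (unelim a (shift (frag_of t)) - ?a \<star> ?t)
        + (?a \<star> ?s \<star> ?t + ?s \<star> (?a \<star> ?t) - ?a \<star> (?s \<star> ?t))"
      by (simp add: unelim_def subst_brk frag_brk_distribs)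
    show ?case unfolding eq
      by (intro lie_null_add lie_null.left lie_null.right Br ad_derivation)
  qed
next
  case (diff x y)
  then show ?case using lie_null.diff[OF diff] by (simp add: unelim_def frag_brk_distribs algebra_simps)
qed (simp add: unelim_def lie_null.zero)

text \<open>Both sides respect brackets and agree on generators. Strictness enters only through \<open>[a,a]\<close>, to
which the semidirect product assigns the value zero.\<close>

lemma unelim_elim:
  "frag_cmul (gen_coeff a x) (frag_of (Gen a)) + unelim a (elim a x) - x \<in> lie_null True"
proof (induction x rule: frag_induct)
  case (one w)
  show ?case
  proof (induction w)
    case (Gen g)
    then show ?case by (simp add: unelim_def lie_null.zero)
  next
    case (Br s t)
    define E where "E x = frag_cmul (gen_coeff a x) (frag_of (Gen a)) + unelim a (elim a x)" for x
    let ?a = "frag_of (Gen a)" and ?s = "unelim a (elim a (frag_of s))" and ?t = "unelim a (elim a (frag_of t))"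
    define cs ct where "cs = gen_coeff a (frag_of s)" and "ct = gen_coeff a (frag_of t)"
    have u: "unelim a (frag_cmul c x) = frag_cmul c (unelim a x)" 
      "unelim a (x + y) = unelim a x + unelim a y" "unelim a (x - y) = unelim a x - unelim a y" 
      "unelim a (x \<star> y) = unelim a x \<star> unelim a y"
      for c x y
      by (simp_all add: unelim_def subst_brk) (simp add: subst_def frag_extend_cmul)
    have "E (frag_of s \<star> frag_of t) - E (frag_of s) \<star> E (frag_of t) =
       frag_cmul cs (unelim a (shift (elim a (frag_of t))) - ?a \<star> ?t)
       - frag_cmul ct (unelim a (shift (elim a (frag_of s))) - ?a \<star> ?s)
       - frag_cmul ct (?a \<star> ?s + ?s \<star> ?a) - frag_cmul (cs * ct) (?a \<star> ?a)"
      unfolding E_def cs_def ct_def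
      by (simp only: elim_brk lookup_frag_brk_Gen u)
         (simp add: frag_brk_distribs frag_brk_cmul frag_cmul_diff2 frag_cmul_distrib2 mult.commute)
    also have "\<dots> \<in> lie_null True"
      by (intro lie_null.diff lie_null_cmul unelim_shift lie_null.antisym lie_null.self) simp
    finally have 1: "E (frag_of s \<star> frag_of t) - E (frag_of s) \<star> E (frag_of t) \<in> lie_null True" .
    have 2: "E (frag_of s) \<star> E (frag_of t) - frag_of s \<star> frag_of t \<in> lie_null True"
      using Br unfolding E_def by (rule lie_null_brk_cong)
    show ?case
      using lie_null_diff_trans[OF 1 2] by (simp add: E_def)
  qed
next
  case (diff x y)
  then show ?case using lie_null.diff[OF diff]
    by (simp add: unelim_def lookup_minus frag_cmul_diff_distrib algebra_simps)
qed (simp add: unelim_def lie_null.zero)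

section \<open>Elimination shortens words\<close>

lemma keys_frag_brk: "Poly_Mapping.keys (x \<star> y) \<subseteq> {Br s t | s t. s \<in> Poly_Mapping.keys x \<and> t \<in> Poly_Mapping.keys y}"
proof
  fix u assume u: "u \<in> Poly_Mapping.keys (x \<star> y)"
  show "u \<in> {Br s t | s t. s \<in> Poly_Mapping.keys x \<and> t \<in> Poly_Mapping.keys y}"
  proof (cases u)
    case (Gen g)
    then show ?thesis using u by (simp add: in_keys_iff lookup_frag_brk_Gen)
  next
    case (Br s t)
    then show ?thesis using u by (simp add: in_keys_iff lookup_frag_brk_Br)
  qed
qed

definition max_weight :: "nat \<Rightarrow> ('g bracketing \<Rightarrow>\<^sub>0 int) \<Rightarrow> bool" where
  "max_weight k x \<longleftrightarrow> (\<forall>t\<in>Poly_Mapping.keys x. weight t \<le> k)"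

lemma max_weight_simps [simp]:
  "max_weight k 0" "max_weight k (frag_of t) \<longleftrightarrow> weight t \<le> k"
  by (simp_all add: max_weight_def)

lemma max_weight_add: "\<lbrakk>max_weight k x; max_weight k y\<rbrakk> \<Longrightarrow> max_weight k (x + y)"
  unfolding max_weight_def using Poly_Mapping.keys_add[of x y] by blast

lemma max_weight_diff: "\<lbrakk>max_weight k x; max_weight k y\<rbrakk> \<Longrightarrow> max_weight k (x - y)"
  unfolding max_weight_def using keys_diff[of x y] by blast

lemma max_weight_brk: "\<lbrakk>max_weight k x; max_weight l y\<rbrakk> \<Longrightarrow> max_weight (k + l) (x \<star> y)"
  unfolding max_weight_def using keys_frag_brk[of x y] by (fastforce intro: add_mono)

lemma max_weight_mono: "\<lbrakk>max_weight k x; k \<le> l\<rbrakk> \<Longrightarrow> max_weight l x"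
  unfolding max_weight_def by force

lemma max_weight_extend:
  assumes "max_weight k x" and "\<And>t. \<lbrakk>t \<in> Poly_Mapping.keys x; weight t \<le> k\<rbrakk> \<Longrightarrow> max_weight l (f t)"
  shows "max_weight l (frag_extend f x)"
  using assms keys_frag_extend[of f x] unfolding max_weight_def by blast

lemma max_weight_shift_word: "max_weight (weight t) (derivation_word shift_gen t)"
proof (induction t)
  case (Gen g)
  then show ?case by (simp add: shift_gen_def)
next
  case (Br s t)
  then show ?case by (simp add: max_weight_add max_weight_brk)
qed

lemma max_weight_shift: "max_weight k x \<Longrightarrow> max_weight k (shift x)"
  unfolding derivation_def
  by (rule max_weight_extend) (auto intro: max_weight_mono max_weight_shift_word)

text \<open>An occurrence of \<open>a\<close> is absorbed into the index of a symbol and no longer counts as a letter.\<close>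

lemma max_weight_elim_word:
  "max_weight (weight t - (if a \<in> set_bracketing t then 1 else 0)) (elim_word a t)"
proof (induction t)
  case (Br s t)
  let ?w = "\<lambda>t. weight t - (if a \<in> set_bracketing t then 1 else 0)"
  have pos: "weight s > 0" "weight t > 0" by (rule weight_pos)+
  have "max_weight (?w (Br s t)) (elim_word a s \<star> elim_word a t)"
    by (rule max_weight_mono[OF max_weight_brk[OF Br]]) (use pos in auto)
  moreover have "max_weight (?w (Br s t)) (if s = Gen a then shift (elim_word a t) else 0)"
    using max_weight_mono[OF max_weight_shift[OF Br(2)]] by auto
  moreover have "max_weight (?w (Br s t)) (if t = Gen a then shift (elim_word a s) else 0)"
    using max_weight_mono[OF max_weight_shift[OF Br(1)]] by auto
  ultimately show ?case
    by (simp add: max_weight_add max_weight_diff)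
qed simp

lemma max_weight_elim:
  assumes "max_weight (Suc k) x" and "\<And>t. t \<in> Poly_Mapping.keys x \<Longrightarrow> a \<in> set_bracketing t"
  shows "max_weight k (elim a x)"
  unfolding elim_def
proof (rule max_weight_extend[OF assms(1)])
  fix t assume t: "t \<in> Poly_Mapping.keys x" "weight t \<le> Suc k"
  show "max_weight k (elim_word a t)"
    by (rule max_weight_mono[OF max_weight_elim_word[of t a]]) (use t assms(2) in auto)
qed

text \<open>Setting the generator \<open>a\<close> to zero keeps exactly the words that avoid \<open>a\<close>.\<close>

abbreviation kill :: "'g \<Rightarrow> ('g bracketing \<Rightarrow>\<^sub>0 int) \<Rightarrow> ('g bracketing \<Rightarrow>\<^sub>0 int)" where
  "kill a \<equiv> subst (\<lambda>g. if g = a then 0 else frag_of (Gen g))"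

lemma kill_word: "subst_word (\<lambda>g. if g = a then 0 else frag_of (Gen g)) t
     = (if a \<in> set_bracketing t then 0 else frag_of t)"
  by (induction t) auto

lemma keys_kill: "Poly_Mapping.keys (kill a x) \<subseteq> {t \<in> Poly_Mapping.keys x. a \<notin> set_bracketing t}"
  unfolding subst_def kill_word
  using keys_frag_extend[of "\<lambda>t. if a \<in> set_bracketing t then 0 else frag_of t" x]
  by (fastforce split: if_splits)

lemma keys_diff_kill: "t \<in> Poly_Mapping.keys (x - kill a x) \<Longrightarrow> a \<in> set_bracketing t"
proof -
  have "Poly_Mapping.lookup (kill a x) t = (if a \<in> set_bracketing t then 0 else Poly_Mapping.lookup x t)"
    by (induction x rule: frag_induct) (auto simp: kill_word lookup_minus)
  then show "t \<in> Poly_Mapping.keys (x - kill a x) \<Longrightarrow> a \<in> set_bracketing t"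
    by (simp add: in_keys_iff lookup_minus split: if_splits)
qed

lemma finite_set_bracketing: "finite (set_bracketing t)"
  by (induction t) auto

lemma set_bracketing_nonempty: "set_bracketing t \<noteq> {}"
  by (induction t) simp_all

text \<open>Induction on the length, and for fixed length on the set of letters: killing a letter \<open>a\<close> leaves
fewer letters, while on the words that contain \<open>a\<close> elimination lowers the length. The number of
letters may grow there, whence the order of the two inductions.\<close>

lemma square_null_even_aux:
  fixes x :: "nat bracketing \<Rightarrow>\<^sub>0 int"
  assumes "finite S" "max_weight k x" "\<And>t. t \<in> Poly_Mapping.keys x \<Longrightarrow> set_bracketing t \<subseteq> S"
    and "x \<star> x \<in> lie_null False"
  shows "\<exists>y. x - (y + y) \<in> lie_null True"
  using assms
proof (induction k arbitrary: S x)
  case 0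
  have "t \<notin> Poly_Mapping.keys x" for t
    using weight_pos[of t] 0(2) unfolding max_weight_def by (meson not_le)
  then have "Poly_Mapping.keys x = {}" by (intro equals0I) simp
  then have "x = 0" by simp
  then have "x - (0 + 0) \<in> lie_null True" by (simp add: lie_null.zero)
  then show ?case ..
next
  case (Suc k)
  note outer = Suc.IH
  from Suc.prems show ?case
  proof (induction S arbitrary: x rule: finite_induct)
    case empty
    have "t \<notin> Poly_Mapping.keys x" for t
    proof
      assume "t \<in> Poly_Mapping.keys x"
      then have "set_bracketing t \<subseteq> {}" by (rule empty.prems(2))
      then show False using set_bracketing_nonempty[of t] by simp
    qed
    then have "Poly_Mapping.keys x = {}" by (intro equals0I) simp
    then have "x = 0" by simp
    then have "x - (0 + 0) \<in> lie_null True" by (simp add: lie_null.zero)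
    then show ?case ..
  next
    case (insert a S)
    define z where "z = x - kill a x"
    have k0: "kill a x \<star> kill a x \<in> lie_null False"
      using subst_lie_null[OF insert.prems(3)] by (simp add: subst_brk)
    have "\<exists>y. kill a x - (y + y) \<in> lie_null True"
    proof (rule insert.IH)
      show "max_weight (Suc k) (kill a x)"
        using insert.prems(1) keys_kill[of a x] by (auto simp: max_weight_def)
      show "\<And>t. t \<in> Poly_Mapping.keys (kill a x) \<Longrightarrow> set_bracketing t \<subseteq> S"
        using insert.prems(2) keys_kill[of a x] by blast
    qed (rule k0)
    then obtain y0 where y0: "kill a x - (y0 + y0) \<in> lie_null True" ..
    have z0: "z \<star> z \<in> lie_null False"
      using lie_null.diff[OF insert.prems(3) k0] lie_null_cong[OF square_diff] unfolding z_def by blast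
    \<comment> \<open>The two shift terms of the semidirect product cancel in a self-bracket.\<close>
    have "elim a (z \<star> z) = elim a z \<star> elim a z" by (simp add: elim_brk)
    then have e0: "elim a z \<star> elim a z \<in> lie_null False"
      using elim_lie_null[OF z0, of a] by simp
    have mz: "max_weight (Suc k) z"
      unfolding z_def using insert.prems(1) keys_kill[of a x] 
      by (intro max_weight_diff) (auto simp: max_weight_def)
    have "\<exists>y. elim a z - (y + y) \<in> lie_null True"
    proof (rule outer)
      show "finite (\<Union>t\<in>Poly_Mapping.keys (elim a z). set_bracketing t)"
        by (simp add: finite_set_bracketing)
      show "max_weight k (elim a z)"
        by (rule max_weight_elim[OF mz]) (simp add: z_def keys_diff_kill)
    qed (use e0 in auto)
    then obtain y where y: "elim a z - (y + y) \<in> lie_null True" ..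
    \<comment> \<open>The word \<open>[a,a]\<close> has the square of the coefficient of \<open>a\<close> as its coefficient.\<close>
    obtain c where c: "gen_coeff a z = c + c"
      using lie_null_lookup_square[OF z0, of a] by (auto simp: lookup_frag_brk_Br elim!: evenE)
    let ?a = "frag_of (Gen a)"
    define v where "v = frag_cmul c ?a + unelim a y + y0"
    have "x - (v + v) = (kill a x - (y0 + y0)) + unelim a (elim a z - (y + y))
        - (frag_cmul (gen_coeff a z) ?a + unelim a (elim a z) - z)"
      unfolding c frag_cmul_distrib by (simp add: v_def z_def unelim_def del: minus_frag_cmul)
    also have "\<dots> \<in> lie_null True"
      by (rule lie_null.diff[OF lie_null_add[OF y0 unelim_lie_null[OF y]] unelim_elim])
    finally show ?case by blast
  qed
qed

text \<open>The map \<open>x \<mapsto> [x,x]\<close> from \<open>L \<otimes> \<int>/2\<close> to \<open>L'\<close> is injective.\<close>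

theorem square_null_even:
  fixes x :: "nat bracketing \<Rightarrow>\<^sub>0 int"
  assumes "x \<star> x \<in> lie_null False"
  shows "\<exists>y. x - (y + y) \<in> lie_null True"
proof (rule square_null_even_aux)
  show "finite (\<Union>t\<in>Poly_Mapping.keys x. set_bracketing t)"
    by (simp add: finite_set_bracketing)
  show "max_weight (Max (weight ` Poly_Mapping.keys x)) x"
    by (simp add: max_weight_def)
qed (use assms in auto)

section \<open>Homogeneous elements\<close>

definition homogeneous :: "nat \<Rightarrow> ('g bracketing \<Rightarrow>\<^sub>0 int) \<Rightarrow> bool" where
  "homogeneous n x \<longleftrightarrow> (\<forall>t\<in>Poly_Mapping.keys x. weight t = n)"

lemma homogeneous_simps [simp]:
  "homogeneous n 0" "homogeneous n (frag_of t) \<longleftrightarrow> weight t = n" "homogeneous n (- x) \<longleftrightarrow> homogeneous n x"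
  by (simp_all add: homogeneous_def)

lemma homogeneous_add: "\<lbrakk>homogeneous n x; homogeneous n y\<rbrakk> \<Longrightarrow> homogeneous n (x + y)"
  unfolding homogeneous_def using Poly_Mapping.keys_add[of x y] by blast

lemma homogeneous_brk: "\<lbrakk>homogeneous m x; homogeneous n y\<rbrakk> \<Longrightarrow> homogeneous (m + n) (x \<star> y)"
  unfolding homogeneous_def using keys_frag_brk[of x y] by fastforce

lemma homogeneous_extend:
  assumes "\<And>t. t \<in> Poly_Mapping.keys x \<Longrightarrow> homogeneous n (f t)"
  shows "homogeneous n (frag_extend f x)"
  using assms keys_frag_extend[of f x] unfolding homogeneous_def by blast

lemma homogeneous_component: "homogeneous n (component n x)"
  unfolding component_def by (rule homogeneous_extend) simp

lemma component_homogeneous: "homogeneous n x \<Longrightarrow> component n x = x"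
proof -
  assume h: "homogeneous n x"
  have "component n x = frag_extend frag_of x"
    unfolding component_def by (rule frag_extend_eq) (use h in \<open>simp add: homogeneous_def\<close>)
  then show ?thesis using frag_expansion[of x] by simp
qed

lemma homogeneous_subst:
  assumes "\<And>g. homogeneous 1 (f g)" and "homogeneous n x"
  shows "homogeneous n (subst f x)"
proof -
  have word: "homogeneous (weight t) (subst_word f t)" for t
    by (induction t) (use assms(1) in \<open>simp_all add: homogeneous_brk\<close>)
  show ?thesis
    unfolding subst_def by (rule homogeneous_extend) (use assms(2) word in \<open>auto simp: homogeneous_def\<close>)
qed

lemma homogeneous_lie_null_imp_square:
  assumes x: "x \<in> lie_null True" "homogeneous n x"
  shows "odd n \<Longrightarrow> x \<in> lie_null False"
    and "even n \<Longrightarrow> \<exists>y. homogeneous (n div 2) y \<and> x - y \<star> y \<in> lie_null False"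
proof -
  obtain y where y: "x - y \<star> y \<in> lie_null False"
    using lie_null_imp_square[OF x(1)] ..
  have "x - component n (y \<star> y) \<in> lie_null False"
    using component_lie_null[OF y, of n] by (simp add: component_homogeneous[OF x(2)])
  then have *: "x - halved_square n y \<in> lie_null False"
    using component_square by (rule lie_null_diff_trans)
  then show "odd n \<Longrightarrow> x \<in> lie_null False" by simp
  show "even n \<Longrightarrow> \<exists>y. homogeneous (n div 2) y \<and> x - y \<star> y \<in> lie_null False"
    using * homogeneous_component[of "n div 2" y] by auto
qed

lemma homogeneous_square_null_even:
  fixes x :: "nat bracketing \<Rightarrow>\<^sub>0 int"
  assumes "x \<star> x \<in> lie_null False" "homogeneous k x"
  shows "\<exists>y. homogeneous k y \<and> x - (y + y) \<in> lie_null True"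
proof -
  obtain y where "x - (y + y) \<in> lie_null True"
    using square_null_even[OF assms(1)] ..
  from component_lie_null[OF this, of k] show ?thesis
    using homogeneous_component[of k y] by (auto simp: component_homogeneous[OF assms(2)])
qed

section \<open>Passing between a basis and the group it generates\<close>

text \<open>One name for both ideals, to treat the two free algebras on \<open>H\<close> uniformly.\<close>

definition free_ideal :: "bool \<Rightarrow> ('a, 'm) monoid_scheme \<Rightarrow> ('a bracketing \<Rightarrow>\<^sub>0 int) set" where
  "free_ideal strict H = (if strict then lie_ideal H else quasi_lie_ideal H)"

definition bracket_relations :: "bool \<Rightarrow> ('a, 'm) bracket_group_scheme \<Rightarrow> 'a set" where
  "bracket_relations strict A = (if strict then lie_relations A else quasi_lie_relations A)"

lemma free_ideal_eq_brk_ideal: "free_ideal strict H = brk_ideal (nonassoc_ring H)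
    (additivity_relations H \<union> bracket_relations strict (nonassoc_ring H))"
  by (simp add: free_ideal_def bracket_relations_def lie_ideal_def quasi_lie_ideal_def)

lemma free_bracket_algebra_relations:
  "comm_group H \<Longrightarrow> free_bracket_algebra H (bracket_relations strict (nonassoc_ring H))"
  by (simp add: bracket_relations_def free_bracket_algebra_lie free_bracket_algebra_quasi_lie)

lemma inv_nonassoc_ring:
  assumes "x \<in> carrier (nonassoc_ring H)" shows "inv\<^bsub>nonassoc_ring H\<^esub> x = - x"
proof -
  interpret bracket_ring "nonassoc_ring H" by (rule bracket_ring_nonassoc_ring)
  show ?thesis
    by (rule inv_equality) (use assms in \<open>simp_all add: nonassoc_ring_simps\<close>)
qed

lemma carrier_brk: "\<lbrakk>x \<in> carrier (nonassoc_ring H); y \<in> carrier (nonassoc_ring H)\<rbrakk>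
    \<Longrightarrow> x \<star> y \<in> carrier (nonassoc_ring H)"
  using bracket_ring.brk_closed[OF bracket_ring_nonassoc_ring, of x H y] by (simp add: nonassoc_ring_simps)

lemma carrier_diff: "\<lbrakk>x \<in> carrier (nonassoc_ring H); y \<in> carrier (nonassoc_ring H)\<rbrakk>
    \<Longrightarrow> x - y \<in> carrier (nonassoc_ring H)"
  by (simp add: nonassoc_ring_simps keys_subset_diff)

locale based_free_abelian_group =
  fixes H :: "('a, 'm) monoid_scheme" and n :: nat and \<phi> :: "(nat \<Rightarrow>\<^sub>0 int) \<Rightarrow> 'a"
  assumes comm_group_H: "comm_group H" and \<phi>: "\<phi> \<in> iso (free_Abelian_group {..<n}) H"
begin

sublocale H: comm_group H by (rule comm_group_H)

abbreviation "N \<equiv> nonassoc_ring H"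

definition basis :: "nat \<Rightarrow> 'a" where "basis i = \<phi> (frag_of i)"

definition coords :: "'a \<Rightarrow> (nat \<Rightarrow>\<^sub>0 int)" where
  "coords = inv_into (carrier (free_Abelian_group {..<n})) \<phi>"

lemma \<phi>_hom: "\<phi> \<in> hom (free_Abelian_group {..<n}) H"
  using \<phi> by (simp add: iso_def)

lemma \<phi>_coords: "h \<in> carrier H \<Longrightarrow> \<phi> (coords h) = h"
  using \<phi> unfolding coords_def iso_def by (auto simp: bij_betw_def intro!: f_inv_into_f)

lemma coords_hom: "coords \<in> hom H (free_Abelian_group {..<n})"
  using group.iso_set_sym[OF group_free_Abelian_group \<phi>] unfolding coords_def iso_def by simp

lemma keys_coords: "h \<in> carrier H \<Longrightarrow> Poly_Mapping.keys (coords h) \<subseteq> {..<n}"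
  using hom_in_carrier[OF coords_hom] by simp

lemma coords_mult: "\<lbrakk>a \<in> carrier H; b \<in> carrier H\<rbrakk> \<Longrightarrow> coords (a \<otimes>\<^bsub>H\<^esub> b) = coords a + coords b"
  using hom_mult[OF coords_hom] by simp

lemma basis_closed: "i < n \<Longrightarrow> basis i \<in> carrier H"
  unfolding basis_def by (rule hom_in_carrier[OF \<phi>_hom]) simp

text \<open>Writing every element of \<open>H\<close> in the basis, and conversely inserting the basis elements for the
generators, relates the algebras on \<open>H\<close> to those on a set of generators. Generators beyond the
rank go to zero.\<close>

definition encode :: "('a bracketing \<Rightarrow>\<^sub>0 int) \<Rightarrow> (nat bracketing \<Rightarrow>\<^sub>0 int)" where
  "encode = subst (\<lambda>h. frag_extend (\<lambda>i. frag_of (Gen i)) (coords h))"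

definition decode :: "(nat bracketing \<Rightarrow>\<^sub>0 int) \<Rightarrow> ('a bracketing \<Rightarrow>\<^sub>0 int)" where
  "decode = subst (\<lambda>i. if i < n then frag_of (Gen (basis i)) else 0)"

lemma encode_homogeneous: "homogeneous k x \<Longrightarrow> homogeneous k (encode x)"
  unfolding encode_def by (rule homogeneous_subst) (auto intro: homogeneous_extend)

lemma decode_homogeneous: "homogeneous k x \<Longrightarrow> homogeneous k (decode x)"
  unfolding decode_def by (rule homogeneous_subst) auto

lemma decode_closed: "decode x \<in> carrier N"
proof (induction x rule: frag_induct)
  case (one t)
  show ?case
  proof (induction t)
    case (Gen i)
    then show ?case by (simp add: decode_def nonassoc_ring_simps basis_closed)
  next
    case (Br s t)
    then show ?case using carrier_brk by (simp add: decode_def)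
  qed
qed (simp_all add: decode_def carrier_diff, simp add: nonassoc_ring_simps)

context
  fixes strict :: bool
begin

interpretation F: free_bracket_algebra H "bracket_relations strict (nonassoc_ring H)"
  rewrites "brk_ideal (nonassoc_ring H) (additivity_relations H \<union> bracket_relations strict (nonassoc_ring H))
      = free_ideal strict H"
  by (rule free_bracket_algebra_relations[OF comm_group_H]) (simp add: free_ideal_eq_brk_ideal)

lemma free_ideal_closed: "x \<in> free_ideal strict H \<Longrightarrow> x \<in> carrier N"
  by (rule F.ideal_closed)

lemma free_ideal_zero: "0 \<in> free_ideal strict H"
  using brk_ideal.one[of N] by (simp add: free_ideal_eq_brk_ideal nonassoc_ring_simps)

lemma free_ideal_add: "\<lbrakk>x \<in> free_ideal strict H; y \<in> free_ideal strict H\<rbrakk> \<Longrightarrow> x + y \<in> free_ideal strict H"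
  using brk_ideal.mult[of x N _ y] by (simp add: free_ideal_eq_brk_ideal nonassoc_ring_simps)

lemma free_ideal_uminus: "x \<in> free_ideal strict H \<Longrightarrow> - x \<in> free_ideal strict H"
  using brk_ideal.inv[of x N] inv_nonassoc_ring[OF free_ideal_closed] by (simp add: free_ideal_eq_brk_ideal)

lemma free_ideal_diff: "\<lbrakk>x \<in> free_ideal strict H; y \<in> free_ideal strict H\<rbrakk> \<Longrightarrow> x - y \<in> free_ideal strict H"
  using free_ideal_add[OF _ free_ideal_uminus] by fastforce

lemma free_ideal_left: "\<lbrakk>z \<in> carrier N; x \<in> free_ideal strict H\<rbrakk> \<Longrightarrow> z \<star> x \<in> free_ideal strict H"
  using brk_ideal.left[of z N x] by (simp add: free_ideal_eq_brk_ideal nonassoc_ring_simps)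

lemma free_ideal_right: "\<lbrakk>z \<in> carrier N; x \<in> free_ideal strict H\<rbrakk> \<Longrightarrow> x \<star> z \<in> free_ideal strict H"
  using brk_ideal.right[of x N _ z] by (simp add: free_ideal_eq_brk_ideal nonassoc_ring_simps)

lemma free_ideal_incl: "x \<in> bracket_relations strict N \<Longrightarrow> x \<in> free_ideal strict H"
  by (simp add: free_ideal_eq_brk_ideal brk_ideal.incl)

lemma free_ideal_additivity: "\<lbrakk>a \<in> carrier H; b \<in> carrier H\<rbrakk>
   \<Longrightarrow> frag_of (Gen (a \<otimes>\<^bsub>H\<^esub> b)) - frag_of (Gen a) - frag_of (Gen b) \<in> free_ideal strict H"
  unfolding free_ideal_eq_brk_ideal by (rule brk_ideal.incl) (auto simp: additivity_relations_def)

lemma free_ideal_antisym: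
  assumes "x \<in> carrier N" "y \<in> carrier N"
  shows "x \<star> y + y \<star> x \<in> free_ideal strict H"
proof -
  have "x \<star> y + y \<star> x \<in> quasi_lie_relations N"
    unfolding quasi_lie_relations_def nonassoc_ring_simps(2,4) using assms by blast
  then show ?thesis
    by (intro free_ideal_incl) (simp add: bracket_relations_def lie_relations_def)
qed

lemma free_ideal_jacobi:
  assumes "x \<in> carrier N" "y \<in> carrier N" "z \<in> carrier N"
  shows "jacobiator x y z \<in> free_ideal strict H"
proof -
  have "jacobiator x y z \<in> quasi_lie_relations N"
    unfolding quasi_lie_relations_def nonassoc_ring_simps(2,4) jacobiator_def using assms by blast
  then show ?thesis
    by (intro free_ideal_incl) (simp add: bracket_relations_def lie_relations_def)
qed

lemma free_ideal_self:
  assumes "strict" "x \<in> carrier N"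
  shows "x \<star> x \<in> free_ideal strict H"
proof -
  have "x \<star> x \<in> lie_relations N"
    unfolding lie_relations_def nonassoc_ring_simps(4) using assms by blast
  then show ?thesis
    using assms by (intro free_ideal_incl) (simp add: bracket_relations_def)
qed

lemma encode_free_ideal: "x \<in> free_ideal strict H \<Longrightarrow> encode x \<in> lie_null strict"
proof -
  assume "x \<in> free_ideal strict H"
  then have "x \<in> brk_ideal N (additivity_relations H \<union> bracket_relations strict N)"
    by (simp add: free_ideal_eq_brk_ideal)
  then show ?thesis
  proof (induction rule: brk_ideal.induct)
    case (incl r)
    then consider "r \<in> additivity_relations H" | "r \<in> quasi_lie_relations N"
      | "strict" "r \<in> {brk N x x | x. x \<in> carrier N}"
      by (auto simp: bracket_relations_def lie_relations_def split: if_splits)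
    then show ?case
    proof cases
      case 1
      then show ?thesis
        by (auto simp: additivity_relations_def encode_def coords_mult frag_extend_add lie_null.zero)
    next
      case 2
      then show ?thesis
        using lie_null.antisym lie_null.jacobi
        by (auto simp: quasi_lie_relations_def encode_def subst_brk nonassoc_ring_simps jacobiator_def)
    next
      case 3
      then show ?thesis
        using lie_null.self by (auto simp: encode_def subst_brk nonassoc_ring_simps)
    qed
  next
    case one
    then show ?case by (simp add: encode_def nonassoc_ring_simps lie_null.zero)
  next
    case (mult r s)
    then show ?case by (simp add: encode_def nonassoc_ring_simps lie_null_add)
  next
    case (inv r)
    then have "r \<in> carrier N" using F.ideal_closed by (simp add: free_ideal_eq_brk_ideal)
    then show ?case using inv by (simp add: inv_nonassoc_ring encode_def lie_null_uminus)
  qed (simp_all add: encode_def nonassoc_ring_simps subst_brk lie_null.intros)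
qed

lemma decode_lie_null: "x \<in> lie_null strict \<Longrightarrow> decode x \<in> free_ideal strict H"
proof (induction rule: lie_null.induct)
  case (antisym x y)
  then show ?case using free_ideal_antisym[OF decode_closed decode_closed] by (simp add: decode_def subst_brk)
next
  case (jacobi x y z)
  then show ?case using free_ideal_jacobi[OF decode_closed decode_closed decode_closed, of x y z]
    by (simp add: decode_def subst_brk jacobiator_def)
next
  case (left x z)
  then show ?case using free_ideal_left[OF decode_closed] by (simp add: decode_def subst_brk)
next
  case (right x z)
  then show ?case using free_ideal_right[OF decode_closed] by (simp add: decode_def subst_brk)
next
  case (self x)
  then show ?case using free_ideal_self[OF _ decode_closed] by (simp add: decode_def subst_brk)
next
  case zero
  then show ?case by (simp add: decode_def free_ideal_zero)
next
  case (diff x y)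
  then show ?case by (simp add: decode_def free_ideal_diff)
qed

text \<open>The additivity relations let a generator \<open>h\<close> be expanded in the basis.\<close>

lemma free_ideal_linear:
  assumes "Poly_Mapping.keys c \<subseteq> {..<n}"
  shows "frag_extend (\<lambda>i. frag_of (Gen (basis i))) c - frag_of (Gen (\<phi> c)) \<in> free_ideal strict H"
proof (rule free_Abelian_group_induct[OF assms])
  have "\<phi> 0 = \<one>\<^bsub>H\<^esub>"
    using hom_one[OF \<phi>_hom group_free_Abelian_group H.is_group] by simp
  then show "frag_extend (\<lambda>i. frag_of (Gen (basis i))) 0 - frag_of (Gen (\<phi> 0)) \<in> free_ideal strict H"
    \<comment> \<open>Additivity for the pair of neutral elements says that their generator is zero.\<close>
    using free_ideal_additivity[OF H.one_closed H.one_closed] by simp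
next
  fix x y
  let ?B = "frag_extend (\<lambda>i. frag_of (Gen (basis i)))"
  assume xy: "Poly_Mapping.keys x \<subseteq> {..<n}" "Poly_Mapping.keys y \<subseteq> {..<n}"
    and IH: "?B x - frag_of (Gen (\<phi> x)) \<in> free_ideal strict H" "?B y - frag_of (Gen (\<phi> y)) \<in> free_ideal strict H"
  have c: "\<phi> (x - y) \<in> carrier H" "\<phi> y \<in> carrier H"
    using xy by (auto intro!: hom_in_carrier[OF \<phi>_hom] simp: keys_subset_diff)
  have m: "\<phi> x = \<phi> (x - y) \<otimes>\<^bsub>H\<^esub> \<phi> y"
    using hom_mult[OF \<phi>_hom, of "x - y" y] xy by (simp add: keys_subset_diff)
  have "?B (x - y) - frag_of (Gen (\<phi> (x - y)))
    = (?B x - frag_of (Gen (\<phi> x))) - (?B y - frag_of (Gen (\<phi> y)))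
      + (frag_of (Gen (\<phi> (x - y) \<otimes>\<^bsub>H\<^esub> \<phi> y)) - frag_of (Gen (\<phi> (x - y))) - frag_of (Gen (\<phi> y)))"
    by (simp add: m frag_extend_diff)
  then show "?B (x - y) - frag_of (Gen (\<phi> (x - y))) \<in> free_ideal strict H"
    using free_ideal_add[OF free_ideal_diff[OF IH] free_ideal_additivity[OF c]] by (simp only:)
qed (simp add: basis_def free_ideal_zero)

lemma decode_encode:
  assumes "x \<in> carrier N"
  shows "decode (encode x) - x \<in> free_ideal strict H"
proof -
  have "Poly_Mapping.keys x \<subseteq> bracketings H" using assms by (simp add: nonassoc_ring_simps)
  then show ?thesis
  proof (induction x rule: frag_induction)
    case (one t)
    then show ?case
    proof (induction t)
      case (Gen h)
      then have h: "h \<in> carrier H" by simp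
      have "decode (encode (frag_of (Gen h))) = frag_extend (\<lambda>i. frag_of (Gen (basis i))) (coords h)"
        unfolding encode_def decode_def subst_def frag_extend_of subst_word.simps
        using keys_coords[OF h]
        by (subst frag_extend_compose[unfolded o_def])
           (auto intro!: frag_extend_eq)
      then show ?case
        using free_ideal_linear[OF keys_coords[OF h]] by (simp add: \<phi>_coords[OF h])
    next
      case (Br s t)
      let ?s = "decode (encode (frag_of s))" and ?t = "decode (encode (frag_of t))"
      have c: "frag_of s \<in> carrier N" using Br by (simp add: nonassoc_ring_simps)
      have "decode (encode (frag_of (Br s t))) - frag_of (Br s t)
        = (?s - frag_of s) \<star> ?t + frag_of s \<star> (?t - frag_of t)"
        by (simp add: decode_def encode_def subst_brk frag_brk_diff)
      moreover have "(?s - frag_of s) \<star> ?t \<in> free_ideal strict H"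
        "frag_of s \<star> (?t - frag_of t) \<in> free_ideal strict H"
        using Br by (auto intro: free_ideal_left[OF c] free_ideal_right[OF decode_closed])
      ultimately show ?case
        using free_ideal_add by simp
    qed
  next
    case (diff a b)
    then show ?case using free_ideal_diff[OF diff]
      by (simp add: decode_def encode_def algebra_simps)
  qed (simp add: decode_def encode_def free_ideal_zero)
qed

end

text \<open>Modulo the quasi-Lie ideal an element of the Lie ideal is a self-bracket, and the components of
odd degree of a self-bracket vanish.\<close>

lemma homogeneous_lie_ideal_odd:
  assumes "x \<in> lie_ideal H" "homogeneous k x" "odd k"
  shows "x \<in> quasi_lie_ideal H"
proof -
  have x: "x \<in> free_ideal True H" using assms(1) by (simp add: free_ideal_def)
  then have "encode x \<in> lie_null False"
    using assms encode_free_ideal encode_homogeneous by (intro homogeneous_lie_null_imp_square(1))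
  then have "decode (encode x) \<in> free_ideal False H"
    by (rule decode_lie_null)
  from free_ideal_diff[OF this decode_encode[OF free_ideal_closed[OF x]]]
  show ?thesis by (simp add: free_ideal_def)
qed

lemma homogeneous_lie_ideal_even:
  assumes "x \<in> lie_ideal H" "homogeneous (2 * k) x"
  shows "\<exists>y\<in>carrier N. homogeneous k y \<and> x - y \<star> y \<in> quasi_lie_ideal H"
proof -
  have x: "x \<in> free_ideal True H" using assms(1) by (simp add: free_ideal_def)
  then have "\<exists>y. homogeneous (2 * k div 2) y \<and> encode x - y \<star> y \<in> lie_null False"
    using assms encode_free_ideal encode_homogeneous by (intro homogeneous_lie_null_imp_square(2)) auto
  then obtain y where y: "homogeneous k y" "encode x - y \<star> y \<in> lie_null False"
    by auto
  then have "decode (encode x) - decode y \<star> decode y \<in> free_ideal False H"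
    using decode_lie_null[OF y(2)] by (simp add: decode_def subst_brk)
  from free_ideal_diff[OF this decode_encode[OF free_ideal_closed[OF x]]]
  show ?thesis using decode_homogeneous[OF y(1)] decode_closed[of y] by (auto simp: free_ideal_def)
qed

lemma homogeneous_square_even:
  assumes "x \<in> carrier N" "x \<star> x \<in> quasi_lie_ideal H" "homogeneous k x"
  shows "\<exists>y\<in>carrier N. homogeneous k y \<and> x - (y + y) \<in> lie_ideal H"
proof -
  have "encode x \<star> encode x \<in> lie_null False"
    using encode_free_ideal[of "x \<star> x" False] assms(2) by (simp add: encode_def free_ideal_def subst_brk)
  then obtain y where y: "homogeneous k y" "encode x - (y + y) \<in> lie_null True"
    using homogeneous_square_null_even[OF _ encode_homogeneous[OF assms(3)]] by blast
  then have "decode (encode x) - (decode y + decode y) \<in> free_ideal True H"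
    using decode_lie_null[OF y(2)] by (simp add: decode_def)
  from free_ideal_diff[OF this decode_encode[OF assms(1)]]
  show ?thesis using decode_homogeneous[OF y(1)] decode_closed[of y]
    by (intro bexI[of _ "decode y"]) (simp_all add: free_ideal_def algebra_simps)
qed

end

section \<open>The kernel of the canonical epimorphism\<close>

context free_bracket_algebra
begin

abbreviation cls where "cls x \<equiv> I #>\<^bsub>nonassoc_ring H\<^esub> x"

lemma cls_hom: "cls \<in> hom (nonassoc_ring H) (free_alg H I)"
  using coset_brk_hom by (simp add: brk_hom_def free_alg_def)

lemma cls_brk: "\<lbrakk>x \<in> carrier (nonassoc_ring H); y \<in> carrier (nonassoc_ring H)\<rbrakk>
    \<Longrightarrow> brk (free_alg H I) (cls x) (cls y) = cls (x \<star> y)"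
  by (simp add: free_alg_def brk_quotient nonassoc_ring_simps(4))

lemma cls_add: "\<lbrakk>x \<in> carrier (nonassoc_ring H); y \<in> carrier (nonassoc_ring H)\<rbrakk>
    \<Longrightarrow> cls x \<otimes>\<^bsub>free_alg H I\<^esub> cls y = cls (x + y)"
  using hom_mult[OF cls_hom] by (simp add: nonassoc_ring_simps(2))

lemma one_free_alg: "\<one>\<^bsub>free_alg H I\<^esub> = I"
  by (simp add: free_alg_def one_quotient)

lemma one_degree_part: "\<one>\<^bsub>degree_part H I n\<^esub> = I"
  by (simp add: degree_part_def one_free_alg)

lemma cls_eq_iff:
  assumes "x \<in> carrier (nonassoc_ring H)" "y \<in> carrier (nonassoc_ring H)"
  shows "cls x = cls y \<longleftrightarrow> x - y \<in> I"
proof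
  assume "cls x = cls y"
  then have "x \<in> cls y" using rcos_self[OF assms(1) ideal_subgroup] by simp
  from coset_elem[OF this] show "x - y \<in> I"
    by (auto simp: nonassoc_ring_simps(2))
next
  assume "x - y \<in> I"
  then show "cls x = cls y"
    by (rule coset_eqI[OF assms]) (simp add: nonassoc_ring_simps(2))
qed

lemma cls_zero: "cls 0 = I"
  using hom_one[OF cls_hom] bracket_ring.axioms(1)[OF bracket_ring_free_alg] is_group
  by (simp add: one_free_alg nonassoc_ring_simps(3) comm_group.axioms(2))

lemma cls_eq_ideal_iff: "x \<in> carrier (nonassoc_ring H) \<Longrightarrow> cls x = I \<longleftrightarrow> x \<in> I"
  using cls_eq_iff[of x 0] by (simp add: cls_zero nonassoc_ring_simps(1))

text \<open>The degree \<open>n\<close> part is generated by classes of words; the homogeneous combinations of words are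
already closed under the group operations.\<close>

lemma carrier_degree_part:
  "carrier (degree_part H I n) = cls ` {x \<in> carrier (nonassoc_ring H). homogeneous n x}" (is "?C = ?R")
proof
  let ?W = "{word_class H I t | t. t \<in> bracketings H \<and> weight t = n}"
  interpret alg: bracket_ring "free_alg H I" by (rule bracket_ring_free_alg)
  interpret c: group_hom "nonassoc_ring H" "free_alg H I" cls
    using cls_hom by unfold_locales
  interpret d: comm_group "degree_part H I n" by (rule comm_group_degree_part)
  have C: "?C = generate (free_alg H I) ?W"
    using word_class_closed unfolding degree_part_def carrier_subgroup_generated
    by (intro arg_cong[where f = "generate (free_alg H I)"]) auto
  have W: "?W \<subseteq> carrier (free_alg H I)" using word_class_closed by auto
  show "?C \<subseteq> ?R"
  proof
    fix X assume "X \<in> ?C"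
    then have "X \<in> generate (free_alg H I) ?W" by (simp add: C)
    then show "X \<in> ?R"
    proof (induction rule: generate.induct)
      case one
      show ?case
        by (rule image_eqI[of _ _ 0]) (simp_all add: one_free_alg cls_zero nonassoc_ring_simps(1))
    next
      case (incl X)
      then obtain t where "X = cls (frag_of t)" "t \<in> bracketings H" "weight t = n"
        by (auto simp: word_class_def)
      then show ?case by (intro image_eqI[of _ _ "frag_of t"]) (simp_all add: nonassoc_ring_simps(1))
    next
      case (inv X)
      then obtain t where t: "X = cls (frag_of t)" "t \<in> bracketings H" "weight t = n"
        by (auto simp: word_class_def)
      then have c: "frag_of t \<in> carrier (nonassoc_ring H)" by (simp add: nonassoc_ring_simps(1))
      show ?case
        using t c.hom_inv[OF c] c inv_closed[OF c]
        by (intro image_eqI[of _ _ "- frag_of t"]) (simp_all add: inv_nonassoc_ring)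
    next
      case (eng X Y)
      then obtain x y where "X = cls x" "Y = cls y" "homogeneous n x" "homogeneous n y"
        "x \<in> carrier (nonassoc_ring H)" "y \<in> carrier (nonassoc_ring H)" by blast
      then show ?case
        by (intro image_eqI[of _ _ "x + y"])
           (simp_all add: cls_add homogeneous_add, simp add: nonassoc_ring_simps(1) keys_subset_add)
    qed
  qed
  show "?R \<subseteq> ?C"
  proof (rule image_subsetI, elim CollectE conjE)
    fix x assume "x \<in> carrier (nonassoc_ring H)" "homogeneous n x"
    then have k: "Poly_Mapping.keys x \<subseteq> {t \<in> bracketings H. weight t = n}"
      by (auto simp: nonassoc_ring_simps(1) homogeneous_def)
    show "cls x \<in> ?C"
    proof (rule free_Abelian_group_induct[OF k])
      show "cls 0 \<in> ?C" using d.one_closed by (simp add: cls_zero one_degree_part)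
    next
      fix a b assume ab: "Poly_Mapping.keys a \<subseteq> {t \<in> bracketings H. weight t = n}"
        "Poly_Mapping.keys b \<subseteq> {t \<in> bracketings H. weight t = n}" "cls a \<in> ?C" "cls b \<in> ?C"
      have c: "a \<in> carrier (nonassoc_ring H)" "b \<in> carrier (nonassoc_ring H)"
        using ab by (auto simp: nonassoc_ring_simps(1))
      have "cls (a - b) = cls a \<otimes>\<^bsub>free_alg H I\<^esub> inv\<^bsub>free_alg H I\<^esub> cls b"
        using c c.hom_inv[OF c(2)] cls_add[of a "- b"] inv_closed[OF c(2)] by (simp add: inv_nonassoc_ring)
      then show "cls (a - b) \<in> ?C"
        using ab(3,4) unfolding C by (auto intro: generate.eng alg.generate_m_inv_closed[OF W])
    next
      fix t assume "t \<in> {t \<in> bracketings H. weight t = n}"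
      then show "cls (frag_of t) \<in> ?C"
        unfolding C by (intro generate.incl) (auto simp: word_class_def)
    qed
  qed
qed

lemma degree_partE:
  assumes "X \<in> carrier (degree_part H I n)"
  obtains x where "x \<in> carrier (nonassoc_ring H)" "homogeneous n x" "X = cls x"
  using assms unfolding carrier_degree_part by blast

lemma degree_partI: "\<lbrakk>x \<in> carrier (nonassoc_ring H); homogeneous n x\<rbrakk> \<Longrightarrow> cls x \<in> carrier (degree_part H I n)"
  unfolding carrier_degree_part by blast

end

context based_free_abelian_group
begin

sublocale q: free_bracket_algebra H "quasi_lie_relations (nonassoc_ring H)"
  rewrites "brk_ideal (nonassoc_ring H) (additivity_relations H \<union> quasi_lie_relations (nonassoc_ring H))
      = quasi_lie_ideal H"
  by (rule free_bracket_algebra_quasi_lie[OF comm_group_H]) (simp add: quasi_lie_ideal_def)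

sublocale l: free_bracket_algebra H "lie_relations (nonassoc_ring H)"
  rewrites "brk_ideal (nonassoc_ring H) (additivity_relations H \<union> lie_relations (nonassoc_ring H))
      = lie_ideal H"
  by (rule free_bracket_algebra_lie[OF comm_group_H]) (simp add: lie_ideal_def)

abbreviation "proj \<equiv> lie_projection H"
abbreviation "qcls x \<equiv> quasi_lie_ideal H #>\<^bsub>N\<^esub> x"
abbreviation "lcls x \<equiv> lie_ideal H #>\<^bsub>N\<^esub> x"

lemma proj_cls: "x \<in> carrier N \<Longrightarrow> proj (qcls x) = lcls x"
  by (rule lie_projection_coset[OF comm_group_H])

lemma proj_hom: "proj \<in> hom (L' k H) (L k H)"
  by (rule lie_projection_hom_degree[OF comm_group_H])

lemma proj_surj: 
  assumes "Y \<in> carrier (L k H)" obtains X where "X \<in> carrier (L' k H)" "proj X = Y"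
  using assms by (metis l.degree_partE q.degree_partI proj_cls)

lemma proj_eq_one_odd:
  assumes "X \<in> carrier (L' k H)" "proj X = \<one>\<^bsub>L k H\<^esub>" "odd k"
  shows "X = \<one>\<^bsub>L' k H\<^esub>"
proof -
  obtain x where x: "x \<in> carrier N" "homogeneous k x" "X = qcls x"
    using assms(1) by (rule q.degree_partE)
  then have "x \<in> lie_ideal H"
    using assms(2) by (simp add: proj_cls l.one_degree_part l.cls_eq_ideal_iff)
  then have "x \<in> quasi_lie_ideal H"
    using x assms(3) by (intro homogeneous_lie_ideal_odd)
  then show ?thesis using x by (simp add: q.one_degree_part q.cls_eq_ideal_iff)
qed

abbreviation sq :: "('a bracketing \<Rightarrow>\<^sub>0 int) set \<Rightarrow> ('a bracketing \<Rightarrow>\<^sub>0 int) set" where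
  "sq X \<equiv> brk (free_quasi_lie H) X X"

lemma sq_cls: "x \<in> carrier N \<Longrightarrow> sq (qcls x) = qcls (x \<star> x)"
  by (rule q.cls_brk)

lemma sq_closed: "X \<in> carrier (L' k H) \<Longrightarrow> sq X \<in> carrier (L' (2 * k) H)"
  using homogeneous_brk[of k _ k]
  by (elim q.degree_partE) (auto simp: sq_cls mult_2 intro!: q.degree_partI carrier_brk)

lemma proj_eq_one_even:
  assumes "X \<in> carrier (L' (2 * k) H)" "proj X = \<one>\<^bsub>L (2 * k) H\<^esub>"
  shows "\<exists>Y\<in>carrier (L' k H). X = sq Y"
proof -
  obtain x where x: "x \<in> carrier N" "homogeneous (2 * k) x" "X = qcls x"
    using assms(1) by (rule q.degree_partE)
  then have "x \<in> lie_ideal H"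
    using assms(2) by (simp add: proj_cls l.one_degree_part l.cls_eq_ideal_iff)
  then obtain y where y: "y \<in> carrier N" "homogeneous k y" "x - y \<star> y \<in> quasi_lie_ideal H"
    using x homogeneous_lie_ideal_even by blast
  then have "X = sq (qcls y)" using x by (simp add: sq_cls q.cls_eq_iff carrier_brk)
  then show ?thesis using y q.degree_partI by blast
qed

lemma proj_sq: "X \<in> carrier (L' k H) \<Longrightarrow> proj (sq X) = \<one>\<^bsub>L (2 * k) H\<^esub>"
proof (elim q.degree_partE)
  fix x assume x: "x \<in> carrier N" "X = qcls x"
  have "x \<star> x \<in> lie_ideal H"
    using free_ideal_self[of True x] x by (simp add: free_ideal_def)
  then show "proj (sq X) = \<one>\<^bsub>L (2 * k) H\<^esub>"
    using x by (simp add: sq_cls proj_cls carrier_brk l.one_degree_part l.cls_eq_ideal_iff)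
qed

lemma sq_mult:
  assumes "X \<in> carrier (L' k H)" "Y \<in> carrier (L' k H)"
  shows "sq (X \<otimes>\<^bsub>L' k H\<^esub> Y) = sq X \<otimes>\<^bsub>L' (2 * k) H\<^esub> sq Y"
proof -
  obtain x where x: "x \<in> carrier N" "X = qcls x"
    using assms(1) by (rule q.degree_partE)
  obtain y where y: "y \<in> carrier N" "Y = qcls y"
    using assms(2) by (rule q.degree_partE)
  have "(x + y) \<star> (x + y) - (x \<star> x + y \<star> y) = x \<star> y + y \<star> x"
    by (simp add: frag_brk_distribs)
  also have "\<dots> \<in> quasi_lie_ideal H"
    using free_ideal_antisym[of x y False] x y by (simp add: free_ideal_def)
  finally have "(x + y) \<star> (x + y) - (x \<star> x + y \<star> y) \<in> quasi_lie_ideal H" .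
  moreover have "u + v \<in> carrier N" if "u \<in> carrier N" "v \<in> carrier N" for u v
    using that by (simp add: nonassoc_ring_simps(1) keys_subset_add)
  ultimately show ?thesis
    using x y by (simp add: q.mult_degree_part q.cls_add sq_cls carrier_brk q.cls_eq_iff)
qed

lemma sq_torsion: "X \<in> carrier (L' k H) \<Longrightarrow> sq X \<otimes>\<^bsub>L' (2 * k) H\<^esub> sq X = \<one>\<^bsub>L' (2 * k) H\<^esub>"
proof (elim q.degree_partE)
  fix x assume x: "x \<in> carrier N" "X = qcls x"
  have "x \<star> x + x \<star> x \<in> quasi_lie_ideal H"
    using free_ideal_antisym[of x x False] x by (simp add: free_ideal_def)
  then show "sq X \<otimes>\<^bsub>L' (2 * k) H\<^esub> sq X = \<one>\<^bsub>L' (2 * k) H\<^esub>"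
    using x q.cls_add[of "x \<star> x" "x \<star> x"] free_ideal_closed[of "x \<star> x + x \<star> x" False]
    by (simp add: sq_cls carrier_brk q.mult_degree_part q.one_degree_part q.cls_eq_ideal_iff free_ideal_def)
qed

text \<open>Centrality of self-brackets once more, with the relations restricted to words over \<open>H\<close>.\<close>

lemma quasi_lie_square_central:
  assumes "x \<in> carrier N" "z \<in> carrier N"
  shows "x \<star> x \<star> z \<in> quasi_lie_ideal H" "z \<star> (x \<star> x) \<in> quasi_lie_ideal H"
proof -
  let ?I = "free_ideal False H"
  have "x \<star> x \<star> z = jacobiator x x z - (x \<star> z + z \<star> x) \<star> x"
    by (simp add: jacobiator_def frag_brk_distribs)
  also have "\<dots> \<in> ?I"
    using assms by (intro free_ideal_diff free_ideal_right free_ideal_antisym free_ideal_jacobi)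
  finally have 1: "x \<star> x \<star> z \<in> ?I" .
  then show "x \<star> x \<star> z \<in> quasi_lie_ideal H" by (simp add: free_ideal_def)
  have "z \<star> (x \<star> x) = (z \<star> (x \<star> x) + x \<star> x \<star> z) - x \<star> x \<star> z" by simp
  also have "\<dots> \<in> ?I"
    using assms 1 by (intro free_ideal_diff free_ideal_antisym carrier_brk)
  finally show "z \<star> (x \<star> x) \<in> quasi_lie_ideal H" by (simp add: free_ideal_def)
qed

text \<open>The kernel of the projection consists of self-brackets, which are central and hence have zero
self-bracket. Thus \<open>[X,X]\<close> depends only on the image of \<open>X\<close> in the free Lie algebra.\<close>

lemma sq_eq_one:
  assumes "X \<in> carrier (L' k H)" "proj X = \<one>\<^bsub>L k H\<^esub>"
  shows "sq X = \<one>\<^bsub>L' (2 * k) H\<^esub>"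
proof (cases "even k")
  case True
  then obtain j where j: "k = 2 * j" by blast
  then obtain Y where "Y \<in> carrier (L' j H)" "X = sq Y"
    using proj_eq_one_even assms by blast
  moreover from this(1) obtain y where "y \<in> carrier N" "Y = qcls y"
    by (rule q.degree_partE)
  ultimately show ?thesis
    using quasi_lie_square_central(1)[of y "y \<star> y"]
    by (simp add: sq_cls carrier_brk q.one_degree_part q.cls_eq_ideal_iff)
next
  case False
  then have "X = quasi_lie_ideal H" using proj_eq_one_odd[OF assms] by (simp add: q.one_degree_part)
  moreover have "sq (qcls 0) = qcls (0 \<star> 0)"
    by (rule sq_cls) (simp add: nonassoc_ring_simps(1))
  ultimately show ?thesis by (simp add: q.one_degree_part q.cls_zero)
qed

lemma sq_eq_one_imp_double:
  assumes "X \<in> carrier (L' k H)" "sq X = \<one>\<^bsub>L' (2 * k) H\<^esub>"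
  shows "\<exists>W\<in>carrier (L k H). proj X = W \<otimes>\<^bsub>L k H\<^esub> W"
proof -
  obtain x where x: "x \<in> carrier N" "homogeneous k x" "X = qcls x"
    using assms(1) by (rule q.degree_partE)
  then have "x \<star> x \<in> quasi_lie_ideal H"
    using assms(2) by (simp add: sq_cls q.one_degree_part q.cls_eq_ideal_iff carrier_brk)
  then obtain y where y: "y \<in> carrier N" "homogeneous k y" "x - (y + y) \<in> lie_ideal H"
    using homogeneous_square_even x by blast
  have c: "y + y \<in> carrier N" using y(1) by (simp add: nonassoc_ring_simps(1) keys_subset_add)
  have "proj X = lcls y \<otimes>\<^bsub>L k H\<^esub> lcls y"
    using x y c by (simp add: proj_cls l.mult_degree_part l.cls_add l.cls_eq_iff)
  then show ?thesis using l.degree_partI y by blast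
qed

text \<open>The homomorphism \<open>L\<^sub>k \<rightarrow> L'\<^sub>2\<^sub>k\<close> which takes the self-bracket of an arbitrary lift.\<close>

definition lifted_square :: "nat \<Rightarrow> ('a bracketing \<Rightarrow>\<^sub>0 int) set \<Rightarrow> ('a bracketing \<Rightarrow>\<^sub>0 int) set" where
  "lifted_square k Z = sq (inv_into (carrier (L' k H)) proj Z)"

lemma proj_image: "proj ` carrier (L' k H) = carrier (L k H)"
  using proj_hom[of k] proj_surj by (auto intro: hom_in_carrier) blast

lemma lifted_square_P:
  assumes X: "X \<in> carrier (L' k H)"
  shows "lifted_square k (proj X) = sq X"
proof -
  interpret A: comm_group "L' k H" by (rule q.comm_group_degree_part)
  interpret B: comm_group "L k H" by (rule l.comm_group_degree_part)
  interpret A2: comm_group "L' (2 * k) H" by (rule q.comm_group_degree_part)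
  interpret p: group_hom "L' k H" "L k H" proj
    using proj_hom by unfold_locales
  define Y where "Y = inv_into (carrier (L' k H)) proj (proj X)"
  have Y: "Y \<in> carrier (L' k H)" "proj Y = proj X"
    unfolding Y_def using X by (simp_all add: inv_into_into f_inv_into_f)
  define Z where "Z = Y \<otimes>\<^bsub>L' k H\<^esub> inv\<^bsub>L' k H\<^esub> X"
  have Z: "Z \<in> carrier (L' k H)" "proj Z = \<one>\<^bsub>L k H\<^esub>" "Y = Z \<otimes>\<^bsub>L' k H\<^esub> X"
    using X Y by (simp_all add: Z_def A.m_assoc)
  have "sq Y = sq X"
    unfolding Z(3) using Z X by (simp add: sq_mult sq_eq_one sq_closed)
  then show ?thesis by (simp add: lifted_square_def Y_def)
qed

lemma lifted_square_hom: "lifted_square k \<in> hom (L k H) (L' (2 * k) H)"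
proof (rule homI)
  fix U assume "U \<in> carrier (L k H)"
  then obtain X where X: "X \<in> carrier (L' k H)" "U = proj X" using proj_surj by metis
  then show "lifted_square k U \<in> carrier (L' (2 * k) H)" by (simp add: lifted_square_P sq_closed)
  fix V assume "V \<in> carrier (L k H)"
  then obtain Y where Y: "Y \<in> carrier (L' k H)" "V = proj Y" using proj_surj by metis
  interpret A: comm_group "L' k H" by (rule q.comm_group_degree_part)
  have "U \<otimes>\<^bsub>L k H\<^esub> V = proj (X \<otimes>\<^bsub>L' k H\<^esub> Y)"
    using X Y hom_mult[OF proj_hom] by simp
  then show "lifted_square k (U \<otimes>\<^bsub>L k H\<^esub> V) = lifted_square k U \<otimes>\<^bsub>L' (2 * k) H\<^esub> lifted_square k V"
    using X Y by (simp add: lifted_square_P sq_mult)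
qed

lemma lifted_square_torsion: "U \<in> carrier (L k H) \<Longrightarrow> lifted_square k U \<otimes>\<^bsub>L' (2 * k) H\<^esub> lifted_square k U = \<one>\<^bsub>L' (2 * k) H\<^esub>"
  by (elim proj_surj) (auto simp: lifted_square_P sq_torsion)

lemma lifted_square_eq_one:
  "\<lbrakk>U \<in> carrier (L k H); lifted_square k U = \<one>\<^bsub>L' (2 * k) H\<^esub>\<rbrakk> \<Longrightarrow> \<exists>W\<in>carrier (L k H). U = W \<otimes>\<^bsub>L k H\<^esub> W"
  by (elim proj_surj) (auto simp: lifted_square_P intro: sq_eq_one_imp_double)

lemma lifted_square_image: "lifted_square k ` carrier (L k H) = kernel (L' (2 * k) H) (L (2 * k) H) proj"
proof
  show "lifted_square k ` carrier (L k H) \<subseteq> kernel (L' (2 * k) H) (L (2 * k) H) proj"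
    by (auto simp: kernel_def elim!: proj_surj simp: lifted_square_P sq_closed proj_sq)
  show "kernel (L' (2 * k) H) (L (2 * k) H) proj \<subseteq> lifted_square k ` carrier (L k H)"
  proof
    fix X assume "X \<in> kernel (L' (2 * k) H) (L (2 * k) H) proj"
    then obtain Y where Y: "Y \<in> carrier (L' k H)" "X = sq Y"
      using proj_eq_one_even[of X k] by (auto simp: kernel_def)
    then show "X \<in> lifted_square k ` carrier (L k H)"
      using hom_in_carrier[OF proj_hom Y(1)] by (auto simp: lifted_square_P intro!: image_eqI[of _ _ "proj Y"])
  qed
qed

text \<open>Brackets \<open>[h,x]\<close> with \<open>h \<in> H\<close> span everything of degree at least two, because
\<open>[[a,b],x] = [a,[b,x]] - [b,[a,x]]\<close> shortens the left factor.\<close>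

lemma bracket_map_quasi_lie_surj:
  "bracket_map H (quasi_lie_ideal H) m ` carrier (tensor H (L' (m + 1) H)) = carrier (L' (m + 2) H)"
  (is "?\<beta> ` ?T = _")
proof
  \<comment> \<open>Degrees have to stay in the forms \<open>m + 1\<close> and \<open>m + 2\<close> that occur in the bracket map.\<close>
  note [simp del] = One_nat_def add_2_eq_Suc add_2_eq_Suc'
  show "?\<beta> ` ?T \<subseteq> carrier (L' (m + 2) H)"
    by (rule image_subsetI) (rule hom_in_carrier[OF q.bracket_map_hom])
  interpret T: tensor_product H "L' (m + 1) H"
    by (rule tensor_product.intro[OF comm_group_H q.comm_group_degree_part])
  interpret A: comm_group "L' (m + 2) H" by (rule q.comm_group_degree_part)
  interpret b: group_hom "tensor H (L' (m + 1) H)" "L' (m + 2) H" ?\<beta>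
    using q.bracket_map_hom by unfold_locales
  have im_diff: "qcls (x - y) \<in> ?\<beta> ` ?T"
    if "qcls x \<in> ?\<beta> ` ?T" "qcls y \<in> ?\<beta> ` ?T" and c: "x \<in> carrier N" "y \<in> carrier N" for x y
  proof -
    from that(1) obtain X where X: "qcls x = ?\<beta> X" "X \<in> ?T" by (rule imageE)
    from that(2) obtain Y where Y: "qcls y = ?\<beta> Y" "Y \<in> ?T" by (rule imageE)
    define Z where "Z = X \<otimes>\<^bsub>tensor H (L' (m + 1) H)\<^esub> inv\<^bsub>tensor H (L' (m + 1) H)\<^esub> Y"
    have Z: "Z \<in> ?T" "Z \<otimes>\<^bsub>tensor H (L' (m + 1) H)\<^esub> Y = X"
      using X(2) Y(2) by (simp_all add: Z_def T.T.m_assoc)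
    obtain z where z: "z \<in> carrier N" "?\<beta> Z = qcls z"
      using b.hom_closed[OF Z(1)] by (elim q.degree_partE)
    have "qcls x = ?\<beta> Z \<otimes>\<^bsub>L' (m + 2) H\<^esub> ?\<beta> Y"
      unfolding b.hom_mult[OF Z(1) Y(2), symmetric] Z(2) by (rule X(1))
    also have "\<dots> = qcls (z + y)"
      unfolding z(2) Y(1)[symmetric] q.mult_degree_part by (rule q.cls_add[OF z(1) c(2)])
    finally have "qcls (z + y) = qcls x" ..
    moreover have "z + y \<in> carrier N" using z c by (simp add: nonassoc_ring_simps(1) keys_subset_add)
    ultimately have "(z + y) - x \<in> quasi_lie_ideal H" using c q.cls_eq_iff by blast
    then have "qcls z = qcls (x - y)"
      using z c by (simp add: q.cls_eq_iff carrier_diff algebra_simps)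
    then show ?thesis using Z(1) z(2) by (intro image_eqI[of _ _ Z]) simp_all
  qed
  have brk_word: "qcls (frag_of s \<star> x) \<in> ?\<beta> ` ?T"
    if "s \<in> bracketings H" "x \<in> carrier N" "homogeneous j x" "weight s + j = m + 2" for s x j
    using that
  proof (induction s arbitrary: x j)
    case (Gen h)
    have "j = m + 1" using Gen.prems(4) by simp
    then have x: "qcls x \<in> carrier (L' (m + 1) H)"
      using Gen.prems(2,3) by (intro q.degree_partI) simp_all
    have h: "h \<in> carrier H" using Gen by simp
    have "frag_of (Gen h) \<in> carrier N" using h by (simp add: nonassoc_ring_simps(1))
    then have "?\<beta> (tensor_of H (L' (m + 1) H) h (qcls x)) = qcls (frag_of (Gen h) \<star> x)"
      unfolding q.bracket_map_tensor_of[OF h x] word_class_def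
      using Gen by (simp add: q.cls_brk)
    then show ?case using T.tensor_of_closed[OF h x] by (intro image_eqI) (rule sym)
  next
    case (Br a b)
    let ?a = "frag_of a" and ?b = "frag_of b"
    have c: "?a \<in> carrier N" "?b \<in> carrier N" using Br.prems by (simp_all add: nonassoc_ring_simps(1))
    have "qcls (?a \<star> (?b \<star> x)) \<in> ?\<beta> ` ?T"
      by (rule Br.IH(1)[of _ "weight b + j"]) (use Br.prems c in \<open>auto intro!: carrier_brk homogeneous_brk\<close>)
    moreover have "qcls (?b \<star> (?a \<star> x)) \<in> ?\<beta> ` ?T"
      by (rule Br.IH(2)[of _ "weight a + j"]) (use Br.prems c in \<open>auto intro!: carrier_brk homogeneous_brk\<close>)
    ultimately have "qcls (?a \<star> (?b \<star> x) - ?b \<star> (?a \<star> x)) \<in> ?\<beta> ` ?T"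
      using c Br.prems by (intro im_diff carrier_brk)
    moreover have "qcls (?a \<star> (?b \<star> x) - ?b \<star> (?a \<star> x)) = qcls (frag_of (Br a b) \<star> x)"
    proof -
      let ?I = "free_ideal False H"
      have "(?a \<star> (?b \<star> x) - ?b \<star> (?a \<star> x)) - ?a \<star> ?b \<star> x = (?b \<star> x \<star> ?a + ?a \<star> (?b \<star> x))
          + (x \<star> ?a \<star> ?b + ?b \<star> (x \<star> ?a)) - jacobiator ?a ?b x - ?b \<star> (x \<star> ?a + ?a \<star> x)"
        by (simp add: jacobiator_def frag_brk_distribs del: frag_brk_frag_of)
      also have "\<dots> \<in> ?I"
        using c Br.prems
        by (intro free_ideal_diff free_ideal_add free_ideal_antisym free_ideal_jacobi free_ideal_left carrier_brk)
      finally show ?thesis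
        using c Br.prems by (subst q.cls_eq_iff) (auto simp: free_ideal_def intro!: carrier_diff carrier_brk simp flip: frag_brk_frag_of)
    qed
    ultimately show ?case by simp
  qed
  show "carrier (L' (m + 2) H) \<subseteq> ?\<beta> ` ?T"
  proof
    fix X assume "X \<in> carrier (L' (m + 2) H)"
    then obtain x where x: "x \<in> carrier N" "homogeneous (m + 2) x" "X = qcls x"
      by (rule q.degree_partE)
    then have k: "Poly_Mapping.keys x \<subseteq> {t \<in> bracketings H. weight t = m + 2}"
      by (auto simp: nonassoc_ring_simps(1) homogeneous_def)
    have "qcls x \<in> ?\<beta> ` ?T"
    proof (rule free_Abelian_group_induct[OF k])
      show "qcls 0 \<in> ?\<beta> ` ?T"
        by (rule image_eqI[OF _ T.T.one_closed]) (simp add: q.cls_zero q.one_degree_part)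
    next
      fix t assume t: "t \<in> {t \<in> bracketings H. weight t = m + 2}"
      then obtain s u where "t = Br s u" by (cases t) auto
      then show "qcls (frag_of t) \<in> ?\<beta> ` ?T"
        using brk_word[of s "frag_of u" "weight u"] t by (simp add: nonassoc_ring_simps(1))
    next
      fix x y assume "Poly_Mapping.keys x \<subseteq> {t \<in> bracketings H. weight t = m + 2}"
        "Poly_Mapping.keys y \<subseteq> {t \<in> bracketings H. weight t = m + 2}"
        "qcls x \<in> ?\<beta> ` ?T" "qcls y \<in> ?\<beta> ` ?T"
      then show "qcls (x - y) \<in> ?\<beta> ` ?T"
        by (intro im_diff) (auto simp: nonassoc_ring_simps(1))
    qed
    then show "X \<in> ?\<beta> ` ?T" by (simp add: x)
  qed
qed

end

section \<open>Tensor products\<close>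

lemma hom_finprod:
  assumes "comm_group G" "comm_group K" "h \<in> hom G K" "finite I" "f \<in> I \<rightarrow> carrier G"
  shows "h (finprod G f I) = finprod K (\<lambda>i. h (f i)) I"
proof -
  interpret G: comm_group G by fact
  interpret K: comm_group K by fact
  interpret h: group_hom G K h using assms(3) by unfold_locales
  show ?thesis
    using assms(4,5) by (induction I rule: finite_induct) (auto simp: Pi_iff)
qed

lemma (in tensor_product) tensor_induct:
  assumes X: "X \<in> carrier (tensor G H)"
    and one: "Q \<one>\<^bsub>tensor G H\<^esub>"
    and gen: "\<And>a b. \<lbrakk>a \<in> carrier G; b \<in> carrier H\<rbrakk> \<Longrightarrow> Q (tensor_of G H a b)"
    and diff: "\<And>X Y. \<lbrakk>X \<in> carrier (tensor G H); Y \<in> carrier (tensor G H); Q X; Q Y\<rbrakk>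
        \<Longrightarrow> Q (X \<otimes>\<^bsub>tensor G H\<^esub> inv\<^bsub>tensor G H\<^esub> Y)"
  shows "Q X"
proof -
  let ?q = "\<lambda>x. N #>\<^bsub>F\<^esub> x"
  obtain x where x: "x \<in> carrier F" "X = ?q x"
    using X by (auto simp: tensor_def carrier_FactGroup)
  have q: "?q \<in> hom F (tensor G H)"
    unfolding tensor_def by (rule N.r_coset_hom_Mod)
  have k: "Poly_Mapping.keys x \<subseteq> carrier G \<times> carrier H" using x by simp
  have "Q (?q x)"
  proof (rule free_Abelian_group_induct[OF k])
    show "Q (?q 0)"
      using hom_one[OF q F.is_group T.is_group] one by simp
  next
    fix p assume "p \<in> carrier G \<times> carrier H"
    then show "Q (?q (frag_of p))"
      using gen[of "fst p" "snd p"] by (auto simp: tensor_of_def)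
  next
    fix a b assume ab: "Poly_Mapping.keys a \<subseteq> carrier G \<times> carrier H"
      "Poly_Mapping.keys b \<subseteq> carrier G \<times> carrier H" "Q (?q a)" "Q (?q b)"
    have "?q a \<in> carrier (tensor G H)" "?q b \<in> carrier (tensor G H)"
      using hom_in_carrier[OF q] ab by auto
    from diff[OF this ab(3,4)] show "Q (?q (a - b))"
      using hom_free_Abelian_group_diff[OF T.is_group q ab(1,2)] by simp
  qed
  then show ?thesis using x by simp
qed

lemma (in tensor_product) tensor_of_one_right: "a \<in> carrier G \<Longrightarrow> tensor_of G H a \<one>\<^bsub>H\<^esub> = \<one>\<^bsub>tensor G H\<^esub>"
  using tensor_of_mult_right[of a "\<one>\<^bsub>H\<^esub>" "\<one>\<^bsub>H\<^esub>"] tensor_of_closed[of a "\<one>\<^bsub>H\<^esub>"] by simp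

lemma (in tensor_product) tensor_of_hom_left: "b \<in> carrier H \<Longrightarrow> (\<lambda>a. tensor_of G H a b) \<in> hom G (tensor G H)"
  by (rule homI) (simp_all add: tensor_of_closed tensor_of_mult_left)

text \<open>The group \<open>C \<otimes> \<int>/2\<close> is \<open>C\<close> modulo doubles: every element is of the form \<open>c \<otimes> 1\<close>.\<close>

locale mod_two_tensor = comm_group C for C :: "('c, 'm) monoid_scheme" (structure)
begin

abbreviation "Z2 \<equiv> integer_mod_group 2"

sublocale T: tensor_product C Z2
  by (rule tensor_product.intro) (simp_all add: comm_group_axioms)

lemma one_Z2: "1 \<in> carrier Z2" by simp

lemma tensor_of_double: "c \<in> carrier C \<Longrightarrow> tensor_of C Z2 (c \<otimes> c) 1 = \<one>\<^bsub>tensor C Z2\<^esub>"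
  using T.tensor_of_mult_left[of c c 1] T.tensor_of_mult_right[of c 1 1] T.tensor_of_one_right[of c]
  by simp

lemma tensor_mod_twoE:
  assumes "X \<in> carrier (tensor C Z2)"
  obtains c where "c \<in> carrier C" "X = tensor_of C Z2 c 1"
proof -
  have "\<exists>c\<in>carrier C. X = tensor_of C Z2 c 1"
    using assms
  proof (rule T.tensor_induct)
    interpret h: group_hom C "tensor C Z2" "\<lambda>c. tensor_of C Z2 c 1"
      using T.tensor_of_hom_left[OF one_Z2] by unfold_locales
    show "\<exists>c\<in>carrier C. \<one>\<^bsub>tensor C Z2\<^esub> = tensor_of C Z2 c 1"
      using h.hom_one one_closed by (intro bexI[of _ \<one>]) simp_all
    show "\<exists>c\<in>carrier C. tensor_of C Z2 a j = tensor_of C Z2 c 1" if "a \<in> carrier C" "j \<in> carrier Z2" for a j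
    proof -
      have "j = 0 \<or> j = 1" using that(2) by (auto simp: carrier_integer_mod_group)
      then show ?thesis
        using that(1) h.hom_one T.tensor_of_one_right[OF that(1)] by (metis one_closed one_integer_mod_group)
    qed
    fix X Y assume "\<exists>c\<in>carrier C. X = tensor_of C Z2 c 1" "\<exists>c\<in>carrier C. Y = tensor_of C Z2 c 1"
    then obtain c d where cd: "c \<in> carrier C" "X = tensor_of C Z2 c 1" "d \<in> carrier C" "Y = tensor_of C Z2 d 1"
      by (elim bexE)
    have "X \<otimes>\<^bsub>tensor C Z2\<^esub> inv\<^bsub>tensor C Z2\<^esub> Y = tensor_of C Z2 (c \<otimes> inv d) 1"
      unfolding cd(2,4) h.hom_mult[OF cd(1) inv_closed[OF cd(3)]] h.hom_inv[OF cd(3)] ..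
    then show "\<exists>c\<in>carrier C. X \<otimes>\<^bsub>tensor C Z2\<^esub> inv\<^bsub>tensor C Z2\<^esub> Y = tensor_of C Z2 c 1"
      using cd by (intro bexI[of _ "c \<otimes> inv d"]) simp_all
  qed
  then show thesis using that by blast
qed

text \<open>The hypotheses say that \<open>u\<close> induces an injective homomorphism on \<open>C/2C\<close>.\<close>

lemma mod_two_lift:
  assumes K: "comm_group K" and u: "u \<in> hom C K"
    and torsion: "\<And>c. c \<in> carrier C \<Longrightarrow> u c \<otimes>\<^bsub>K\<^esub> u c = \<one>\<^bsub>K\<^esub>"
    and ker: "\<And>c. \<lbrakk>c \<in> carrier C; u c = \<one>\<^bsub>K\<^esub>\<rbrakk> \<Longrightarrow> \<exists>d\<in>carrier C. c = d \<otimes> d"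
  obtains g where "g \<in> mon (tensor C Z2) K" "g ` carrier (tensor C Z2) = u ` carrier C"
proof -
  interpret K: comm_group K by (rule K)
  interpret u: group_hom C K u using u by unfold_locales
  let ?f = "\<lambda>c (j::int). u c [^]\<^bsub>K\<^esub> j"
  define g where "g = tensor_lift C Z2 K ?f"
  have right: "?f a ((i + j) mod 2) = ?f a i \<otimes>\<^bsub>K\<^esub> ?f a j" 
    if "a \<in> carrier C" "i \<in> carrier Z2" "j \<in> carrier Z2" for a i j
  proof -
    have "i = 0 \<or> i = 1" "j = 0 \<or> j = 1" using that by (auto simp: carrier_integer_mod_group)
    then show ?thesis using that(1) torsion[OF that(1)] by auto
  qed
  have gh: "g \<in> hom (tensor C Z2) K"
    unfolding g_def by (rule T.tensor_lift_hom[OF K]) (simp_all add: K.int_pow_distrib right)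
  have g1: "g (tensor_of C Z2 c 1) = u c" if "c \<in> carrier C" for c
    unfolding g_def using that
    by (subst T.tensor_lift_tensor_of[OF K]) (simp_all add: K.int_pow_distrib right)
  interpret g: group_hom "tensor C Z2" K g using gh by unfold_locales
  have "g \<in> mon (tensor C Z2) K"
  proof -
    have "X = \<one>\<^bsub>tensor C Z2\<^esub>" if X: "X \<in> carrier (tensor C Z2)" "g X = \<one>\<^bsub>K\<^esub>" for X
    proof -
      obtain c where c: "c \<in> carrier C" "X = tensor_of C Z2 c 1"
        using X(1) by (rule tensor_mod_twoE)
      then obtain d where "d \<in> carrier C" "c = d \<otimes> d" using ker[of c] X(2) g1 by auto
      then show ?thesis using c tensor_of_double by simp
    qed
    then show ?thesis
      using gh g.inj_on_one_iff by (simp add: mon_def)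
  qed
  moreover have "g ` carrier (tensor C Z2) = u ` carrier C"
  proof
    show "g ` carrier (tensor C Z2) \<subseteq> u ` carrier C"
      by (auto elim!: tensor_mod_twoE simp: g1)
    show "u ` carrier C \<subseteq> g ` carrier (tensor C Z2)"
      using g1 T.tensor_of_closed[OF _ one_Z2] by (metis image_eqI image_subsetI)
  qed
  ultimately show thesis by (rule that)
qed

end

context based_free_abelian_group
begin

text \<open>The basis identifies \<open>H \<otimes> A\<close> with \<open>A\<^sup>n\<close>, naturally in \<open>A\<close>. The two
maps of this identification are \<open>coord\<close> and \<open>combine\<close>.\<close>

definition coord :: "('c, 'k) monoid_scheme \<Rightarrow> nat \<Rightarrow> ('a \<times> 'c \<Rightarrow>\<^sub>0 int) set \<Rightarrow> 'c" where
  "coord A i = tensor_lift H A A (\<lambda>h a. a [^]\<^bsub>A\<^esub> Poly_Mapping.lookup (coords h) i)"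

definition combine :: "('c, 'k) monoid_scheme \<Rightarrow> (nat \<Rightarrow> 'c) \<Rightarrow> ('a \<times> 'c \<Rightarrow>\<^sub>0 int) set" where
  "combine A a = finprod (tensor H A) (\<lambda>i. tensor_of H A (basis i) (a i)) {..<n}"

context
  fixes A :: "('c, 'k) monoid_scheme"
  assumes A: "comm_group A"
begin

interpretation A: comm_group A by (rule A)
interpretation T: tensor_product H A by (rule tensor_product.intro[OF comm_group_H A])

lemma coord_hom: "coord A i \<in> hom (tensor H A) A"
  unfolding coord_def
  by (rule T.tensor_lift_hom[OF A])
     (simp_all add: coords_mult lookup_add A.int_pow_mult A.int_pow_distrib)

lemma coord_tensor_of: "\<lbrakk>h \<in> carrier H; a \<in> carrier A\<rbrakk>
    \<Longrightarrow> coord A i (tensor_of H A h a) = a [^]\<^bsub>A\<^esub> Poly_Mapping.lookup (coords h) i"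
  unfolding coord_def
  by (rule T.tensor_lift_tensor_of[OF A])
     (simp_all add: coords_mult lookup_add A.int_pow_mult A.int_pow_distrib)

lemma combine_closed: "(\<And>i. i < n \<Longrightarrow> a i \<in> carrier A) \<Longrightarrow> combine A a \<in> carrier (tensor H A)"
  unfolding combine_def by (rule T.T.finprod_closed) (auto intro: T.tensor_of_closed basis_closed)

lemma combine_mult:
  assumes "\<And>i. i < n \<Longrightarrow> a i \<in> carrier A" "\<And>i. i < n \<Longrightarrow> b i \<in> carrier A"
  shows "combine A (\<lambda>i. a i \<otimes>\<^bsub>A\<^esub> b i) = combine A a \<otimes>\<^bsub>tensor H A\<^esub> combine A b"
proof -
  have "combine A (\<lambda>i. a i \<otimes>\<^bsub>A\<^esub> b i) = finprod (tensor H A)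
      (\<lambda>i. tensor_of H A (basis i) (a i) \<otimes>\<^bsub>tensor H A\<^esub> tensor_of H A (basis i) (b i)) {..<n}"
    unfolding combine_def using assms
    by (intro T.T.finprod_cong') (auto simp: T.tensor_of_mult_right basis_closed intro!: T.tensor_of_closed)
  also have "\<dots> = combine A a \<otimes>\<^bsub>tensor H A\<^esub> combine A b"
    unfolding combine_def using assms
    by (intro T.T.finprod_multf) (auto intro: T.tensor_of_closed basis_closed)
  finally show ?thesis .
qed

lemma combine_cong:
  assumes "\<And>i. i < n \<Longrightarrow> a i = b i" "\<And>i. i < n \<Longrightarrow> b i \<in> carrier A"
  shows "combine A a = combine A b"
  unfolding combine_def using assms
  by (intro T.T.finprod_cong') (auto intro: T.tensor_of_closed basis_closed)

text \<open>Both sides are homomorphisms in the coordinate vector \<open>c\<close>, so unit vectors suffice.\<close>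

lemma combine_powers:
  assumes a: "a \<in> carrier A" and c: "Poly_Mapping.keys c \<subseteq> {..<n}"
  shows "combine A (\<lambda>i. a [^]\<^bsub>A\<^esub> Poly_Mapping.lookup c i) = tensor_of H A (\<phi> c) a"
proof (rule hom_free_Abelian_group_eqI[OF T.T.is_group _ _ _ c])
  show "(\<lambda>c. combine A (\<lambda>i. a [^]\<^bsub>A\<^esub> Poly_Mapping.lookup c i)) \<in> hom (free_Abelian_group {..<n}) (tensor H A)"
    using a by (intro homI) (simp_all add: combine_closed lookup_add A.int_pow_mult combine_mult)
  show "(\<lambda>c. tensor_of H A (\<phi> c) a) \<in> hom (free_Abelian_group {..<n}) (tensor H A)"
    using Group.hom_compose[OF \<phi>_hom T.tensor_of_hom_left[OF a]] by (simp add: o_def)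
  fix j assume "j \<in> {..<n}"
  then have j: "j < n" by simp
  have "combine A (\<lambda>i. a [^]\<^bsub>A\<^esub> Poly_Mapping.lookup (frag_of j) i) = finprod (tensor H A)
      (\<lambda>i. if j = i then tensor_of H A (basis i) a else \<one>\<^bsub>tensor H A\<^esub>) {..<n}"
    unfolding combine_def using a
    by (intro T.T.finprod_cong') (auto simp: T.tensor_of_one_right basis_closed intro!: T.tensor_of_closed)
  also have "\<dots> = tensor_of H A (basis j) a"
    using j a by (intro T.T.finprod_singleton) (auto intro: T.tensor_of_closed basis_closed)
  finally show "combine A (\<lambda>i. a [^]\<^bsub>A\<^esub> Poly_Mapping.lookup (frag_of j) i) = tensor_of H A (\<phi> (frag_of j)) a"
    by (simp add: basis_def)
qed

lemma coord_closed: "X \<in> carrier (tensor H A) \<Longrightarrow> coord A i X \<in> carrier A"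
  by (rule hom_in_carrier[OF coord_hom])

lemma combine_coord:
  assumes "X \<in> carrier (tensor H A)"
  shows "combine A (\<lambda>i. coord A i X) = X"
proof -
  have "(\<lambda>X. combine A (\<lambda>i. coord A i X)) X = id X"
  proof (rule T.tensor_hom_eqI[OF T.T.is_group _ _ _ assms])
    show "(\<lambda>X. combine A (\<lambda>i. coord A i X)) \<in> hom (tensor H A) (tensor H A)"
    proof (rule homI)
      fix X Y assume XY: "X \<in> carrier (tensor H A)" "Y \<in> carrier (tensor H A)"
      then show "combine A (\<lambda>i. coord A i (X \<otimes>\<^bsub>tensor H A\<^esub> Y))
        = combine A (\<lambda>i. coord A i X) \<otimes>\<^bsub>tensor H A\<^esub> combine A (\<lambda>i. coord A i Y)"
        by (simp add: hom_mult[OF coord_hom] combine_mult coord_closed)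
    qed (simp add: combine_closed coord_closed)
    show "id \<in> hom (tensor H A) (tensor H A)" by (rule homI) simp_all
    fix h a assume ha: "h \<in> carrier H" "a \<in> carrier A"
    then show "combine A (\<lambda>i. coord A i (tensor_of H A h a)) = id (tensor_of H A h a)"
      using combine_powers[OF ha(2) keys_coords[OF ha(1)]] by (simp add: coord_tensor_of \<phi>_coords)
  qed
  then show ?thesis by simp
qed

lemma coord_eqI:
  assumes "X \<in> carrier (tensor H A)" "Y \<in> carrier (tensor H A)"
    and "\<And>i. i < n \<Longrightarrow> coord A i X = coord A i Y"
  shows "X = Y"
  using combine_cong[of "\<lambda>i. coord A i X" "\<lambda>i. coord A i Y"] assms combine_coord coord_closed by simp

end

abbreviation id_tensor where "id_tensor A B p \<equiv> tensor_map H A H B (\<lambda>h. h) p"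

context
  fixes A :: "('c, 'k) monoid_scheme" and B :: "('d, 'l) monoid_scheme" and p
  assumes A: "comm_group A" and B: "comm_group B" and p: "p \<in> hom A B"
begin

interpretation A: comm_group A by (rule A)
interpretation B: comm_group B by (rule B)
interpretation p: group_hom A B p using p by unfold_locales
interpretation TA: tensor_product H A by (rule tensor_product.intro[OF comm_group_H A])
interpretation TB: tensor_product H B by (rule tensor_product.intro[OF comm_group_H B])

lemma id_tensor_hom: "id_tensor A B p \<in> hom (tensor H A) (tensor H B)"
  unfolding tensor_map_def
  by (rule TA.tensor_lift_hom[OF TB.T.comm_group_axioms])
     (simp_all add: TB.tensor_of_closed TB.tensor_of_mult_left TB.tensor_of_mult_right)

lemma id_tensor_tensor_of: "\<lbrakk>h \<in> carrier H; a \<in> carrier A\<rbrakk>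
    \<Longrightarrow> id_tensor A B p (tensor_of H A h a) = tensor_of H B h (p a)"
  unfolding tensor_map_def
  by (rule TA.tensor_lift_tensor_of[OF TB.T.comm_group_axioms])
     (simp_all add: TB.tensor_of_closed TB.tensor_of_mult_left TB.tensor_of_mult_right)

lemma coord_id_tensor:
  assumes "X \<in> carrier (tensor H A)"
  shows "coord B i (id_tensor A B p X) = p (coord A i X)"
proof -
  have "(coord B i \<circ> id_tensor A B p) X = (p \<circ> coord A i) X"
    by (rule TA.tensor_hom_eqI[OF B.is_group Group.hom_compose[OF id_tensor_hom coord_hom[OF B]]
          Group.hom_compose[OF coord_hom[OF A] p] _ assms])
       (simp add: id_tensor_tensor_of coord_tensor_of[OF A] coord_tensor_of[OF B] p.hom_int_pow)
  then show ?thesis by simp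
qed

lemma id_tensor_combine:
  assumes "\<And>i. i < n \<Longrightarrow> a i \<in> carrier A"
  shows "id_tensor A B p (combine A a) = combine B (\<lambda>i. p (a i))"
proof -
  have "id_tensor A B p (combine A a) = finprod (tensor H B) (\<lambda>i. id_tensor A B p (tensor_of H A (basis i) (a i))) {..<n}"
    unfolding combine_def using assms
    by (intro hom_finprod[OF TA.T.comm_group_axioms TB.T.comm_group_axioms id_tensor_hom])
       (auto intro: TA.tensor_of_closed basis_closed)
  also have "\<dots> = combine B (\<lambda>i. p (a i))"
    unfolding combine_def using assms
    by (intro TB.T.finprod_cong') (auto simp: id_tensor_tensor_of basis_closed intro!: TB.tensor_of_closed)
  finally show ?thesis .
qed

lemma id_tensor_surj:
  assumes surj: "p ` carrier A = carrier B"
  shows "id_tensor A B p ` carrier (tensor H A) = carrier (tensor H B)"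
proof
  show "id_tensor A B p ` carrier (tensor H A) \<subseteq> carrier (tensor H B)"
    using hom_in_carrier[OF id_tensor_hom] by (rule image_subsetI)
  show "carrier (tensor H B) \<subseteq> id_tensor A B p ` carrier (tensor H A)"
  proof
    fix Y assume Y: "Y \<in> carrier (tensor H B)"
    have "\<forall>i. \<exists>a\<in>carrier A. p a = coord B i Y"
      using coord_closed[OF B Y] surj by (metis imageE)
    then obtain a where a: "\<And>i. a i \<in> carrier A" "\<And>i. p (a i) = coord B i Y" by metis
    have "id_tensor A B p (combine A a) = Y"
      using a by (simp add: id_tensor_combine combine_coord[OF B Y])
    then show "Y \<in> id_tensor A B p ` carrier (tensor H A)"
      using combine_closed[OF A, of a] a(1) by (intro image_eqI[of _ _ "combine A a"]) simp_all
  qed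
qed

lemma id_tensor_eq_one:
  assumes "X \<in> carrier (tensor H A)" "id_tensor A B p X = \<one>\<^bsub>tensor H B\<^esub>"
  shows "p (coord A i X) = \<one>\<^bsub>B\<^esub>"
  using coord_id_tensor[OF assms(1), of i] assms(2) hom_one[OF coord_hom[OF B] TB.T.is_group B.is_group] by simp

lemma id_tensor_inj:
  assumes "inj_on p (carrier A)"
  shows "inj_on (id_tensor A B p) (carrier (tensor H A))"
proof (rule inj_onI)
  fix X Y assume XY: "X \<in> carrier (tensor H A)" "Y \<in> carrier (tensor H A)" "id_tensor A B p X = id_tensor A B p Y"
  have "coord A i X = coord A i Y" for i
    using coord_id_tensor[OF XY(1), of i] coord_id_tensor[OF XY(2), of i] XY assms
    by (auto dest!: inj_onD intro: coord_closed[OF A])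
  then show "X = Y" using XY by (intro coord_eqI[OF A])
qed

end

end

section \<open>Exact sequences between the kernels in a commutative square\<close>

text \<open>A commutative square with rows \<open>\<beta>' : T' \<rightarrow> A\<close> and \<open>\<beta> : T \<rightarrow> B\<close> and columns \<open>d : T' \<rightarrow> T\<close> and
\<open>p : A \<rightarrow> B\<close>. The column \<open>d\<close> restricts to the kernels \<open>K'\<close> and \<open>K\<close> of the rows.\<close>

locale morphism_square =
  p: group_hom A B p + d: group_hom T' T d + b': group_hom T' A \<beta>' + b: group_hom T B \<beta>
  for A :: "('a, 'm) monoid_scheme" and B :: "('b, 'n) monoid_scheme" and p
    and T' :: "('c, 'o) monoid_scheme" and T :: "('d, 'q) monoid_scheme" and d \<beta>' \<beta> +
  assumes commutes: "X \<in> carrier T' \<Longrightarrow> \<beta> (d X) = p (\<beta>' X)"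
begin

abbreviation "K' \<equiv> T'\<lparr>carrier := kernel T' A \<beta>'\<rparr>"
abbreviation "K \<equiv> T\<lparr>carrier := kernel T B \<beta>\<rparr>"

lemma group_K': "group K'"
  using b'.subgroup_kernel by (rule subgroup.subgroup_is_group) (rule d.G.is_group)

lemma group_K: "group K"
  using b.subgroup_kernel by (rule subgroup.subgroup_is_group) (rule d.H.is_group)

lemma d_hom: "d \<in> hom K' K"
  by (rule homI) (auto simp: kernel_def commutes)

text \<open>If \<open>d\<close> is bijective, then \<open>\<beta>'\<close> after the inverse of \<open>d\<close> maps \<open>K\<close> to the kernel of \<open>p\<close>, with kernel
\<open>d(K')\<close>; it is onto when \<open>\<beta>'\<close> is. Here \<open>s\<close> identifies \<open>C\<close> with the kernel of \<open>p\<close>.\<close>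

lemma short_exact_cokernel:
  assumes C: "group C" and s: "s \<in> mon C A" "s ` carrier C = kernel A B p"
    and inj: "inj_on d (carrier T')" and surj: "d ` carrier T' = carrier T"
    and bracket_surj: "\<beta>' ` carrier T' = carrier A"
  shows "\<exists>f. short_exact K' K C d f"
proof -
  interpret C: group C by (rule C)
  interpret s: group_hom C A s using s(1) by unfold_locales (simp add: mon_def)
  have s_inj: "inj_on s (carrier C)" using s(1) by (simp add: mon_def)
  define f where "f X = inv_into (carrier C) s (\<beta>' (inv_into (carrier T') d X))" for X
  have f: "f (d X) = c" if "X \<in> carrier T'" "c \<in> carrier C" "\<beta>' X = s c" for X c
    using that inj s_inj by (simp add: f_def)
  have lift: "\<exists>Y\<in>carrier T'. \<exists>c\<in>carrier C. X = d Y \<and> \<beta>' Y = s c" if "X \<in> carrier K" for X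
  proof -
    have X: "X \<in> carrier T" "\<beta> X = \<one>\<^bsub>B\<^esub>" using that by (simp_all add: kernel_def)
    then obtain Y where Y: "Y \<in> carrier T'" "X = d Y" using surj by blast
    then have "\<beta>' Y \<in> kernel A B p" using X commutes by (simp add: kernel_def)
    then obtain c where "c \<in> carrier C" "\<beta>' Y = s c" using s(2) by blast
    then show ?thesis using Y by blast
  qed
  have f_hom: "f \<in> hom K C"
  proof (rule homI)
    show "f X \<in> carrier C" if "X \<in> carrier K" for X
      using lift[OF that] f by auto
    fix X X' assume "X \<in> carrier K" "X' \<in> carrier K"
    then obtain Y c Y' c' where "Y \<in> carrier T'" "c \<in> carrier C" "X = d Y" "\<beta>' Y = s c"
      "Y' \<in> carrier T'" "c' \<in> carrier C" "X' = d Y'" "\<beta>' Y' = s c'"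
      using lift by meson
    then show "f (X \<otimes>\<^bsub>K\<^esub> X') = f X \<otimes>\<^bsub>C\<^esub> f X'"
      using f[of "Y \<otimes>\<^bsub>T'\<^esub> Y'" "c \<otimes>\<^bsub>C\<^esub> c'"] f[of Y c] f[of Y' c'] by simp
  qed
  have "f ` carrier K = carrier C"
  proof
    show "f ` carrier K \<subseteq> carrier C" using hom_in_carrier[OF f_hom] by (rule image_subsetI)
    show "carrier C \<subseteq> f ` carrier K"
    proof
      fix c assume c: "c \<in> carrier C"
      then obtain Y where Y: "Y \<in> carrier T'" "\<beta>' Y = s c"
        using bracket_surj s.hom_closed[OF c] by (metis imageE)
      have "s c \<in> kernel A B p" using c s(2) by blast
      then have "d Y \<in> carrier K" using Y commutes by (simp add: kernel_def)
      then show "c \<in> f ` carrier K" using f[OF Y(1) c Y(2)] by (metis imageI)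
    qed
  qed
  moreover have "d ` carrier K' = kernel K C f"
  proof
    show "d ` carrier K' \<subseteq> kernel K C f"
      using hom_in_carrier[OF d_hom] f[OF _ C.one_closed] by (auto simp: kernel_def)
    show "kernel K C f \<subseteq> d ` carrier K'"
    proof
      fix X assume X: "X \<in> kernel K C f"
      then obtain Y c where Yc: "Y \<in> carrier T'" "c \<in> carrier C" "X = d Y" "\<beta>' Y = s c"
        using lift[of X] by (auto simp: kernel_def)
      then have "c = \<one>\<^bsub>C\<^esub>" using X f by (auto simp: kernel_def)
      then show "X \<in> d ` carrier K'" using Yc by (auto simp: kernel_def)
    qed
  qed
  moreover have "inj_on d (carrier K')"
    by (rule inj_on_subset[OF inj]) (auto simp: kernel_def)
  ultimately show ?thesis
    unfolding short_exact_def using group_K group_K' C d_hom f_hom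
    by (intro exI[of _ f]) (simp add: mon_def epi_def)
qed

text \<open>If \<open>p\<close> is injective, then \<open>K'\<close> is the full preimage of \<open>K\<close> under \<open>d\<close>, so passing to \<open>K'\<close> and \<open>K\<close>
changes neither the kernel of \<open>d\<close> nor its surjectivity.\<close>

lemma short_exact_kernel:
  assumes C: "group C" and g: "g \<in> mon C T'" "g ` carrier C = kernel T' T d"
    and inj: "inj_on p (carrier A)" and surj: "d ` carrier T' = carrier T"
  shows "short_exact C K' K g d"
proof -
  have ker: "X \<in> carrier K'" if X: "X \<in> carrier T'" "d X \<in> carrier K" for X
  proof -
    have "p (\<beta>' X) = p \<one>\<^bsub>A\<^esub>" using X commutes[OF X(1)] by (simp add: kernel_def)
    then have "\<beta>' X = \<one>\<^bsub>A\<^esub>"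
      by (rule inj_onD[OF inj]) (use X(1) in simp_all)
    then show ?thesis using X by (simp add: kernel_def)
  qed
  have one: "\<one>\<^bsub>T\<^esub> \<in> carrier K" by (simp add: kernel_def)
  have "kernel K' K d = kernel T' T d"
  proof
    show "kernel K' K d \<subseteq> kernel T' T d" by (auto simp: kernel_def)
    show "kernel T' T d \<subseteq> kernel K' K d"
      using ker one by (auto simp: kernel_def[of K'] kernel_def[of T' T]) 
  qed
  moreover have "g \<in> mon C K'"
  proof -
    have "g c \<in> carrier K'" if "c \<in> carrier C" for c
    proof -
      have "g c \<in> kernel T' T d" using that g(2) by blast
      then show ?thesis using ker one by (simp add: kernel_def[of T' T])
    qed
    then show ?thesis
      using g(1) by (auto simp: mon_def hom_def)
  qed
  moreover have "d ` carrier K' = carrier K"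
  proof
    show "d ` carrier K' \<subseteq> carrier K" using hom_in_carrier[OF d_hom] by (rule image_subsetI)
    show "carrier K \<subseteq> d ` carrier K'"
    proof
      fix X assume X: "X \<in> carrier K"
      then have "X \<in> d ` carrier T'" using surj by (simp add: kernel_def)
      then show "X \<in> d ` carrier K'" using ker X by blast
    qed
  qed
  ultimately show ?thesis
    unfolding short_exact_def using group_K group_K' C d_hom g(2) by (simp add: epi_def)
qed

end

section \<open>The two exact sequences\<close>

context based_free_abelian_group
begin

lemma comm_group_tensor_degree: 
  "comm_group (tensor H (L' k H))" "comm_group (tensor H (L k H))"
  by (intro comm_group_tensor comm_group_H q.comm_group_degree_part l.comm_group_degree_part)+

lemma D_canonical_eq_id_tensor: "D_canonical H m = id_tensor (L' (m + 1) H) (L (m + 1) H) proj"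
  by (simp add: D_canonical_def)

lemma canonical_morphism_square: "morphism_square (L' (m + 2) H) (L (m + 2) H) proj
    (tensor H (L' (m + 1) H)) (tensor H (L (m + 1) H)) (D_canonical H m)
    (bracket_map H (quasi_lie_ideal H) m) (bracket_map H (lie_ideal H) m)"
proof -
  note groups = comm_group.axioms(2)[OF q.comm_group_degree_part] comm_group.axioms(2)[OF l.comm_group_degree_part]
    comm_group_tensor_degree[THEN comm_group.axioms(2)]
  show ?thesis
    by (intro morphism_square.intro morphism_square_axioms.intro group_hom.intro group_hom_axioms.intro groups
        proj_hom D_canonical_tensor_hom[OF comm_group_H] q.bracket_map_hom l.bracket_map_hom
        bracket_map_D_canonical[OF comm_group_H])
qed

lemma proj_inj_odd: "odd k \<Longrightarrow> inj_on proj (carrier (L' k H))"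
proof -
  assume k: "odd k"
  interpret p: group_hom "L' k H" "L k H" proj
    by (intro group_hom.intro group_hom_axioms.intro proj_hom
        comm_group.axioms(2)[OF q.comm_group_degree_part] comm_group.axioms(2)[OF l.comm_group_degree_part])
  show ?thesis
    using proj_eq_one_odd[OF _ _ k] p.inj_on_one_iff by blast
qed

lemma lifted_square_mod_two:
  obtains s where "s \<in> mon (tensor (L k H) (integer_mod_group 2)) (L' (2 * k) H)"
    "s ` carrier (tensor (L k H) (integer_mod_group 2)) = kernel (L' (2 * k) H) (L (2 * k) H) proj"
proof -
  interpret C: mod_two_tensor "L k H"
    by (rule mod_two_tensor.intro[OF l.comm_group_degree_part])
  from C.mod_two_lift[OF q.comm_group_degree_part lifted_square_hom lifted_square_torsion lifted_square_eq_one] show thesis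
    using that unfolding lifted_square_image by blast
qed

text \<open>Tensoring with the free group \<open>H\<close> preserves the exact sequence
\<open>0 \<rightarrow> L\<^sub>k \<otimes> \<int>/2 \<rightarrow> L'\<^sub>2\<^sub>k \<rightarrow> L\<^sub>2\<^sub>k\<close>: each step is checked in coordinates.\<close>

lemma tensor_lifted_square_mod_two:
  obtains g where
    "g \<in> mon (tensor (tensor H (L k H)) (integer_mod_group 2)) (tensor H (L' (2 * k) H))"
    "g ` carrier (tensor (tensor H (L k H)) (integer_mod_group 2))
       = kernel (tensor H (L' (2 * k) H)) (tensor H (L (2 * k) H)) (id_tensor (L' (2 * k) H) (L (2 * k) H) proj)"
proof -
  let ?L = "L k H" and ?A = "L' (2 * k) H" and ?B = "L (2 * k) H"
  have L: "comm_group ?L" and A: "comm_group ?A" and B: "comm_group ?B"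
    by (rule q.comm_group_degree_part l.comm_group_degree_part)+
  interpret L: comm_group ?L by (rule L)
  interpret A: comm_group ?A by (rule A)
  interpret B: comm_group ?B by (rule B)
  interpret TA: comm_group "tensor H ?A" by (rule comm_group_tensor_degree)
  interpret TL: comm_group "tensor H ?L" by (rule comm_group_tensor_degree)
  interpret TB: comm_group "tensor H ?B" by (rule comm_group_tensor_degree)
  interpret C: mod_two_tensor "tensor H ?L"
    by (rule mod_two_tensor.intro[OF comm_group_tensor_degree(2)])
  let ?u = "id_tensor ?L ?A (lifted_square k)" and ?p = "id_tensor ?A ?B proj"
  note u_hom = id_tensor_hom[OF L A lifted_square_hom]
  note u_closed = hom_in_carrier[OF u_hom]
  have coord_one: "coord ?A i \<one>\<^bsub>tensor H ?A\<^esub> = \<one>\<^bsub>?A\<^esub>" for i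
    by (rule hom_one[OF coord_hom[OF A] TA.is_group A.is_group])
  have torsion: "?u X \<otimes>\<^bsub>tensor H ?A\<^esub> ?u X = \<one>\<^bsub>tensor H ?A\<^esub>" if X: "X \<in> carrier (tensor H ?L)" for X
  proof (rule coord_eqI[OF A])
    show "coord ?A i (?u X \<otimes>\<^bsub>tensor H ?A\<^esub> ?u X) = coord ?A i \<one>\<^bsub>tensor H ?A\<^esub>" for i
      unfolding coord_one hom_mult[OF coord_hom[OF A] u_closed[OF X] u_closed[OF X]]
        coord_id_tensor[OF L A lifted_square_hom X]
      by (rule lifted_square_torsion[OF coord_closed[OF L X]])
  qed (simp_all add: u_closed[OF X])
  have divisible: "\<exists>W\<in>carrier (tensor H ?L). X = W \<otimes>\<^bsub>tensor H ?L\<^esub> W"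
    if X: "X \<in> carrier (tensor H ?L)" "?u X = \<one>\<^bsub>tensor H ?A\<^esub>" for X
  proof -
    have "\<forall>i. \<exists>w\<in>carrier ?L. coord ?L i X = w \<otimes>\<^bsub>?L\<^esub> w"
      using lifted_square_eq_one[OF coord_closed[OF L X(1)] id_tensor_eq_one[OF L A lifted_square_hom X]] by blast
    then obtain w where w: "\<And>i. w i \<in> carrier ?L" "\<And>i. coord ?L i X = w i \<otimes>\<^bsub>?L\<^esub> w i"
      by metis
    have "X = combine ?L (\<lambda>i. coord ?L i X)" by (rule combine_coord[OF L X(1), symmetric])
    also have "\<dots> = combine ?L w \<otimes>\<^bsub>tensor H ?L\<^esub> combine ?L w"
      unfolding w(2) by (rule combine_mult[OF L w(1) w(1)])
    finally show ?thesis by (rule bexI[OF _ combine_closed[OF L w(1)]])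
  qed
  have image: "?u ` carrier (tensor H ?L) = kernel (tensor H ?A) (tensor H ?B) ?p"
  proof
    show "?u ` carrier (tensor H ?L) \<subseteq> kernel (tensor H ?A) (tensor H ?B) ?p"
    proof (rule image_subsetI)
      fix X assume X: "X \<in> carrier (tensor H ?L)"
      have "?p (?u X) = \<one>\<^bsub>tensor H ?B\<^esub>"
      proof (rule coord_eqI[OF B])
        fix i
        have "lifted_square k (coord ?L i X) \<in> kernel ?A ?B proj"
          using coord_closed[OF L X] lifted_square_image by blast
        then show "coord ?B i (?p (?u X)) = coord ?B i \<one>\<^bsub>tensor H ?B\<^esub>"
          using hom_one[OF coord_hom[OF B] TB.is_group B.is_group]
          by (simp add: coord_id_tensor[OF A B proj_hom u_closed[OF X]] coord_id_tensor[OF L A lifted_square_hom X] kernel_def)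
      qed (simp_all add: hom_in_carrier[OF id_tensor_hom[OF A B proj_hom] u_closed[OF X]])
      then show "?u X \<in> kernel (tensor H ?A) (tensor H ?B) ?p"
        using u_closed[OF X] by (simp add: kernel_def)
    qed
    show "kernel (tensor H ?A) (tensor H ?B) ?p \<subseteq> ?u ` carrier (tensor H ?L)"
    proof
      fix X assume "X \<in> kernel (tensor H ?A) (tensor H ?B) ?p"
      then have X: "X \<in> carrier (tensor H ?A)" "?p X = \<one>\<^bsub>tensor H ?B\<^esub>" by (simp_all add: kernel_def)
      have "\<forall>i. \<exists>c\<in>carrier ?L. coord ?A i X = lifted_square k c"
      proof
        fix i
        have "coord ?A i X \<in> kernel ?A ?B proj"
          using coord_closed[OF A X(1)] id_tensor_eq_one[OF A B proj_hom X] by (simp add: kernel_def)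
        then show "\<exists>c\<in>carrier ?L. coord ?A i X = lifted_square k c" using lifted_square_image by blast
      qed
      then obtain c where c: "\<And>i. c i \<in> carrier ?L" "\<And>i. coord ?A i X = lifted_square k (c i)" by metis
      have "X = combine ?A (\<lambda>i. coord ?A i X)" by (rule combine_coord[OF A X(1), symmetric])
      also have "\<dots> = ?u (combine ?L c)"
        unfolding c(2) by (rule id_tensor_combine[OF L A lifted_square_hom c(1), symmetric])
      finally show "X \<in> ?u ` carrier (tensor H ?L)"
        by (rule image_eqI[OF _ combine_closed[OF L c(1)]])
    qed
  qed
  from C.mod_two_lift[OF comm_group_tensor_degree(1) u_hom torsion divisible] show thesis
    using that unfolding image by blast
qed

theorem even_sequence:
  "\<exists>f. short_exact (D' (2 * k) H) (D (2 * k) H) (tensor (L (k + 1) H) (integer_mod_group 2))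
         (D_canonical H (2 * k)) f"
proof -
  let ?A = "L' (2 * k + 1) H" and ?B = "L (2 * k + 1) H"
  interpret ms: morphism_square "L' (2 * k + 2) H" "L (2 * k + 2) H" proj
    "tensor H ?A" "tensor H ?B" "D_canonical H (2 * k)"
    "bracket_map H (quasi_lie_ideal H) (2 * k)" "bracket_map H (lie_ideal H) (2 * k)"
    by (rule canonical_morphism_square)
  obtain s where "s \<in> mon (tensor (L (k + 1) H) (integer_mod_group 2)) (L' (2 * (k + 1)) H)"
    "s ` carrier (tensor (L (k + 1) H) (integer_mod_group 2)) = kernel (L' (2 * (k + 1)) H) (L (2 * (k + 1)) H) proj"
    by (rule lifted_square_mod_two)
  then have s: "s \<in> mon (tensor (L (k + 1) H) (integer_mod_group 2)) (L' (2 * k + 2) H)"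
    "s ` carrier (tensor (L (k + 1) H) (integer_mod_group 2)) = kernel (L' (2 * k + 2) H) (L (2 * k + 2) H) proj"
    by (simp_all add: distrib_left)
  have C: "group (tensor (L (k + 1) H) (integer_mod_group 2))"
    by (intro comm_group.axioms(2) comm_group_tensor l.comm_group_degree_part abelian_integer_mod_group)
  have inj: "inj_on (D_canonical H (2 * k)) (carrier (tensor H ?A))"
    unfolding D_canonical_eq_id_tensor
    by (rule id_tensor_inj[OF q.comm_group_degree_part l.comm_group_degree_part proj_hom proj_inj_odd]) simp
  have surj: "D_canonical H (2 * k) ` carrier (tensor H ?A) = carrier (tensor H ?B)"
    unfolding D_canonical_eq_id_tensor
    by (rule id_tensor_surj[OF q.comm_group_degree_part l.comm_group_degree_part proj_hom proj_image])
  show ?thesis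
    unfolding bracket_kernel_def
    by (rule ms.short_exact_cokernel[OF C s inj surj bracket_map_quasi_lie_surj])
qed

theorem odd_sequence:
  assumes "k \<ge> 1"
  shows "\<exists>g. short_exact (tensor (tensor H (L k H)) (integer_mod_group 2))
           (D' (2 * k - 1) H) (D (2 * k - 1) H) g (D_canonical H (2 * k - 1))"
proof -
  define m where "m = 2 * k - 1"
  have m: "m + 1 = 2 * k" "odd (m + 2)" using assms by (auto simp: m_def)
  let ?A = "L' (m + 1) H" and ?B = "L (m + 1) H"
  interpret ms: morphism_square "L' (m + 2) H" "L (m + 2) H" proj
    "tensor H ?A" "tensor H ?B" "D_canonical H m"
    "bracket_map H (quasi_lie_ideal H) m" "bracket_map H (lie_ideal H) m"
    by (rule canonical_morphism_square)
  obtain g where "g \<in> mon (tensor (tensor H (L k H)) (integer_mod_group 2)) (tensor H (L' (2 * k) H))"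
    "g ` carrier (tensor (tensor H (L k H)) (integer_mod_group 2))
       = kernel (tensor H (L' (2 * k) H)) (tensor H (L (2 * k) H)) (id_tensor (L' (2 * k) H) (L (2 * k) H) proj)"
    by (rule tensor_lifted_square_mod_two)
  then have g: "g \<in> mon (tensor (tensor H (L k H)) (integer_mod_group 2)) (tensor H ?A)"
    "g ` carrier (tensor (tensor H (L k H)) (integer_mod_group 2))
       = kernel (tensor H ?A) (tensor H ?B) (D_canonical H m)"
    by (simp_all only: m D_canonical_eq_id_tensor)
  have C: "group (tensor (tensor H (L k H)) (integer_mod_group 2))"
    by (intro comm_group.axioms(2) comm_group_tensor[OF comm_group_tensor_degree(2)] abelian_integer_mod_group)
  have surj: "D_canonical H m ` carrier (tensor H ?A) = carrier (tensor H ?B)"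
    unfolding D_canonical_eq_id_tensor
    by (rule id_tensor_surj[OF q.comm_group_degree_part l.comm_group_degree_part proj_hom proj_image])
  have "short_exact (tensor (tensor H (L k H)) (integer_mod_group 2)) (D' m H) (D m H) g (D_canonical H m)"
    unfolding bracket_kernel_def
    by (rule ms.short_exact_kernel[OF C g proj_inj_odd[OF m(2)] surj])
  then show ?thesis unfolding m_def by blast
qed

end

theorem corollary2p3:
  fixes H :: "('a, 'm) monoid_scheme" and k :: nat
  assumes "fg_free_abelian_group H" and "k \<ge> 1"
  shows "(\<exists>f. short_exact (D' (2 * k) H) (D (2 * k) H)
                (tensor (L (k + 1) H) (integer_mod_group 2))
                (D_canonical H (2 * k)) f) \<and>
         (\<exists>g. short_exact (tensor (tensor H (L k H)) (integer_mod_group 2))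
                (D' (2 * k - 1) H) (D (2 * k - 1) H)
                g (D_canonical H (2 * k - 1)))"
proof -
  obtain n \<phi> where "comm_group H" "\<phi> \<in> iso (free_Abelian_group {..<n::nat}) H"
    using assms(1) by (auto simp: fg_free_abelian_group_def is_iso_def)
  then interpret based_free_abelian_group H n \<phi> by (rule based_free_abelian_group.intro)
  show ?thesis using even_sequence odd_sequence[OF assms(2)] by blast
qed

end
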